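(* Let $M$ be an $n$-dimensional smooth manifold, $n\geqslant3$, and let $(\overline g(t),\overline w(t))$ be a gradient soliton to the extended Ricci flow on $M$ with potential function $\overline f$ (steady, shrinking or expanding). Let $\mathscr F=\{\Sigma_t\}$ be a mean curvature flow in the $(\overline g,\overline w)$-extended Ricci flow background. Let $dA_{\overline g}$ be the $(n-1)$-dimensional Riemannian measure on $\Sigma_t$ induced by $\overline g(t)$ and set $\mathrm{Area}_{\overline f}(\Sigma_t)=\int_{\Sigma_t}e^{-\overline f}dA_{\overline g}$. Define, for $t$ in the time interval of the flow, (i) $\Phi(t)=\mathrm{Area}_{\overline f}(\Sigma_t)$ in the steady case ($t\in\mathbb R$); (ii) $\Phi(t)=(-t)^{-(n-1)/2}\mathrm{Area}_{\overline f}(\Sigma_t)$ in the shrinking case ($t\in(-\infty,0)$); (iii) $\Phi(t)=t^{-(n-1)/2}\mathrm{Area}_{\overline f}(\Sigma_t)$ in the expanding case ($t\in(0,\infty)$). Then $\Phi$ is nonincreasing in $t$. Moreover, $\Phi$ is constant if and only if $\mathscr F$ is a family of mean curvature solitons, i.e. $H(p,t)+e(p,t)\overline f=0$ for all $p\in\Sigma_t$ and all $t$.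
   Context: Manifolds are orientable and connected; $\alpha_n=\frac{n-1}{n-2}$. The extended Ricci flow is $\partial_tg=-2\mathrm{Ric}_{g}+2\alpha_n\,dw\otimes dw$, $\partial_tw=\Delta_{g}w$, for a metric $g(t)$ and a function $w(t)$ on $M$. Gradient soliton (normalized): a solution of the extended Ricci flow of the form $\overline g(t)=\sigma(t)\psi_t^*g$, $\overline w(t)=\psi_t^*w$, where $(g,w)$ is a fixed metric and function, $f\in C^\infty(M)$, and $\psi_t$ is the one-parameter family of diffeomorphisms of $M$ generated by $\nabla_gf/\sigma(t)$; steady: $\sigma(t)=1$, $t\in\mathbb R$, $\psi_0=\mathrm{Id}$; shrinking: $\sigma(t)=-t$, $t\in(-\infty,0)$, $\psi_{-1}=\mathrm{Id}$; expanding: $\sigma(t)=t$, $t\in(0,\infty)$, $\psi_1=\mathrm{Id}$. The potential function is $\overline f(t)=\psi_t^*f$. Equivalently $\mathrm{Ric}_{\overline g}+\nabla^2_{\overline g}\overline f-\alpha_nd\overline w\otimes d\overline w=\frac{c}{2t}\overline g$ and $\Delta_{\overline g}\overline w=\langle\nabla\overline f,\nabla\overline w\rangle$, with $c=0$ (steady; right side read as $0$) and $c=-1$ (shrinking and expanding), and $\partial_t\overline f=|\nabla_{\overline g}\overline f|^2_{\overline g}$. Mean curvature flow in the background: a smooth family of immersions $x(\cdot,t)$ of a compact boundaryless $(n-1)$-manifold $\Sigma$ into $M$ with $\frac{\partial}{\partial t}x(p,t)=H(p,t)e(p,t)$, where $e$ is the (inward) unit normal of $\Sigma_t=x_t(\Sigma)$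 in $(M,\overline g(t))$ and $H$ is the trace of the second fundamental form $\mathcal A(X,Y)=\overline g(\nabla_XY,e)$. Integrals over $\Sigma_t$ are taken over $\Sigma$ via $x_t$. *)

theory Defs
  imports "HOL-Analysis.Analysis"
begin

section \<open>Smooth functions between normed spaces\<close>

primrec Ck_on :: "nat \<Rightarrow> 'a::real_normed_vector set \<Rightarrow> ('a \<Rightarrow> 'b::real_normed_vector) \<Rightarrow> bool" where
  "Ck_on 0 U f \<longleftrightarrow> continuous_on U f"
| "Ck_on (Suc k) U f \<longleftrightarrow>
     f differentiable_on U \<and> (\<forall>v. Ck_on k U (\<lambda>x. frechet_derivative f (at x) v))"

text \<open>
  On an arbitrary set, smoothness means local extendability to a smooth function on an open
  set. For open sets this is the usual notion. The general form is needed for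
  time intervals that contain one of their end points.
\<close>

definition smooth_on :: "'a::real_normed_vector set \<Rightarrow> ('a \<Rightarrow> 'b::real_normed_vector) \<Rightarrow> bool" where
  "smooth_on S f \<longleftrightarrow>
     (\<forall>x\<in>S. \<exists>U h. open U \<and> x \<in> U \<and> (\<forall>k. Ck_on k U h) \<and> (\<forall>y\<in>U \<inter> S. h y = f y))"


section \<open>Smooth manifolds\<close>

text \<open>
  A manifold is a type whose topology is Hausdorff and second countable, with an atlas of
  charts. A chart is a pair of its domain and its coordinate map; the values of
  the coordinate map outside of the domain are irrelevant.
\<close>

type_synonym ('m, 'n) chart = "'m set \<times> ('m \<Rightarrow> real ^ 'n)"

abbreviation pt :: "('m, 'n) chart \<Rightarrow> real ^ 'n \<Rightarrow> 'm" where
  "pt c \<equiv> inv_into (fst c) (snd c)"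

abbreviation cimg :: "('m, 'n) chart \<Rightarrow> (real ^ 'n) set" where
  "cimg c \<equiv> snd c ` fst c"

definition charts_at :: "('m, 'n) chart set \<Rightarrow> 'm \<Rightarrow> ('m, 'n) chart set" where
  "charts_at A p = {c \<in> A. p \<in> fst c}"

definition chart_at :: "('m, 'n) chart set \<Rightarrow> 'm \<Rightarrow> ('m, 'n) chart" where
  "chart_at A p = (SOME c. c \<in> charts_at A p)"

definition smooth_atlas :: "('m::topological_space, 'n::finite) chart set \<Rightarrow> bool" where
  "smooth_atlas A \<longleftrightarrow>
     (\<forall>c\<in>A. open (fst c) \<and> open (cimg c) \<and> homeomorphism (fst c) (cimg c) (snd c) (pt c)) \<and>
     (\<Union>c\<in>A. fst c) = UNIV \<and>
     (\<forall>c\<in>A. \<forall>d\<in>A. smooth_on (snd c ` (fst c \<inter> fst d)) (snd d \<circ> pt c))"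

text \<open>Jacobian matrix at \<open>p\<close> of the transition map from \<open>c\<close> to \<open>d\<close>.\<close>

definition trans_jac :: "('m, 'n::finite) chart \<Rightarrow> ('m, 'n) chart \<Rightarrow> 'm \<Rightarrow> real ^ 'n ^ 'n" where
  "trans_jac c d p = jacobian (snd d \<circ> pt c) (at (snd c p))"

definition orientable :: "('m::topological_space, 'n::finite) chart set \<Rightarrow> bool" where
  "orientable A \<longleftrightarrow>
     (\<exists>C. smooth_atlas C \<and> smooth_atlas (A \<union> C) \<and>
        (\<forall>c\<in>C. \<forall>d\<in>C. \<forall>p\<in>fst c \<inter> fst d. det (trans_jac c d p) > 0))"

definition manifold :: "('m::{t2_space, second_countable_topology}, 'n::finite) chart set \<Rightarrow> bool" where
  "manifold A \<longleftrightarrow> smooth_atlas A \<and> connected (UNIV :: 'm set) \<and> orientable A"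

definition smooth_map ::
  "('a::topological_space, 'k::finite) chart set \<Rightarrow> ('m::topological_space, 'n::finite) chart set
     \<Rightarrow> ('a \<Rightarrow> 'm) \<Rightarrow> bool" where
  "smooth_map B A F \<longleftrightarrow>
     continuous_on UNIV F \<and>
     (\<forall>b\<in>B. \<forall>c\<in>A. smooth_on (snd b ` (fst b \<inter> F -` fst c)) (snd c \<circ> F \<circ> pt b))"

definition diffeomorphism :: "('m::topological_space, 'n::finite) chart set \<Rightarrow> ('m \<Rightarrow> 'm) \<Rightarrow> bool" where
  "diffeomorphism A F \<longleftrightarrow> bij F \<and> smooth_map A A F \<and> smooth_map A A (inv F)"

definition smooth_family ::
  "('a::topological_space, 'k::finite) chart set \<Rightarrow> ('m::topological_space, 'n::finite) chart set
     \<Rightarrow> real set \<Rightarrow> (real \<Rightarrow> 'a \<Rightarrow> 'm) \<Rightarrow> bool" where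
  "smooth_family B A I F \<longleftrightarrow>
     continuous_on (I \<times> UNIV) (\<lambda>(t, p). F t p) \<and>
     (\<forall>b\<in>B. \<forall>c\<in>A. smooth_on {(t, u). t \<in> I \<and> u \<in> cimg b \<and> F t (pt b u) \<in> fst c}
        (\<lambda>(t, u). snd c (F t (pt b u))))"

definition smooth_fun :: "('m, 'n::finite) chart set \<Rightarrow> ('m \<Rightarrow> real) \<Rightarrow> bool" where
  "smooth_fun A f \<longleftrightarrow> (\<forall>c\<in>A. smooth_on (cimg c) (f \<circ> pt c))"

definition smooth_fun_family ::
  "('m, 'n::finite) chart set \<Rightarrow> real set \<Rightarrow> (real \<Rightarrow> 'm \<Rightarrow> real) \<Rightarrow> bool" where
  "smooth_fun_family A I w \<longleftrightarrow> (\<forall>c\<in>A. smooth_on (I \<times> cimg c) (\<lambda>(t, u). w t (pt c u)))"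


section \<open>Riemannian metrics\<close>

text \<open>
  A tensor field is given by its components in every chart. Thus \<open>g c p\<close> is the Gram matrix
  of the coordinate vector fields of the chart \<open>c\<close> at the point \<open>p\<close>, and the
  components in different charts are related by the tensor transformation law.
\<close>

type_synonym ('m, 'n) metric = "('m, 'n) chart \<Rightarrow> 'm \<Rightarrow> real ^ 'n ^ 'n"

definition riemannian_metric :: "('m, 'n::finite) chart set \<Rightarrow> ('m, 'n) metric \<Rightarrow> bool" where
  "riemannian_metric A g \<longleftrightarrow>
     (\<forall>c\<in>A. \<forall>p\<in>fst c. transpose (g c p) = g c p \<and> (\<forall>v. v \<noteq> 0 \<longrightarrow> v \<bullet> (g c p *v v) > 0)) \<and>
     (\<forall>c\<in>A. \<forall>d\<in>A. \<forall>p\<in>fst c \<inter> fst d.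
        g c p = transpose (trans_jac c d p) ** g d p ** trans_jac c d p) \<and>
     (\<forall>c\<in>A. smooth_on (cimg c) (g c \<circ> pt c))"

definition metric_family ::
  "('m, 'n::finite) chart set \<Rightarrow> real set \<Rightarrow> (real \<Rightarrow> ('m, 'n) metric) \<Rightarrow> bool" where
  "metric_family A I g \<longleftrightarrow>
     (\<forall>t\<in>I. riemannian_metric A (g t)) \<and>
     (\<forall>c\<in>A. smooth_on (I \<times> cimg c) (\<lambda>(t, u). g t c (pt c u)))"

text \<open>
  Components of the pullback of a metric. They do not depend on the chart \<open>c\<close> of
  the target that is used for computing them.
\<close>

definition pullback_metric ::
  "('m, 'n::finite) chart set \<Rightarrow> ('a \<Rightarrow> 'm) \<Rightarrow> ('m, 'n) metric \<Rightarrow> ('a, 'k::finite) metric" where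
  "pullback_metric A F g b p =
     (let c = chart_at A (F p); J = jacobian (snd c \<circ> F \<circ> pt b) (at (snd b p))
      in transpose J ** g c (F p) ** J)"

text \<open>
  The following are the classical formulas in local coordinates. \<open>G\<close> is the matrix
  of the metric and \<open>h\<close> a function, both as functions of the coordinates.
\<close>

definition pd :: "'n \<Rightarrow> (real ^ 'n::finite \<Rightarrow> 'b::real_normed_vector) \<Rightarrow> real ^ 'n \<Rightarrow> 'b" where
  "pd i h u = frechet_derivative h (at u) (axis i 1)"

definition christoffel ::
  "(real ^ 'n::finite \<Rightarrow> real ^ 'n ^ 'n) \<Rightarrow> 'n \<Rightarrow> 'n \<Rightarrow> 'n \<Rightarrow> real ^ 'n \<Rightarrow> real" where
  "christoffel G k i j u =
     (1/2) * (\<Sum>l\<in>UNIV. matrix_inv (G u) $ k $ l *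
       (pd i (\<lambda>y. G y $ j $ l) u + pd j (\<lambda>y. G y $ i $ l) u - pd l (\<lambda>y. G y $ i $ j) u))"

definition ricci_coord ::
  "(real ^ 'n::finite \<Rightarrow> real ^ 'n ^ 'n) \<Rightarrow> real ^ 'n \<Rightarrow> real ^ 'n ^ 'n" where
  "ricci_coord G u = (\<chi> i j.
     (\<Sum>k\<in>UNIV. pd k (christoffel G k i j) u - pd j (christoffel G k i k) u) +
     (\<Sum>k\<in>UNIV. \<Sum>l\<in>UNIV. christoffel G k k l u * christoffel G l i j u
                          - christoffel G k j l u * christoffel G l i k u))"

definition laplacian_coord ::
  "(real ^ 'n::finite \<Rightarrow> real ^ 'n ^ 'n) \<Rightarrow> (real ^ 'n \<Rightarrow> real) \<Rightarrow> real ^ 'n \<Rightarrow> real" where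
  "laplacian_coord G h u = (\<Sum>i\<in>UNIV. \<Sum>j\<in>UNIV. matrix_inv (G u) $ i $ j *
     (pd i (pd j h) u - (\<Sum>k\<in>UNIV. christoffel G k i j u * pd k h u)))"

definition gradient_coord ::
  "(real ^ 'n::finite \<Rightarrow> real ^ 'n ^ 'n) \<Rightarrow> (real ^ 'n \<Rightarrow> real) \<Rightarrow> real ^ 'n \<Rightarrow> real ^ 'n" where
  "gradient_coord G h u = matrix_inv (G u) *v (\<chi> i. pd i h u)"

definition ricci :: "('m, 'n::finite) metric \<Rightarrow> ('m, 'n) metric" where
  "ricci g c p = ricci_coord (g c \<circ> pt c) (snd c p)"

definition laplacian :: "('m, 'n::finite) metric \<Rightarrow> ('m \<Rightarrow> real) \<Rightarrow> ('m, 'n) chart \<Rightarrow> 'm \<Rightarrow> real" where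
  "laplacian g w c p = laplacian_coord (g c \<circ> pt c) (w \<circ> pt c) (snd c p)"

definition gradient :: "('m, 'n::finite) metric \<Rightarrow> ('m \<Rightarrow> real) \<Rightarrow> ('m, 'n) chart \<Rightarrow> 'm \<Rightarrow> real ^ 'n" where
  "gradient g f c p = gradient_coord (g c \<circ> pt c) (f \<circ> pt c) (snd c p)"

definition d_tensor_d :: "('m \<Rightarrow> real) \<Rightarrow> ('m, 'n::finite) chart \<Rightarrow> 'm \<Rightarrow> real ^ 'n ^ 'n" where
  "d_tensor_d w c p = (\<chi> i j. pd i (w \<circ> pt c) (snd c p) * pd j (w \<circ> pt c) (snd c p))"


section \<open>Extended Ricci flow and gradient solitons\<close>

definition alpha :: "nat \<Rightarrow> real" where
  "alpha n = (real n - 1) / (real n - 2)"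

definition extended_ricci_flow ::
  "('m, 'n::finite) chart set \<Rightarrow> real set \<Rightarrow> (real \<Rightarrow> ('m, 'n) metric) \<Rightarrow> (real \<Rightarrow> 'm \<Rightarrow> real) \<Rightarrow> bool" where
  "extended_ricci_flow A I g w \<longleftrightarrow>
     metric_family A I g \<and> smooth_fun_family A I w \<and>
     (\<forall>t\<in>I. \<forall>p. \<forall>c\<in>charts_at A p.
        ((\<lambda>s. g s c p) has_vector_derivative
           ((- 2) *\<^sub>R ricci (g t) c p + (2 * alpha CARD('n)) *\<^sub>R d_tensor_d (w t) c p)) (at t) \<and>
        ((\<lambda>s. w s p) has_real_derivative laplacian (g t) (w t) c p) (at t))"

datatype soliton_kind = Steady | Shrinking | Expanding

primrec time_domain :: "soliton_kind \<Rightarrow> real set" where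
  "time_domain Steady = UNIV"
| "time_domain Shrinking = {..<0}"
| "time_domain Expanding = {0<..}"

primrec soliton_scale :: "soliton_kind \<Rightarrow> real \<Rightarrow> real" where
  "soliton_scale Steady t = 1"
| "soliton_scale Shrinking t = - t"
| "soliton_scale Expanding t = t"

primrec base_time :: "soliton_kind \<Rightarrow> real" where
  "base_time Steady = 0"
| "base_time Shrinking = - 1"
| "base_time Expanding = 1"

definition gradient_soliton ::
  "('m::topological_space, 'n::finite) chart set \<Rightarrow> soliton_kind \<Rightarrow> (real \<Rightarrow> ('m, 'n) metric)
     \<Rightarrow> (real \<Rightarrow> 'm \<Rightarrow> real) \<Rightarrow> (real \<Rightarrow> 'm \<Rightarrow> real) \<Rightarrow> bool" where
  "gradient_soliton A kind gbar wbar fbar \<longleftrightarrow>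
     extended_ricci_flow A (time_domain kind) gbar wbar \<and>
     (\<exists>g w f \<psi>.
        riemannian_metric A g \<and> smooth_fun A w \<and> smooth_fun A f \<and>
        smooth_family A A (time_domain kind) \<psi> \<and>
        (\<forall>t\<in>time_domain kind. diffeomorphism A (\<psi> t)) \<and>
        \<psi> (base_time kind) = id \<and>
        (\<forall>t\<in>time_domain kind. \<forall>p. \<forall>c\<in>charts_at A (\<psi> t p).
           ((\<lambda>s. snd c (\<psi> s p)) has_vector_derivative
              (1 / soliton_scale kind t) *\<^sub>R gradient g f c (\<psi> t p)) (at t)) \<and>
        (\<forall>t\<in>time_domain kind. \<forall>p.
           (\<forall>c\<in>charts_at A p. gbar t c p = soliton_scale kind t *\<^sub>R pullback_metric A (\<psi> t) g c p) \<and>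
           wbar t p = w (\<psi> t p) \<and>
           fbar t p = f (\<psi> t p)))"


section \<open>Immersed hypersurfaces\<close>

text \<open>A vector field along a map \<open>F\<close>: \<open>v p c\<close> are the components in the chart \<open>c\<close> of a tangent
  vector at \<open>F p\<close>.\<close>

type_synonym ('a, 'm, 'n) field_along = "'a \<Rightarrow> ('m, 'n) chart \<Rightarrow> real ^ 'n"

definition vector_field_along ::
  "('m, 'n::finite) chart set \<Rightarrow> ('a \<Rightarrow> 'm) \<Rightarrow> ('a, 'm, 'n) field_along \<Rightarrow> bool" where
  "vector_field_along A F v \<longleftrightarrow>
     (\<forall>p. \<forall>c\<in>charts_at A (F p). \<forall>d\<in>charts_at A (F p). v p d = trans_jac c d (F p) *v v p c)"

definition smooth_field_family ::
  "('a, 'k::finite) chart set \<Rightarrow> ('m, 'n::finite) chart set \<Rightarrow> real set \<Rightarrow> (real \<Rightarrow> 'a \<Rightarrow> 'm)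
     \<Rightarrow> (real \<Rightarrow> ('a, 'm, 'n) field_along) \<Rightarrow> bool" where
  "smooth_field_family B A I F v \<longleftrightarrow>
     (\<forall>t\<in>I. vector_field_along A (F t) (v t)) \<and>
     (\<forall>b\<in>B. \<forall>c\<in>A. smooth_on {(t, u). t \<in> I \<and> u \<in> cimg b \<and> F t (pt b u) \<in> fst c}
        (\<lambda>(t, u). v t (pt b u) c))"

definition immersion ::
  "('a::topological_space, 'k::finite) chart set \<Rightarrow> ('m::topological_space, 'n::finite) chart set
     \<Rightarrow> ('a \<Rightarrow> 'm) \<Rightarrow> bool" where
  "immersion B A F \<longleftrightarrow>
     smooth_map B A F \<and>
     (\<forall>p. \<forall>b\<in>charts_at B p. \<forall>c\<in>charts_at A (F p).
        inj (frechet_derivative (snd c \<circ> F \<circ> pt b) (at (snd b p))))"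

definition unit_normal ::
  "('a, 'k::finite) chart set \<Rightarrow> ('m, 'n::finite) chart set \<Rightarrow> ('m, 'n) metric \<Rightarrow> ('a \<Rightarrow> 'm)
     \<Rightarrow> ('a, 'm, 'n) field_along \<Rightarrow> bool" where
  "unit_normal B A g F e \<longleftrightarrow>
     (\<forall>p. \<forall>b\<in>charts_at B p. \<forall>c\<in>charts_at A (F p).
        e p c \<bullet> (g c (F p) *v e p c) = 1 \<and>
        (\<forall>i. pd i (snd c \<circ> F \<circ> pt b) (snd b p) \<bullet> (g c (F p) *v e p c) = 0))"

text \<open>
  The covariant derivative along \<open>F\<close> of the coordinate field \<open>dF(\<partial>\<^sub>j)\<close> in the direction \<open>\<partial>\<^sub>i\<close>,
  computed in the chart \<open>b\<close> of the hypersurface and the chart \<open>c\<close> of the ambient manifold.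
\<close>

definition cov_deriv ::
  "('a, 'k::finite) chart \<Rightarrow> ('m, 'n::finite) chart \<Rightarrow> ('m, 'n) metric \<Rightarrow> ('a \<Rightarrow> 'm)
     \<Rightarrow> 'k \<Rightarrow> 'k \<Rightarrow> 'a \<Rightarrow> real ^ 'n" where
  "cov_deriv b c g F i j p =
     (let X = snd c \<circ> F \<circ> pt b; u = snd b p
      in (\<chi> a. pd i (pd j X) u $ a +
            (\<Sum>k\<in>UNIV. \<Sum>l\<in>UNIV. christoffel (g c \<circ> pt c) a k l (X u) * pd i X u $ k * pd j X u $ l)))"

definition second_ff ::
  "('a, 'k::finite) chart \<Rightarrow> ('m, 'n::finite) chart \<Rightarrow> ('m, 'n) metric \<Rightarrow> ('a \<Rightarrow> 'm)
     \<Rightarrow> ('a, 'm, 'n) field_along \<Rightarrow> 'k \<Rightarrow> 'k \<Rightarrow> 'a \<Rightarrow> real" where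
  "second_ff b c g F e i j p = cov_deriv b c g F i j p \<bullet> (g c (F p) *v e p c)"

text \<open>
  The trace of the second fundamental form with respect to the induced metric. For a unit normal
  \<open>e\<close> the value is the same for all charts \<open>b\<close> at \<open>p\<close> and \<open>c\<close> at \<open>F p\<close>.
\<close>

definition mean_curvature ::
  "('m, 'n::finite) chart set \<Rightarrow> ('a, 'k::finite) chart \<Rightarrow> ('m, 'n) chart \<Rightarrow> ('m, 'n) metric
     \<Rightarrow> ('a \<Rightarrow> 'm) \<Rightarrow> ('a, 'm, 'n) field_along \<Rightarrow> 'a \<Rightarrow> real" where
  "mean_curvature A b c g F e p =
     (\<Sum>i\<in>UNIV. \<Sum>j\<in>UNIV.
        matrix_inv (pullback_metric A F g b p) $ i $ j * second_ff b c g F e i j p)"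

definition mean_curvature_flow ::
  "('a::topological_space, 'k::finite) chart set \<Rightarrow> ('m::topological_space, 'n::finite) chart set
     \<Rightarrow> real set \<Rightarrow> (real \<Rightarrow> ('m, 'n) metric) \<Rightarrow> (real \<Rightarrow> 'a \<Rightarrow> 'm)
     \<Rightarrow> (real \<Rightarrow> ('a, 'm, 'n) field_along) \<Rightarrow> bool" where
  "mean_curvature_flow B A I g x e \<longleftrightarrow>
     smooth_family B A I x \<and> (\<forall>t\<in>I. immersion B A (x t)) \<and>
     smooth_field_family B A I x e \<and> (\<forall>t\<in>I. unit_normal B A (g t) (x t) (e t)) \<and>
     (\<forall>t\<in>I. \<forall>p. \<forall>b\<in>charts_at B p. \<forall>c\<in>charts_at A (x t p).
        ((\<lambda>s. snd c (x s p)) has_vector_derivative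
           mean_curvature A b c (g t) (x t) (e t) p *\<^sub>R e t p c) (at t within I))"

text \<open>Directional derivative of \<open>f\<close> at \<open>q\<close> along the vector with components \<open>v\<close> in the chart \<open>c\<close>.\<close>

definition dir_deriv :: "('m, 'n::finite) chart \<Rightarrow> ('m \<Rightarrow> real) \<Rightarrow> 'm \<Rightarrow> real ^ 'n \<Rightarrow> real" where
  "dir_deriv c f q v = frechet_derivative (f \<circ> pt c) (at (snd c q)) v"

definition mean_curvature_solitons ::
  "('a, 'k::finite) chart set \<Rightarrow> ('m, 'n::finite) chart set
     \<Rightarrow> real set \<Rightarrow> (real \<Rightarrow> ('m, 'n) metric) \<Rightarrow> (real \<Rightarrow> 'm \<Rightarrow> real) \<Rightarrow> (real \<Rightarrow> 'a \<Rightarrow> 'm)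
     \<Rightarrow> (real \<Rightarrow> ('a, 'm, 'n) field_along) \<Rightarrow> bool" where
  "mean_curvature_solitons B A I g f x e \<longleftrightarrow>
     (\<forall>t\<in>I. \<forall>p. \<forall>b\<in>charts_at B p. \<forall>c\<in>charts_at A (x t p).
        mean_curvature A b c (g t) (x t) (e t) p + dir_deriv c (f t) (x t p) (e t p c) = 0)"


section \<open>Weighted area\<close>

text \<open>
  The Riemannian measure of a metric is the unique Borel measure which in every chart has
  the density \<open>sqrt (det h)\<close>. Uniqueness holds because countably many chart domains
  cover the manifold.
\<close>

definition riemannian_measure ::
  "('a::topological_space, 'k::finite) chart set \<Rightarrow> ('a, 'k) metric \<Rightarrow> 'a measure \<Rightarrow> bool" where
  "riemannian_measure B h \<mu> \<longleftrightarrow>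
     sets \<mu> = sets borel \<and>
     (\<forall>b\<in>B. \<forall>E\<in>sets borel. E \<subseteq> fst b \<longrightarrow>
        emeasure \<mu> E = (\<integral>\<^sup>+ u\<in>snd b ` E. ennreal (sqrt (det (h b (pt b u)))) \<partial>lborel))"

definition weighted_area :: "'a measure \<Rightarrow> ('m \<Rightarrow> real) \<Rightarrow> ('a \<Rightarrow> 'm) \<Rightarrow> real" where
  "weighted_area \<mu> f F = (LINT p|\<mu>. exp (- f (F p)))"

primrec Phi :: "soliton_kind \<Rightarrow> nat \<Rightarrow> (real \<Rightarrow> real) \<Rightarrow> real \<Rightarrow> real" where
  "Phi Steady n area t = area t"
| "Phi Shrinking n area t = (- t) powr (- ((real n - 1) / 2)) * area t"
| "Phi Expanding n area t = t powr (- ((real n - 1) / 2)) * area t"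

end

theory Submission
  imports Defs
begin

text \<open>
  Write \<open>\<sigma>\<close> for the scale of the soliton, \<open>\<psi>\<close> for its diffeomorphisms and \<open>y\<^sub>t = \<psi>\<^sub>t \<circ> x\<^sub>t\<close>. Since
  \<open>gbar t = \<sigma>(t) \<psi>\<^sub>t\<^sup>*g\<close> and \<open>fbar t = f \<circ> \<psi>\<^sub>t\<close>, the powers of \<open>\<sigma>\<close> cancel and \<open>\<Phi>(t)\<close> is the weighted area
  of \<open>y\<^sub>t\<close> in the fixed manifold \<open>(M, g)\<close> with weight \<open>exp (- f)\<close>. The curvature equations of the
  soliton play no role. For fixed \<open>t\<close> the family \<open>\<psi>\<^sub>t\<^sup>-\<^sup>1 \<circ> y\<^sub>s\<close> passes through \<open>x\<^sub>t\<close> at time \<open>s = t\<close> with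
  velocity \<open>H e + \<nabla>fbar = (H + e fbar) e + W\<close>, where \<open>W\<close> is tangential and the gradient is taken in
  \<open>gbar t\<close>. By the first variation formula the
  density \<open>exp (- f) sqrt (det h)\<close> of \<open>y\<^sub>s\<close> changes by \<open>- (H + e fbar)\<^sup>2\<close> times itself plus the divergence
  of \<open>W\<close>, which integrates to zero over the closed hypersurface. Hence the derivative of \<open>\<Phi>\<close> is minus
  the weighted integral of \<open>(H + e fbar)\<^sup>2\<close>, up to a positive factor.
\<close>


section \<open>Calculus of functions of class \<open>C\<^sup>k\<close>\<close>

text \<open>Two obstacles shape the argument. The time interval may contain its end points, where
  the flow has only one-sided derivatives. Near a space-time point the flow is therefore replaced by
  a smooth extension to an open set; the variation formula is stated for the extension, with
  geometric hypotheses on the slice at time \<open>t\<close>, and its result is read back as a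
  derivative within the interval. Such derivatives are unique because the interval has interior
  points. The second obstacle is that curvature and divergence are coordinate expressions whose
  chart independence is laborious to check directly. The divergence is never treated as a function
  on the hypersurface: a partition of unity, fixed in time, reduces the divergence theorem to
  integrations by parts in coordinate boxes. What remains are pairings of \<open>W\<close> with the
  differentials of the partition functions; these are chart independent and cancel because the
  functions add up to 1. Chart independence of the curvature matters for the equality case, where it
  is read off from the flow equation and from the uniqueness of the time derivative of the
  density.\<close>

lemma Ck_on_subset: "Ck_on k U f \<Longrightarrow> V \<subseteq> U \<Longrightarrow> Ck_on k V f"
  by (induction k arbitrary: f) (auto intro: continuous_on_subset differentiable_on_subset)

text \<open>\<open>frechet_derivative\<close> is a choice from the set of derivatives. Both
  functions have the same set, so the chosen values agree even where no derivative exists.\<close>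

lemma frechet_derivative_cong_open:
  assumes "open U" "x \<in> U" "\<And>y. y \<in> U \<Longrightarrow> f y = g y"
  shows "frechet_derivative f (at x) = frechet_derivative g (at x)"
proof -
  have "(f has_derivative D) (at x) \<longleftrightarrow> (g has_derivative D) (at x)" for D
    using has_derivative_transform_within_open[of f D x UNIV U g]
      has_derivative_transform_within_open[of g D x UNIV U f] assms by auto
  then show ?thesis unfolding frechet_derivative_def by simp
qed

lemma Ck_on_cong_imp:
  assumes "open U" "\<And>y. y \<in> U \<Longrightarrow> f y = g y" "Ck_on k U f"
  shows "Ck_on k U g"
  using assms(2,3)
proof (induction k arbitrary: f g)
  case 0
  then show ?case using continuous_on_cong by force
next
  case (Suc k)
  have "g differentiable_on U"
    unfolding differentiable_on_eq_differentiable_at[OF \<open>open U\<close>]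
  proof
    fix x assume "x \<in> U"
    then have "(f has_derivative frechet_derivative f (at x)) (at x)"
      using Suc.prems(2) \<open>open U\<close>
      by (simp add: differentiable_on_eq_differentiable_at frechet_derivative_works[symmetric])
    then have "(g has_derivative frechet_derivative f (at x)) (at x)"
      by (rule has_derivative_transform_within_open[OF _ \<open>open U\<close> \<open>x \<in> U\<close>]) (rule Suc.prems(1))
    then show "g differentiable at x" by (rule differentiableI)
  qed
  moreover have "Ck_on k U (\<lambda>x. frechet_derivative g (at x) v)" for v
  proof (rule Suc.IH)
    show "frechet_derivative f (at y) v = frechet_derivative g (at y) v" if "y \<in> U" for y
      by (simp only: frechet_derivative_cong_open[of U y f g, OF \<open>open U\<close> that Suc.prems(1)])
    show "Ck_on k U (\<lambda>x. frechet_derivative f (at x) v)" using Suc.prems(2) by simp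
  qed
  ultimately show ?case by simp
qed

text \<open>The working introduction rule: each closure property below is an induction that exhibits
  a derivative formula and never handles the chosen derivative itself.\<close>

lemma Ck_on_SucI:
  assumes "open U" "\<And>x. x \<in> U \<Longrightarrow> (f has_derivative f' x) (at x)"
    "\<And>v. Ck_on k U (\<lambda>x. f' x v)"
  shows "Ck_on (Suc k) U f"
proof -
  have "f differentiable_on U"
    using assms(1,2) differentiable_on_eq_differentiable_at differentiableI by blast
  moreover have "frechet_derivative f (at x) = f' x" if "x \<in> U" for x
    using assms(2)[OF that] frechet_derivative_at by metis
  ultimately show ?thesis
    using Ck_on_cong_imp[OF assms(1) _ assms(3)] by simp
qed

lemma Ck_on_has_derivative:
  assumes "Ck_on (Suc k) U f" "open U" "x \<in> U"
  shows "(f has_derivative frechet_derivative f (at x)) (at x)"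
  using assms by (simp add: differentiable_on_eq_differentiable_at frechet_derivative_works[symmetric])

lemma Ck_on_SucD: "Ck_on (Suc k) U f \<Longrightarrow> Ck_on k U f"
  by (induction k arbitrary: f) (auto intro: differentiable_imp_continuous_on)

lemma Ck_on_imp_continuous_on: "Ck_on k U f \<Longrightarrow> continuous_on U f"
  by (cases k) (auto intro: differentiable_imp_continuous_on)

lemma Ck_on_const: "open U \<Longrightarrow> Ck_on k U (\<lambda>_. c)"
proof (induction k arbitrary: c)
  case (Suc k)
  then show ?case by (intro Ck_on_SucI[of _ _ "\<lambda>_ _. 0"]) auto
qed simp

lemma Ck_on_bounded_linear: 
  assumes "open U" "bounded_linear f" shows "Ck_on k U f"
proof (cases k)
  case 0
  then show ?thesis using assms by (simp add: linear_continuous_on)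
next
  case (Suc k')
  then show ?thesis
    using Ck_on_SucI[OF assms(1), of f "\<lambda>_. f"] assms
    by (simp add: bounded_linear_imp_has_derivative Ck_on_const)
qed

lemma Ck_on_id: "open U \<Longrightarrow> Ck_on k U (\<lambda>x. x)"
  by (simp add: Ck_on_bounded_linear)

lemma Ck_on_add:
  assumes "open U" "Ck_on k U f" "Ck_on k U g"
  shows "Ck_on k U (\<lambda>x. f x + g x)"
  using assms(2,3)
proof (induction k arbitrary: f g)
  case 0
  then show ?case by (simp add: continuous_on_add)
next
  case (Suc k)
  show ?case
    using Suc Ck_on_has_derivative[OF Suc.prems(1) \<open>open U\<close>] Ck_on_has_derivative[OF Suc.prems(2) \<open>open U\<close>]
    by (intro Ck_on_SucI[OF \<open>open U\<close> has_derivative_add]) auto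
qed

lemma Ck_on_bilinear:
  assumes "bounded_bilinear prd" "open U" "Ck_on k U f" "Ck_on k U g"
  shows "Ck_on k U (\<lambda>x. prd (f x) (g x))"
  using assms(3,4)
proof (induction k arbitrary: f g)
  case 0
  then show ?case by (simp add: bounded_bilinear.continuous_on[OF assms(1)])
next
  case (Suc k)
  note d = Ck_on_has_derivative[OF _ \<open>open U\<close>]
  show ?case
  proof (rule Ck_on_SucI[OF \<open>open U\<close> bounded_bilinear.FDERIV[OF assms(1) d[OF Suc.prems(1)] d[OF Suc.prems(2)]]])
    fix v
    show "Ck_on k U (\<lambda>x. prd (f x) (frechet_derivative g (at x) v) + prd (frechet_derivative f (at x) v) (g x))"
      using Suc.prems
      by (intro Ck_on_add[OF \<open>open U\<close>] Suc.IH Ck_on_SucD[OF Suc.prems(1)] Ck_on_SucD[OF Suc.prems(2)]) auto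
  qed
qed

lemmas Ck_on_scaleR = Ck_on_bilinear[OF bounded_bilinear_scaleR]
lemmas Ck_on_mult = Ck_on_bilinear[OF bounded_bilinear_mult]
lemmas Ck_on_inner = Ck_on_bilinear[OF bounded_bilinear_inner]

lemma Ck_on_linear_compose:
  assumes "bounded_linear l" "open U" "Ck_on k U f"
  shows "Ck_on k U (\<lambda>x. l (f x))"
  using assms(3)
proof (induction k arbitrary: f)
  case 0
  then show ?case by (simp add: bounded_linear.continuous_on[OF assms(1)])
next
  case (Suc k)
  show ?case
    using Suc Ck_on_has_derivative[OF Suc.prems(1) \<open>open U\<close>]
    by (intro Ck_on_SucI[OF \<open>open U\<close> bounded_linear.has_derivative[OF assms(1)]]) auto
qed

lemma Ck_on_sum:
  assumes "open U" "\<And>i. i \<in> J \<Longrightarrow> Ck_on k U (f i)"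
  shows "Ck_on k U (\<lambda>x. \<Sum>i\<in>J. f i x)"
  using assms(2)
  by (induction J rule: infinite_finite_induct) (auto simp: assms(1) Ck_on_const intro!: Ck_on_add)

lemma has_derivative_expand_basis:
  fixes g :: "'b::euclidean_space \<Rightarrow> 'c::real_normed_vector"
  assumes "(g has_derivative g') (at y)"
  shows "g' w = (\<Sum>b\<in>Basis. (w \<bullet> b) *\<^sub>R g' b)"
proof -
  interpret linear g' using assms has_derivative_linear by blast
  show ?thesis
    by (subst euclidean_representation[of w, symmetric], simp only: sum scale)
qed

text \<open>The chain rule differentiates \<open>g\<close> in the moving direction
  \<open>Df(x) v\<close>, whereas \<open>Ck_on\<close> controls fixed directions only. Expanding
  that direction in the basis turns the derivative into a finite sum of products to which the
  induction hypothesis applies; hence the Euclidean middle space.\<close>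

lemma Ck_on_compose:
  fixes f :: "'a::real_normed_vector \<Rightarrow> 'b::euclidean_space" and g :: "'b \<Rightarrow> 'c::real_normed_vector"
  assumes "open U" "open V" "f ` U \<subseteq> V" "Ck_on k U f" "Ck_on k V g"
  shows "Ck_on k U (\<lambda>x. g (f x))"
  using assms(4,5)
proof (induction k arbitrary: g)
  case 0
  then show ?case using assms by (auto intro: continuous_on_compose2)
next
  case (Suc k)
  have d: "((\<lambda>x. g (f x)) has_derivative
        (\<lambda>v. \<Sum>b\<in>Basis. (frechet_derivative f (at x) v \<bullet> b) *\<^sub>R frechet_derivative g (at (f x)) b)) (at x)"
    if "x \<in> U" for x
  proof -
    have fx: "f x \<in> V" using that assms by auto
    note g = Ck_on_has_derivative[OF Suc.prems(2) \<open>open V\<close> fx]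
    show ?thesis
      using has_derivative_compose[OF Ck_on_has_derivative[OF Suc.prems(1) \<open>open U\<close> that] g]
      by (subst (asm) has_derivative_expand_basis[OF g]) simp
  qed
  show ?case
  proof (rule Ck_on_SucI[OF \<open>open U\<close> d])
    fix v
    show "Ck_on k U (\<lambda>x. \<Sum>b\<in>Basis. (frechet_derivative f (at x) v \<bullet> b) *\<^sub>R frechet_derivative g (at (f x)) b)"
      using Suc.prems Ck_on_SucD[OF Suc.prems(1)] assms
      by (intro Ck_on_sum Ck_on_scaleR Suc.IH Ck_on_linear_compose[OF bounded_linear_inner_left]) auto
  qed
qed

lemma Ck_on_local:
  assumes "open S" "\<And>x. x \<in> S \<Longrightarrow> \<exists>U. open U \<and> x \<in> U \<and> Ck_on k U f"
  shows "Ck_on k S f"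
  using assms(2)
proof (induction k arbitrary: f)
  case 0
  then show ?case
    by (metis Ck_on.simps(1) assms(1) at_within_open continuous_on_eq_continuous_within)
next
  case (Suc k)
  have "f differentiable_on S" 
    using Suc.prems assms(1) by (metis Ck_on.simps(2) differentiable_on_eq_differentiable_at)
  moreover have "Ck_on k S (\<lambda>x. frechet_derivative f (at x) v)" for v
    using Suc by (metis Ck_on.simps(2))
  ultimately show ?case by simp
qed

lemma Ck_on_Pair:
  assumes "open U" "Ck_on k U f" "Ck_on k U g"
  shows "Ck_on k U (\<lambda>x. (f x, g x))"
proof -
  have a: "bounded_linear (\<lambda>x. (x, 0))" "bounded_linear (\<lambda>y. (0, y))"
    by (simp_all add: bounded_linear_Pair bounded_linear_ident bounded_linear_zero)
  from Ck_on_add[OF assms(1) Ck_on_linear_compose[OF a(1) assms(1,2)] Ck_on_linear_compose[OF a(2) assms(1,3)]]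
  show ?thesis by simp
qed

lemma Ck_on_exp: "open U \<Longrightarrow> Ck_on k U (exp :: real \<Rightarrow> real)"
proof (induction k)
  case (Suc k)
  then show ?case
    by (intro Ck_on_SucI[where f' = "\<lambda>x v. v * exp x"])
       (auto intro!: Ck_on_mult Ck_on_const derivative_eq_intros)
qed (simp add: continuous_intros)

lemma Ck_on_inverse: "Ck_on k (- {0}) (inverse :: real \<Rightarrow> real)"
proof (induction k)
  case 0
  then show ?case by (auto intro: continuous_intros)
next
  case (Suc k)
  then show ?case
    by (intro Ck_on_SucI[where f' = "\<lambda>x v. - (inverse x * v * inverse x)"])
       (auto intro!: Ck_on_mult Ck_on_const Ck_on_linear_compose[OF bounded_linear_minus[OF bounded_linear_ident]] derivative_eq_intros)
qed

lemma Ck_on_sqrt: "Ck_on k {0<..} sqrt"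
proof (induction k)
  case 0
  then show ?case by (auto intro: continuous_intros)
next
  case (Suc k)
  have "Ck_on k {0<..} (\<lambda>x. v * inverse (sqrt x) / 2)" for v
    unfolding divide_inverse
    using Suc.IH
    by (intro Ck_on_mult Ck_on_const Ck_on_compose[OF _ _ _ _ Ck_on_inverse]) auto
  then show ?case
    by (intro Ck_on_SucI[where f' = "\<lambda>x v. v * inverse (sqrt x) / 2"])
       (auto intro!: derivative_eq_intros simp: field_simps)
qed


text \<open>The difference of the \<open>w\<close>-derivatives along a segment in direction \<open>v\<close> is computed in two
  ways, one of them by differentiating under the integral sign.\<close>

lemma second_derivative_symmetric:
  fixes f :: "'a::real_normed_vector \<Rightarrow> 'b::banach"
  assumes "open U" "x \<in> U" "Ck_on 2 U f"
  shows "frechet_derivative (\<lambda>y. frechet_derivative f (at y) v) (at x) w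
       = frechet_derivative (\<lambda>y. frechet_derivative f (at y) w) (at x) v"
proof -
  define p where "p s r = x + s *\<^sub>R v + r *\<^sub>R w" for s r
  define D where "D u y = frechet_derivative f (at y) u" for u y
  define D2 where "D2 u u' y = frechet_derivative (D u) (at y) u'" for u u' y
  have C2: "Ck_on (Suc (Suc 0)) U f" using assms(3) by (simp add: numeral_2_eq_2)
  have CD: "Ck_on (Suc 0) U (D u)" for u using C2 by (simp add: D_def[abs_def])
  have f: "(f has_derivative (\<lambda>u. D u y)) (at y)" if "y \<in> U" for y
    using Ck_on_has_derivative[OF C2 \<open>open U\<close> that] by (simp add: D_def)
  have Df: "(D u has_derivative (\<lambda>u'. D2 u u' y)) (at y)" if "y \<in> U" for y u
    using Ck_on_has_derivative[OF CD \<open>open U\<close> that] by (simp add: D2_def)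
  have cD: "continuous_on U (D u)" for u using CD Ck_on_imp_continuous_on by blast
  have cD2: "continuous_on U (D2 u u')" for u u' using CD by (simp add: D2_def[abs_def])
  have "\<forall>\<^sub>F z in at (0::real \<times> real). p (fst z) (snd z) \<in> U"
  proof -
    have "((\<lambda>z. p (fst z) (snd z)) \<longlongrightarrow> p (fst (0::real\<times>real)) (snd (0::real\<times>real))) (at 0)"
      unfolding p_def by (intro tendsto_intros)
    moreover have "p (fst (0::real\<times>real)) (snd (0::real\<times>real)) \<in> U" using assms by (simp add: p_def)
    ultimately show ?thesis using \<open>open U\<close> topological_tendstoD by blast
  qed
  then obtain e where e: "e > 0" "\<And>z::real\<times>real. z \<noteq> 0 \<Longrightarrow> dist z 0 < e \<Longrightarrow> p (fst z) (snd z) \<in> U"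
    unfolding eventually_at by blast
  \<comment> \<open>Points of the square with side from \<open>-d\<close> to \<open>d\<close> have
    norm at most \<open>2 * d\<close>, which is below \<open>e\<close>, so the parallelogram spanned
    there by \<open>v\<close> and \<open>w\<close> stays inside \<open>U\<close>.\<close>
  define d where "d = e / 4"
  have d: "d > 0" using e by (simp add: d_def)
  have pU: "p s r \<in> U" if "s \<in> {-d..d}" "r \<in> {-d..d}" for s r
  proof (cases "(s, r) = 0")
    case True
    then show ?thesis using assms by (simp add: p_def zero_prod_def)
  next
    case False
    have "norm (s, r) \<le> norm s + norm r" by (rule norm_Pair_le)
    also have "\<dots> < e" using that e by (auto simp: d_def)
    finally show ?thesis using e(2)[of "(s,r)"] False by simp
  qed
  have ds: "((\<lambda>s. g (p s r)) has_vector_derivative g' v) (at s within X)"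
    if "(g has_derivative g') (at (p s r))" for g :: "'a \<Rightarrow> 'b" and g' s r X
  proof -
    have "((\<lambda>s. p s r) has_derivative (\<lambda>h. h *\<^sub>R v)) (at s within X)"
      unfolding p_def by (auto intro!: derivative_eq_intros)
    from has_derivative_compose[OF this that] show ?thesis
      unfolding has_vector_derivative_def using linear_scale[OF has_derivative_linear[OF that]] by simp
  qed
  have dr: "((\<lambda>r. g (p s r)) has_vector_derivative g' w) (at r within X)"
    if "(g has_derivative g') (at (p s r))" for g :: "'a \<Rightarrow> 'b" and g' s r X
  proof -
    have "((\<lambda>r. p s r) has_derivative (\<lambda>h. h *\<^sub>R w)) (at r within X)"
      unfolding p_def by (auto intro!: derivative_eq_intros)
    from has_derivative_compose[OF this that] show ?thesis
      unfolding has_vector_derivative_def using linear_scale[OF has_derivative_linear[OF that]] by simp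
  qed
  have cg: "continuous_on (X \<times> Y) (\<lambda>(r, s). g (p s r))"
    if "continuous_on U g" "X \<subseteq> {-d..d}" "Y \<subseteq> {-d..d}" for g :: "'a \<Rightarrow> 'b" and X Y
    unfolding split_beta
  proof (rule continuous_on_compose2[OF that(1)])
    show "continuous_on (X \<times> Y) (\<lambda>z. p (snd z) (fst z))" unfolding p_def by (intro continuous_intros)
    show "(\<lambda>z. p (snd z) (fst z)) ` (X \<times> Y) \<subseteq> U"
      using that(2,3) by (auto intro!: pU simp del: atLeastAtMost_iff)
  qed
  have cs: "continuous_on Y (\<lambda>s. g (p s r))" 
    if "continuous_on U g" "r \<in> {-d..d}" "Y \<subseteq> {-d..d}" for g :: "'a \<Rightarrow> 'b" and r Y
  proof (rule continuous_on_compose2[OF that(1)])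
    show "continuous_on Y (\<lambda>s. p s r)" unfolding p_def by (intro continuous_intros)
    show "(\<lambda>s. p s r) ` Y \<subseteq> U"
      using that(2,3) by (auto intro!: pU simp del: atLeastAtMost_iff)
  qed
  have ftc: "integral {0..s} (\<lambda>\<sigma>. D v (p \<sigma> r)) = f (p s r) - f (p 0 r)"
    if "s \<in> {0..d}" "r \<in> {-d..d}" for s r
    using that by (intro integral_unique fundamental_theorem_of_calculus ds[OF f[OF pU]]) auto
  have key: "D w (p s 0) - D w (p 0 0) = integral {0..s} (\<lambda>\<sigma>. D2 v w (p \<sigma> 0))"
    if s: "s \<in> {0..d}" for s
  proof -
    have "((\<lambda>r. integral (cbox 0 s) (\<lambda>\<sigma>. D v (p \<sigma> r))) has_vector_derivative
        integral (cbox 0 s) (\<lambda>\<sigma>. D2 v w (p \<sigma> 0))) (at 0 within {-d..d})"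
    proof (rule leibniz_rule_vector_derivative)
      show "((\<lambda>r. D v (p \<sigma> r)) has_vector_derivative D2 v w (p \<sigma> r)) (at r within {- d..d})"
        if "r \<in> {-d..d}" "\<sigma> \<in> cbox 0 s" for r \<sigma>
        using that s by (intro dr[OF Df[OF pU]]) auto
      show "(\<lambda>\<sigma>. D v (p \<sigma> r)) integrable_on cbox 0 s" if "r \<in> {-d..d}" for r
        using that s by (intro integrable_continuous cs[OF cD]) auto
      show "continuous_on ({- d..d} \<times> cbox 0 s) (\<lambda>(r, \<sigma>). D2 v w (p \<sigma> r))"
        using s by (intro cg[OF cD2]) auto
    qed (use d in auto)
    then have "((\<lambda>r. f (p s r) - f (p 0 r)) has_vector_derivative
        integral {0..s} (\<lambda>\<sigma>. D2 v w (p \<sigma> 0))) (at 0 within {-d..d})"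
      unfolding cbox_interval
      by (rule has_vector_derivative_transform[rotated 2]) (use d ftc[OF s] in auto)
    moreover have "((\<lambda>r. f (p s r) - f (p 0 r)) has_vector_derivative D w (p s 0) - D w (p 0 0)) (at 0 within {-d..d})"
      using s d by (intro has_vector_derivative_diff dr[OF f[OF pU]]) auto
    ultimately show ?thesis
      using d by (intro vector_derivative_unique_within_closed_interval[of "-d" d 0]) auto
  qed
  \<comment> \<open>By \<open>key\<close>, differentiating the increment of \<open>D w\<close> at
    \<open>s = 0\<close> through its integral representation gives one mixed derivative;
    differentiating it directly gives the other.\<close>
  have "((\<lambda>s. integral {0..s} (\<lambda>\<sigma>. D2 v w (p \<sigma> 0))) has_vector_derivative D2 v w (p 0 0)) (at 0 within {0..d})"
    using d by (intro integral_has_vector_derivative cs[OF cD2]) auto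
  then have "((\<lambda>s. D w (p s 0) - D w (p 0 0)) has_vector_derivative D2 v w (p 0 0)) (at 0 within {0..d})"
    by (rule has_vector_derivative_transform[rotated 2]) (use d key in auto)
  moreover have "((\<lambda>s. D w (p s 0) - D w (p 0 0)) has_vector_derivative D2 w v (p 0 0) - 0) (at 0 within {0..d})"
    using d by (intro has_vector_derivative_diff ds[OF Df[OF pU]] has_vector_derivative_const) auto
  ultimately have "D2 v w (p 0 0) = D2 w v (p 0 0) - 0"
    using d by (intro vector_derivative_unique_within_closed_interval[of "0" d 0]) auto
  then show ?thesis by (simp add: D2_def D_def[abs_def] p_def)
qed


section \<open>Smooth functions on arbitrary sets\<close>

lemma smooth_onI:
  assumes "open U" "S \<subseteq> U" "\<And>k. Ck_on k U f"
  shows "smooth_on S f"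
  unfolding smooth_on_def using assms by blast

lemma smooth_onE:
  assumes "smooth_on S f" "x \<in> S"
  obtains U h where "open U" "x \<in> U" "\<And>k. Ck_on k U h" "\<And>y. y \<in> U \<Longrightarrow> y \<in> S \<Longrightarrow> h y = f y"
  using assms unfolding smooth_on_def by (metis IntI)

lemma smooth_on_subset: "smooth_on S f \<Longrightarrow> T \<subseteq> S \<Longrightarrow> smooth_on T f"
  unfolding smooth_on_def by (meson Int_iff subsetD)

lemma smooth_on_cong:
  assumes "smooth_on S f" "\<And>x. x \<in> S \<Longrightarrow> f x = g x"
  shows "smooth_on S g"
  using assms unfolding smooth_on_def by (metis IntD2)

lemma smooth_on_local:
  assumes "\<And>x. x \<in> S \<Longrightarrow> \<exists>U. open U \<and> x \<in> U \<and> smooth_on (S \<inter> U) f"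
  shows "smooth_on S f"
  unfolding smooth_on_def
proof
  fix x assume x: "x \<in> S"
  then obtain U where U: "open U" "x \<in> U" "smooth_on (S \<inter> U) f" using assms by blast
  with x obtain V h where V: "open V" "x \<in> V" "\<And>k. Ck_on k V h" "\<And>y. y \<in> V \<Longrightarrow> y \<in> S \<inter> U \<Longrightarrow> h y = f y"
    using smooth_onE[OF U(3), of x] by blast
  have "open (U \<inter> V)" "x \<in> U \<inter> V" "\<forall>k. Ck_on k (U \<inter> V) h" "\<forall>y\<in>(U \<inter> V) \<inter> S. h y = f y"
    using U V Ck_on_subset[OF V(3)] by (auto intro: open_Int)
  then show "\<exists>U h. open U \<and> x \<in> U \<and> (\<forall>k. Ck_on k U h) \<and> (\<forall>y\<in>U \<inter> S. h y = f y)" by blast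
qed

lemma smooth_on_open_Ck: "open S \<Longrightarrow> smooth_on S f \<Longrightarrow> Ck_on k S f"
proof (rule Ck_on_local)
  fix x assume "open S" "smooth_on S f" "x \<in> S"
  then obtain U h where U: "open U" "x \<in> U" "\<And>k. Ck_on k U h" "\<And>y. y \<in> U \<Longrightarrow> y \<in> S \<Longrightarrow> h y = f y"
    using smooth_onE by blast
  have "Ck_on k (U \<inter> S) f"
    by (rule Ck_on_cong_imp[of _ h]) (use U \<open>open S\<close> in \<open>auto intro: Ck_on_subset\<close>)
  then show "\<exists>U. open U \<and> x \<in> U \<and> Ck_on k U f" using U \<open>open S\<close> \<open>x \<in> S\<close> by (intro exI[of _ "U \<inter> S"]) auto
qed

lemma smooth_on_continuous_on: "smooth_on S f \<Longrightarrow> continuous_on S f"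
proof (unfold continuous_on_eq_continuous_within, safe)
  fix x assume "smooth_on S f" "x \<in> S"
  then obtain U h where U: "open U" "x \<in> U" "\<And>k. Ck_on k U h" "\<And>y. y \<in> U \<Longrightarrow> y \<in> S \<Longrightarrow> h y = f y"
    using smooth_onE by blast
  have "isCont h x"
    using U(1,2) Ck_on_imp_continuous_on[OF U(3)[of 0]] by (simp add: continuous_on_eq_continuous_at)
  then have "continuous (at x within S) h" using continuous_at_imp_continuous_at_within by blast
  moreover have "\<forall>\<^sub>F y in at x within S. h y = f y"
    unfolding eventually_at_topological using U by blast
  ultimately show "continuous (at x within S) f"
    using U(2,4) \<open>x \<in> S\<close> by (simp add: continuous_within Lim_transform_eventually)
qed

lemma smooth_on_compose:
  fixes f :: "'a::real_normed_vector \<Rightarrow> 'b::euclidean_space" and g :: "'b \<Rightarrow> 'c::real_normed_vector"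
  assumes "smooth_on S f" "smooth_on T g" "f ` S \<subseteq> T"
  shows "smooth_on S (\<lambda>x. g (f x))"
  unfolding smooth_on_def
proof
  fix x assume x: "x \<in> S"
  obtain U h where U: "open U" "x \<in> U" "\<And>k. Ck_on k U h" "\<And>y. y \<in> U \<Longrightarrow> y \<in> S \<Longrightarrow> h y = f y"
    using smooth_onE[OF assms(1) x] by blast
  have fx: "f x \<in> T" using x assms(3) by blast
  obtain V l where V: "open V" "f x \<in> V" "\<And>k. Ck_on k V l" "\<And>y. y \<in> V \<Longrightarrow> y \<in> T \<Longrightarrow> l y = g y"
    using smooth_onE[OF assms(2) fx] by blast
  \<comment> \<open>The extension of \<open>f\<close> may leave \<open>T\<close> off the set
    \<open>S\<close>; on \<open>W\<close> it at least lands where the extension of \<open>g\<close>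
    is smooth.\<close>
  define W where "W = U \<inter> h -` V"
  have W: "open W"
    unfolding W_def using Ck_on_imp_continuous_on[OF U(3)[of 0]] U(1) V(1) continuous_on_open_vimage by (metis Int_commute)
  have "Ck_on k W (\<lambda>x. l (h x))" for k
    by (rule Ck_on_compose[OF W V(1) _ _ V(3)]) (auto simp: W_def intro: Ck_on_subset[OF U(3)])
  moreover have "x \<in> W" using U V x by (simp add: W_def)
  moreover have "\<forall>y\<in>W \<inter> S. l (h y) = g (f y)"
    using U(4) V(4) assms(3) by (auto simp: W_def image_subset_iff)
  ultimately show "\<exists>U h. open U \<and> x \<in> U \<and> (\<forall>k. Ck_on k U h) \<and> (\<forall>y\<in>U \<inter> S. h y = g (f y))"
    using W by (intro exI[of _ W] exI[of _ "\<lambda>x. l (h x)"]) auto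
qed

lemma smooth_on_bounded_linear: "bounded_linear f \<Longrightarrow> smooth_on S f"
  by (rule smooth_onI[of UNIV]) (auto intro: Ck_on_bounded_linear)

lemma smooth_on_const: "smooth_on S (\<lambda>_. c)"
  by (rule smooth_onI[of UNIV]) (auto intro: Ck_on_const)

lemma smooth_on_binop:
  fixes S :: "'a::real_normed_vector set"
  assumes "\<And>(U :: 'a set) k f g. open U \<Longrightarrow> Ck_on k U f \<Longrightarrow> Ck_on k U g \<Longrightarrow> Ck_on k U (\<lambda>x. prd (f x) (g x))"
    "smooth_on S f" "smooth_on S g"
  shows "smooth_on S (\<lambda>x. prd (f x) (g x))"
  unfolding smooth_on_def
proof
  fix x assume x: "x \<in> S"
  obtain U h where U: "open U" "x \<in> U" "\<And>k. Ck_on k U h" "\<And>y. y \<in> U \<Longrightarrow> y \<in> S \<Longrightarrow> h y = f y"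
    using smooth_onE[OF assms(2) x] by blast
  obtain V l where V: "open V" "x \<in> V" "\<And>k. Ck_on k V l" "\<And>y. y \<in> V \<Longrightarrow> y \<in> S \<Longrightarrow> l y = g y"
    using smooth_onE[OF assms(3) x] by blast
  have "Ck_on k (U \<inter> V) (\<lambda>x. prd (h x) (l x))" for k
    by (rule assms(1)) (use U V in \<open>auto intro: Ck_on_subset\<close>)
  then show "\<exists>U h. open U \<and> x \<in> U \<and> (\<forall>k. Ck_on k U h) \<and> (\<forall>y\<in>U \<inter> S. h y = prd (f y) (g y))"
    using U V by (intro exI[of _ "U \<inter> V"] exI[of _ "\<lambda>x. prd (h x) (l x)"]) auto
qed

lemma smooth_on_add: "smooth_on S f \<Longrightarrow> smooth_on S g \<Longrightarrow> smooth_on S (\<lambda>x. f x + g x)"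
  by (rule smooth_on_binop[OF Ck_on_add])

lemma smooth_on_bilinear:
  assumes "bounded_bilinear prd" "smooth_on S f" "smooth_on S g"
  shows "smooth_on S (\<lambda>x. prd (f x) (g x))"
  using smooth_on_binop[of prd, OF Ck_on_bilinear[OF assms(1)] assms(2,3)] .

lemmas smooth_on_mult = smooth_on_bilinear[OF bounded_bilinear_mult]

lemma smooth_on_Pair: "smooth_on S f \<Longrightarrow> smooth_on S g \<Longrightarrow> smooth_on S (\<lambda>x. (f x, g x))"
  by (rule smooth_on_binop[OF Ck_on_Pair])

lemma smooth_on_linear_compose:
  assumes "bounded_linear l" "smooth_on S f"
  shows "smooth_on S (\<lambda>x. l (f x))"
  using smooth_on_binop[of "\<lambda>x y. l x", OF Ck_on_linear_compose[OF assms(1)] assms(2,2)] by simp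

lemma smooth_on_sum:
  assumes "\<And>i. i \<in> J \<Longrightarrow> smooth_on S (f i)"
  shows "smooth_on S (\<lambda>x. \<Sum>i\<in>J. f i x)"
  using assms
  by (induction J rule: infinite_finite_induct) (auto simp: smooth_on_const intro!: smooth_on_add)

lemma smooth_on_prod:
  fixes f :: "_ \<Rightarrow> _ \<Rightarrow> real"
  assumes "\<And>i. i \<in> J \<Longrightarrow> smooth_on S (f i)"
  shows "smooth_on S (\<lambda>x. \<Prod>i\<in>J. f i x)"
  using assms
  by (induction J rule: infinite_finite_induct) (auto simp: smooth_on_const intro!: smooth_on_mult)

lemma smooth_on_det:
  fixes M :: "'a::real_normed_vector \<Rightarrow> real ^ 'n ^ 'n"
  assumes "\<And>i j. smooth_on S (\<lambda>x. M x $ i $ j)"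
  shows "smooth_on S (\<lambda>x. det (M x))"
  unfolding det_def by (intro smooth_on_sum smooth_on_mult smooth_on_const smooth_on_prod assms)

lemma smooth_on_vec_nth: "smooth_on S f \<Longrightarrow> smooth_on S (\<lambda>x. f x $ i)"
  by (rule smooth_on_linear_compose[OF bounded_linear_vec_nth])

lemma smooth_on_exp: "smooth_on S f \<Longrightarrow> smooth_on S (\<lambda>x. exp (f x :: real))"
  by (rule smooth_on_compose[where T = UNIV and g = exp]) (auto intro!: smooth_onI[of UNIV] Ck_on_exp)

lemma smooth_on_minus: "smooth_on S f \<Longrightarrow> smooth_on S (\<lambda>x. - f x)"
  by (rule smooth_on_linear_compose[OF bounded_linear_minus[OF bounded_linear_ident]])

lemma smooth_on_sqrt:
  assumes "smooth_on S f" "\<And>x. x \<in> S \<Longrightarrow> f x > 0"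
  shows "smooth_on S (\<lambda>x. sqrt (f x))"
proof -
  have "smooth_on {0<..} sqrt" by (rule smooth_onI[OF _ _ Ck_on_sqrt]) auto
  then show ?thesis using assms(2) by (intro smooth_on_compose[OF assms(1)]) auto
qed

lemma smooth_on_divide:
  fixes f g :: "_ \<Rightarrow> real"
  assumes "smooth_on S f" "smooth_on S g" "\<And>x. x \<in> S \<Longrightarrow> g x \<noteq> 0"
  shows "smooth_on S (\<lambda>x. f x / g x)"
proof -
  have "smooth_on (- {0}) (inverse :: real \<Rightarrow> real)" by (rule smooth_onI[OF _ _ Ck_on_inverse]) auto
  then have "smooth_on S (\<lambda>x. inverse (g x))"
    using assms(3) by (intro smooth_on_compose[OF assms(2)]) auto
  then show ?thesis unfolding divide_inverse by (rule smooth_on_mult[OF assms(1)])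
qed

section \<open>Slices of functions of time and space\<close>

lemma slice_space_derivative:
  fixes h :: "real \<times> 'b::real_normed_vector \<Rightarrow> 'c::real_normed_vector"
  assumes "Ck_on (Suc k) U h" "open U" "(s, u) \<in> U"
  shows "((\<lambda>u. h (s, u)) has_derivative (\<lambda>v. frechet_derivative h (at (s, u)) (0, v))) (at u)"
proof -
  have "((\<lambda>u. (s, u)) has_derivative (\<lambda>v. (0, v))) (at u)"
    by (auto intro!: derivative_eq_intros)
  from has_derivative_compose[OF this Ck_on_has_derivative[OF assms]] show ?thesis by simp
qed

lemma slice_time_derivative:
  fixes h :: "real \<times> 'b::real_normed_vector \<Rightarrow> 'c::real_normed_vector"
  assumes "Ck_on (Suc k) U h" "open U" "(s, u) \<in> U"
  shows "((\<lambda>s. h (s, u)) has_vector_derivative frechet_derivative h (at (s, u)) (1, 0)) (at s within X)"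
proof -
  note d = Ck_on_has_derivative[OF assms]
  have "((\<lambda>s. (s, u)) has_derivative (\<lambda>r. (r, 0))) (at s within X)"
    by (auto intro!: derivative_eq_intros)
  note der = has_derivative_compose[OF this d]
  have "frechet_derivative h (at (s, u)) (r, 0) = r *\<^sub>R frechet_derivative h (at (s, u)) (1, 0)" for r
    using linear_scale[OF has_derivative_linear[OF d], of r "(1, 0)"] by simp
  then show ?thesis
    unfolding has_vector_derivative_def by (intro has_derivative_eq_rhs[OF der] ext)
qed

text \<open>The extension \<open>h\<close> is prescribed on \<open>S\<close> only, and
  \<open>S\<close> need not be open in time. Openness of its spatial slice is enough to identify
  spatial derivatives, also at an end point of the time interval.\<close>

lemma slice_agree_derivative:
  fixes h :: "real \<times> 'b::real_normed_vector \<Rightarrow> 'c::real_normed_vector"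
  assumes "Ck_on (Suc k) U h" "open U" "(s, u) \<in> U" "open {u. (s, u) \<in> S}" "(s, u) \<in> S"
    and "\<And>u. (s, u) \<in> U \<Longrightarrow> (s, u) \<in> S \<Longrightarrow> h (s, u) = f u"
  shows "(f has_derivative (\<lambda>v. frechet_derivative h (at (s, u)) (0, v))) (at u)"
proof (rule has_derivative_transform_within_open[OF slice_space_derivative[OF assms(1-3)]])
  have "{u. (s, u) \<in> U} = Pair s -` U" by auto
  then have "open {u. (s, u) \<in> U}" 
    using assms(2) by (auto intro!: open_vimage continuous_intros)
  then show "open ({u. (s, u) \<in> U} \<inter> {u. (s, u) \<in> S})" using assms(4) by blast
qed (use assms in auto)

text \<open>The spatial derivative of a local extension of the family is itself a local extension of
  the family of partial derivatives, which gives joint smoothness in time and space.\<close>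

lemma smooth_on_pd:
  fixes f :: "real \<Rightarrow> real ^ 'k::finite \<Rightarrow> 'c::real_normed_vector"
  assumes "smooth_on S (\<lambda>(s, u). f s u)" "\<And>s. open {u. (s, u) \<in> S}"
  shows "smooth_on S (\<lambda>(s, u). pd i (f s) u)"
  unfolding smooth_on_def
proof
  fix x assume x: "x \<in> S"
  obtain U h where U: "open U" "x \<in> U" "\<And>k. Ck_on k U h" "\<And>y. y \<in> U \<Longrightarrow> y \<in> S \<Longrightarrow> h y = (\<lambda>(s, u). f s u) y"
    using smooth_onE[OF assms(1) x] by blast
  have "frechet_derivative h (at (s, u)) (0, axis i 1) = pd i (f s) u" if "(s, u) \<in> U" "(s, u) \<in> S" for s u
    using slice_agree_derivative[OF U(3) U(1) that(1) assms(2) that(2), of "f s"] U(4)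
    by (metis (no_types, lifting) frechet_derivative_at pd_def case_prod_conv)
  moreover have "Ck_on k U (\<lambda>y. frechet_derivative h (at y) (0, axis i 1))" for k
    using U(3)[of "Suc k"] by simp
  ultimately show "\<exists>U h. open U \<and> x \<in> U \<and> (\<forall>k. Ck_on k U h) \<and> (\<forall>y\<in>U \<inter> S. h y = (\<lambda>(s, u). pd i (f s) u) y)"
    using U(1,2) by (intro exI[of _ U] exI[of _ "\<lambda>y. frechet_derivative h (at y) (0, axis i 1)"]) auto
qed

lemma smooth_on_slice:
  fixes f :: "real \<Rightarrow> 'b::euclidean_space \<Rightarrow> 'c::real_normed_vector"
  assumes "smooth_on S (\<lambda>(s, u). f s u)"
  shows "smooth_on {u. (t, u) \<in> S} (f t)"
proof -
  have "smooth_on {u. (t, u) \<in> S} (\<lambda>u::'b. (t, u))"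
    by (intro smooth_on_Pair smooth_on_const smooth_on_bounded_linear bounded_linear_ident)
  from smooth_on_compose[OF this assms] show ?thesis by auto
qed

text \<open>Makes derivatives within \<open>I\<close> unique at every time, end points included; all
  comparisons of two time derivatives rest on this.\<close>

lemma interval_at_within_nontrivial:
  assumes "is_interval I" "interior I \<noteq> {}" "t \<in> (I::real set)"
  shows "at t within I \<noteq> bot"
proof -
  obtain x where "x \<in> interior I" using assms by blast
  then obtain e where e: "e > 0" "ball x e \<subseteq> I" by (meson mem_interior)
  have "connected I" using assms is_interval_connected by blast
  moreover have "\<not> I \<subseteq> {a}" for a
  proof -
    have "x \<in> I" "x + e/2 \<in> I" using e by (auto simp: subset_iff dist_real_def)
    moreover have "x \<noteq> x + e/2" using e by simp
    ultimately show ?thesis by blast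
  qed
  ultimately have "t islimpt I"
    using connected_imp_perfect[of I t] assms(3) by blast
  then show ?thesis by (simp add: trivial_limit_within)
qed

text \<open>Different local extensions may disagree outside \<open>I\<close>, but their time
  derivatives on \<open>I\<close> are all the unique derivative within \<open>I\<close>. Hence the
  locally continuous candidates fit together to one function, as differentiation under the integral
  sign requires.\<close>

lemma smooth_on_time_derivative:
  fixes f :: "real \<Rightarrow> 'b::real_normed_vector \<Rightarrow> 'c::real_normed_vector"
  assumes "smooth_on (I \<times> Q) (\<lambda>(s, u). f s u)" "is_interval I" "interior I \<noteq> {}"
  obtains f' where "\<And>s u. s \<in> I \<Longrightarrow> u \<in> Q \<Longrightarrow> ((\<lambda>s. f s u) has_vector_derivative f' s u) (at s within I)"
    "continuous_on (I \<times> Q) (\<lambda>(s, u). f' s u)"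
proof
  define f' where "f' s u = vector_derivative (\<lambda>s. f s u) (at s within I)" for s u
  have *: "\<exists>U d. open U \<and> x \<in> U \<and> continuous_on U d \<and>
     (\<forall>(s, u) \<in> U \<inter> (I \<times> Q). ((\<lambda>s. f s u) has_vector_derivative d (s, u)) (at s within I) \<and> f' s u = d (s, u))"
    if x: "x \<in> I \<times> Q" for x
  proof -
    obtain U h where U: "open U" "x \<in> U" "\<And>k. Ck_on k U h"
        "\<And>y. y \<in> U \<Longrightarrow> y \<in> I \<times> Q \<Longrightarrow> h y = (\<lambda>(s, u). f s u) y"
      using smooth_onE[OF assms(1) x] by blast
    define d where "d y = frechet_derivative h (at y) (1, 0)" for y
    have "continuous_on U d" using U(3)[of "Suc 0"] by (simp add: d_def[abs_def])
    moreover have der: "((\<lambda>s. f s u) has_vector_derivative d (s, u)) (at s within I)" 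
      if "(s, u) \<in> U" "s \<in> I" "u \<in> Q" for s u
    proof -
      have "{s. (s, u) \<in> U} = (\<lambda>s. (s, u)) -` U" by auto
      then have o: "open {s. (s, u) \<in> U}"
        using U(1) by (auto intro!: open_vimage continuous_intros)
      have "((\<lambda>s. h (s, u)) has_vector_derivative d (s, u)) (at s within I)"
        unfolding d_def using slice_time_derivative[OF U(3) U(1) that(1)] .
      moreover have "\<forall>\<^sub>F s in at s within I. h (s, u) = f s u"
        unfolding eventually_at_topological using o U(4) that by auto
      moreover have "h (s, u) = f s u" using U(4) that by auto
      ultimately show ?thesis 
        unfolding has_vector_derivative_def
        by (rule has_derivative_transform_eventually) (use that in auto)
    qed
    moreover have "f' s u = d (s, u)" if "(s, u) \<in> U" "s \<in> I" "u \<in> Q" for s u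
      unfolding f'_def
      using vector_derivative_within[OF interval_at_within_nontrivial[OF assms(2,3) that(2)] der[OF that]] .
    ultimately show ?thesis using U(1,2) by (intro exI[of _ U] exI[of _ d]) auto
  qed
  show "((\<lambda>s. f s u) has_vector_derivative f' s u) (at s within I)" if "s \<in> I" "u \<in> Q" for s u
    using *[of "(s, u)"] that by force
  show "continuous_on (I \<times> Q) (\<lambda>(s, u). f' s u)"
    unfolding continuous_on_eq_continuous_within
  proof
    fix x assume x: "x \<in> I \<times> Q"
    from *[OF this] obtain U d where U: "open U" "x \<in> U" "continuous_on U d" 
      "\<And>s u. (s, u) \<in> U \<Longrightarrow> (s, u) \<in> I \<times> Q \<Longrightarrow> f' s u = d (s, u)" by blast
    have "continuous (at x within I \<times> Q) d"
      using U by (simp add: continuous_on_eq_continuous_at continuous_at_imp_continuous_at_within)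
    moreover have "\<forall>\<^sub>F y in at x within I \<times> Q. d y = (\<lambda>(s, u). f' s u) y"
      unfolding eventually_at_topological using U by (intro exI[of _ U]) auto
    ultimately show "continuous (at x within I \<times> Q) (\<lambda>(s, u). f' s u)"
      using U(2,4) x by (cases x) (auto simp: continuous_within intro: Lim_transform_eventually)
  qed
qed


section \<open>Charts, smooth families and induced metrics\<close>

lemma atlas_chart:
  assumes "smooth_atlas A" "c \<in> A"
  shows "open (fst c)" "open (cimg c)" "continuous_on (fst c) (snd c)" "continuous_on (cimg c) (pt c)"
    "\<And>p. p \<in> fst c \<Longrightarrow> pt c (snd c p) = p"
  using assms unfolding smooth_atlas_def homeomorphism_def by blast+

lemma cimg_pt: "u \<in> cimg c \<Longrightarrow> pt c u \<in> fst c" "u \<in> cimg c \<Longrightarrow> snd c (pt c u) = u"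
  by (auto simp: inv_into_into f_inv_into_f)

lemma charts_at_cover: "smooth_atlas A \<Longrightarrow> \<exists>c. c \<in> charts_at A p"
  unfolding smooth_atlas_def charts_at_def by blast

lemma atlas_cover: "smooth_atlas A \<Longrightarrow> \<exists>c. c \<in> A \<and> p \<in> fst c"
  unfolding smooth_atlas_def by blast

lemma chart_at_mem: "smooth_atlas A \<Longrightarrow> chart_at A p \<in> charts_at A p"
  unfolding chart_at_def using charts_at_cover by (metis someI_ex)

lemma charts_atD: "c \<in> charts_at A p \<Longrightarrow> c \<in> A" "c \<in> charts_at A p \<Longrightarrow> p \<in> fst c"
  by (auto simp: charts_at_def)

lemma charts_atI: "c \<in> A \<Longrightarrow> p \<in> fst c \<Longrightarrow> c \<in> charts_at A p"
  by (auto simp: charts_at_def)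

lemma charts_at_pt: "b \<in> B \<Longrightarrow> u \<in> cimg b \<Longrightarrow> b \<in> charts_at B (pt b u)"
  by (simp add: charts_atI cimg_pt)

lemma chart_image_eq:
  assumes "smooth_atlas B" "b \<in> B"
  shows "snd b ` (fst b \<inter> W) = {u. u \<in> cimg b \<and> pt b u \<in> W}"
  using atlas_chart(5)[OF assms] cimg_pt[of _ b] by force

lemma open_chart_image:
  assumes "smooth_atlas B" "b \<in> B" "open W"
  shows "open (snd b ` (fst b \<inter> W))"
proof -
  have "snd b ` (fst b \<inter> W) = pt b -` W \<inter> cimg b"
    unfolding chart_image_eq[OF assms(1,2)] by auto
  then show ?thesis
    using atlas_chart(2,4)[OF assms(1,2)] continuous_on_open_vimage assms(3) by metis
qed

abbreviation chart_domain ::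
  "real set \<Rightarrow> (real \<Rightarrow> 'a \<Rightarrow> 'm) \<Rightarrow> ('a, 'k::finite) chart \<Rightarrow> ('m, 'n::finite) chart \<Rightarrow> (real \<times> (real ^ 'k)) set" where
  "chart_domain I y b c \<equiv> {(t, u). t \<in> I \<and> u \<in> cimg b \<and> y t (pt b u) \<in> fst c}"

lemma smooth_map_id: "smooth_atlas A \<Longrightarrow> smooth_map A A id"
  unfolding smooth_map_def smooth_atlas_def by simp

lemma smooth_map_chart:
  assumes "smooth_atlas B" "smooth_atlas A" "smooth_map B A F" "b \<in> B" "c \<in> A"
  shows "open (snd b ` (fst b \<inter> F -` fst c))"
    "Ck_on k (snd b ` (fst b \<inter> F -` fst c)) (snd c \<circ> F \<circ> pt b)"
proof -
  have "open (F -` fst c)"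
    using assms(3) atlas_chart(1)[OF assms(2,5)] by (intro open_vimage) (auto simp: smooth_map_def)
  then show o: "open (snd b ` (fst b \<inter> F -` fst c))" by (rule open_chart_image[OF assms(1,4)])
  show "Ck_on k (snd b ` (fst b \<inter> F -` fst c)) (snd c \<circ> F \<circ> pt b)"
    using smooth_on_open_Ck[OF o] assms(3-5) unfolding smooth_map_def by blast
qed

lemma smooth_map_has_derivative:
  assumes "smooth_atlas B" "smooth_atlas A" "smooth_map B A F" "b \<in> charts_at B p" "c \<in> charts_at A (F p)"
  shows "((snd c \<circ> F \<circ> pt b) has_derivative (*v) (jacobian (snd c \<circ> F \<circ> pt b) (at (snd b p)))) (at (snd b p))"
proof -
  have p: "snd b p \<in> snd b ` (fst b \<inter> F -` fst c)" using assms(4,5) by (auto simp: charts_at_def)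
  note s = smooth_map_chart[OF assms(1-3) charts_atD(1)[OF assms(4)] charts_atD(1)[OF assms(5)]]
  have "(snd c \<circ> F \<circ> pt b) differentiable (at (snd b p))"
    using Ck_on_has_derivative[OF s(2) s(1) p] differentiableI by blast
  then show ?thesis using jacobian_works by blast
qed

lemma jacobian_unique:
  fixes f :: "real ^ 'k::finite \<Rightarrow> real ^ 'n::finite"
  assumes "(f has_derivative (*v) M) (at x)"
  shows "jacobian f (at x) = M"
  unfolding jacobian_def frechet_derivative_at[OF assms, symmetric] by simp

lemma pd_jacobian:
  fixes f :: "real ^ 'k::finite \<Rightarrow> real ^ 'n::finite"
  shows "pd i f x $ a = jacobian f (at x) $ a $ i"
  by (simp add: pd_def jacobian_def matrix_def)

lemma jacobian_chain:
  assumes "smooth_atlas B" "smooth_atlas A" "smooth_atlas C" "smooth_map B A F" "smooth_map A C K"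
    "b \<in> charts_at B p" "c \<in> charts_at A (F p)" "d \<in> charts_at C (K (F p))"
  shows "jacobian (snd d \<circ> (K \<circ> F) \<circ> pt b) (at (snd b p)) =
     jacobian (snd d \<circ> K \<circ> pt c) (at (snd c (F p))) ** jacobian (snd c \<circ> F \<circ> pt b) (at (snd b p))"
    (is "_ = ?J ** ?L")
proof (rule jacobian_unique)
  have bp: "pt b (snd b p) = p"
    using atlas_chart(5)[OF assms(1)] assms(6) by (auto simp: charts_at_def)
  have "((\<lambda>u. (snd d \<circ> K \<circ> pt c) ((snd c \<circ> F \<circ> pt b) u)) has_derivative (\<lambda>v. ?J *v (?L *v v))) (at (snd b p))"
    by (rule has_derivative_compose[OF smooth_map_has_derivative[OF assms(1,2,4,6,7)]])
       (simp only: comp_apply[of "snd c \<circ> F"] comp_apply[of "snd c"] bp smooth_map_has_derivative[OF assms(2,3,5,7,8)])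
  then show "((snd d \<circ> (K \<circ> F) \<circ> pt b) has_derivative (*v) (?J ** ?L)) (at (snd b p))"
    unfolding matrix_vector_mul_assoc
  proof (rule has_derivative_transform_within_open)
    show "open (snd b ` (fst b \<inter> F -` fst c))"
      using smooth_map_chart(1)[OF assms(1,2,4)] assms(6,7) by (auto simp: charts_at_def)
    show "snd b p \<in> snd b ` (fst b \<inter> F -` fst c)" using assms by (auto simp: charts_at_def)
    fix u assume "u \<in> snd b ` (fst b \<inter> F -` fst c)"
    then have "F (pt b u) \<in> fst c"
      using atlas_chart(5)[OF assms(1) charts_atD(1)[OF assms(6)]] by auto
    then show "(snd d \<circ> K \<circ> pt c) ((snd c \<circ> F \<circ> pt b) u) = (snd d \<circ> (K \<circ> F) \<circ> pt b) u"
      using atlas_chart(5)[OF assms(2) charts_atD(1)[OF assms(7)]] by simp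
  qed
qed

text \<open>A change of chart is the chain rule with the identity as one factor, because
  \<open>trans_jac c d\<close> is the Jacobian of the identity read in \<open>c\<close> and
  \<open>d\<close>.\<close>

lemma jacobian_change_target:
  assumes "smooth_atlas B" "smooth_atlas A" "smooth_map B A F"
    "b \<in> charts_at B p" "c \<in> charts_at A (F p)" "d \<in> charts_at A (F p)"
  shows "jacobian (snd d \<circ> F \<circ> pt b) (at (snd b p)) =
     trans_jac c d (F p) ** jacobian (snd c \<circ> F \<circ> pt b) (at (snd b p))"
  using jacobian_chain[OF assms(1,2,2,3) smooth_map_id[OF assms(2)] assms(4,5), of d] assms(6)
  by (simp add: trans_jac_def)

lemma jacobian_change_source:
  assumes "smooth_atlas B" "smooth_atlas A" "smooth_map B A F"
    "b \<in> charts_at B p" "b' \<in> charts_at B p" "c \<in> charts_at A (F p)"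
  shows "jacobian (snd c \<circ> F \<circ> pt b) (at (snd b p)) =
     jacobian (snd c \<circ> F \<circ> pt b') (at (snd b' p)) ** trans_jac b b' p"
  using jacobian_chain[OF assms(1,1,2) smooth_map_id[OF assms(1)] assms(3,4), of b' c] assms(5,6)
  by (simp add: trans_jac_def)

lemma trans_jac_inverse:
  assumes "smooth_atlas A" "c \<in> charts_at A p" "d \<in> charts_at A p"
  shows "trans_jac d c p ** trans_jac c d p = mat 1"
proof -
  have "jacobian (snd c \<circ> id \<circ> pt c) (at (snd c p)) = trans_jac d c p ** jacobian (snd d \<circ> id \<circ> pt c) (at (snd c p))"
    using jacobian_change_target[OF assms(1,1) smooth_map_id[OF assms(1)] assms(2), of d c] assms by simp
  moreover have "jacobian (snd c \<circ> id \<circ> pt c) (at (snd c p)) = mat 1"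
  proof (rule jacobian_unique)
    have "(*v) (mat 1 :: real^'b^'b) = (\<lambda>v. v)" by (auto simp: fun_eq_iff)
    then have "((\<lambda>u. u) has_derivative (*v) (mat 1)) (at (snd c p))" by simp
    then show "((snd c \<circ> id \<circ> pt c) has_derivative (*v) (mat 1)) (at (snd c p))"
      by (rule has_derivative_transform_within_open[OF _ atlas_chart(2)[OF assms(1) charts_atD(1)[OF assms(2)]]])
         (use assms(2) cimg_pt[of _ c] in \<open>auto simp: charts_at_def\<close>)
  qed
  ultimately show ?thesis by (simp add: trans_jac_def)
qed

lemma matrix_scaleR_mid:
  fixes J :: "real ^ 'k ^ 'n" and M :: "real ^ 'n ^ 'n"
  shows "transpose J ** (r *\<^sub>R M) ** J = r *\<^sub>R (transpose J ** M ** J)"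
  by (simp add: matrix_scalar_ac scalar_matrix_assoc)

text \<open>The transition Jacobian of the map is absorbed by the tensor law of \<open>g\<close>, so
  the target chart selected by \<open>chart_at\<close> can be replaced by a convenient one.\<close>

lemma pullback_metric_chart:
  assumes "smooth_atlas B" "smooth_atlas A" "smooth_map B A F" "riemannian_metric A g"
    "b \<in> charts_at B p" "c \<in> charts_at A (F p)"
  shows "pullback_metric A F g b p = transpose (jacobian (snd c \<circ> F \<circ> pt b) (at (snd b p))) ** g c (F p)
     ** jacobian (snd c \<circ> F \<circ> pt b) (at (snd b p))"
proof -
  define d where "d = chart_at A (F p)"
  have d: "d \<in> charts_at A (F p)" unfolding d_def using chart_at_mem[OF assms(2)] .
  have "g c (F p) = transpose (trans_jac c d (F p)) ** g d (F p) ** trans_jac c d (F p)"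
    using assms(4) assms(6) d unfolding riemannian_metric_def charts_at_def by blast
  moreover note jacobian_change_target[OF assms(1-3,5) assms(6) d]
  ultimately show ?thesis
    unfolding pullback_metric_def Let_def d_def[symmetric]
    by (simp add: matrix_transpose_mul matrix_mul_assoc)
qed

lemma pullback_metric_source:
  assumes "smooth_atlas B" "smooth_atlas A" "smooth_map B A F" "riemannian_metric A g"
    "b \<in> charts_at B p" "b' \<in> charts_at B p"
  shows "pullback_metric A F g b p = transpose (trans_jac b b' p) ** pullback_metric A F g b' p ** trans_jac b b' p"
proof -
  obtain c where c: "c \<in> charts_at A (F p)" using charts_at_cover[OF assms(2)] by blast
  show ?thesis
    unfolding pullback_metric_chart[OF assms(1-5) c] pullback_metric_chart[OF assms(1-4) assms(6) c]
      jacobian_change_source[OF assms(1-3,5,6) c]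
    by (simp add: matrix_transpose_mul matrix_mul_assoc)
qed

section \<open>Smooth families of maps\<close>

lemma smooth_family_slice:
  assumes "smooth_atlas B" "smooth_family B A I y" "t \<in> I"
  shows "smooth_map B A (y t)"
  unfolding smooth_map_def
proof (intro conjI ballI)
  have c: "continuous_on (I \<times> UNIV) (\<lambda>(t, p). y t p)" using assms(2) by (simp add: smooth_family_def)
  have "continuous_on UNIV (\<lambda>p::'a. (t, p))" by (intro continuous_on_Pair continuous_on_const continuous_on_id)
  from continuous_on_compose2[OF c this] show "continuous_on UNIV (y t)" using assms(3) by auto
  fix b c assume b: "b \<in> B" and "c \<in> A"
  then have "smooth_on {(t, u). t \<in> I \<and> u \<in> cimg b \<and> y t (pt b u) \<in> fst c} (\<lambda>(t, u). snd c (y t (pt b u)))"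
    using assms(2) by (simp add: smooth_family_def)
  from smooth_on_slice[OF this, of t] assms(3)
  show "smooth_on (snd b ` (fst b \<inter> y t -` fst c)) (snd c \<circ> y t \<circ> pt b)"
    unfolding chart_image_eq[OF assms(1) b] by (simp add: o_def)
qed

text \<open>Regarding a single map as a family allows results on composition and on pulled back
  metrics to be proved for families only.\<close>

lemma smooth_family_const:
  assumes "smooth_atlas B" "smooth_map B A F"
  shows "smooth_family B A I (\<lambda>_. F)"
  unfolding smooth_family_def
proof (intro conjI ballI)
  have c: "continuous_on UNIV F" using assms(2) by (simp add: smooth_map_def)
  show "continuous_on (I \<times> UNIV) (\<lambda>(t, p). F p)"
    unfolding split_beta by (rule continuous_on_compose2[OF c]) (auto intro!: continuous_intros)
  fix b c assume b: "b \<in> B" and "c \<in> A"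
  then have s: "smooth_on (snd b ` (fst b \<inter> F -` fst c)) (snd c \<circ> F \<circ> pt b)" 
    using assms(2) by (simp add: smooth_map_def)
  have "smooth_on {(t, u). t \<in> I \<and> u \<in> cimg b \<and> F (pt b u) \<in> fst c} (\<lambda>z. (snd c \<circ> F \<circ> pt b) (snd z))"
    by (rule smooth_on_compose[OF smooth_on_bounded_linear[OF bounded_linear_snd] s])
       (auto simp: chart_image_eq[OF assms(1) b])
  then show "smooth_on {(t, u). t \<in> I \<and> u \<in> cimg b \<and> F (pt b u) \<in> fst c} (\<lambda>(t, u). snd c (F (pt b u)))"
    by (simp only: case_prod_unfold comp_apply)
qed

lemma smooth_family_nhd:
  assumes "smooth_atlas B" "smooth_atlas A" "smooth_family B A I y" "b \<in> B" "c \<in> A"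
    "t \<in> I" "u \<in> cimg b" "y t (pt b u) \<in> fst c"
  obtains U where "open U" "(t, u) \<in> U" "\<And>s v. (s, v) \<in> U \<Longrightarrow> v \<in> cimg b"
    "\<And>s v. (s, v) \<in> U \<Longrightarrow> s \<in> I \<Longrightarrow> y s (pt b v) \<in> fst c"
proof -
  have c: "continuous_on (I \<times> UNIV) (\<lambda>(t, p). y t p)" using assms(3) by (simp add: smooth_family_def)
  have "continuous_on (I \<times> cimg b) (\<lambda>z. (fst z, pt b (snd z)))"
    by (intro continuous_intros continuous_on_compose2[OF atlas_chart(4)[OF assms(1,4)]]) auto
  from continuous_on_compose2[OF c this]
  have "continuous_on (I \<times> cimg b) (\<lambda>(s, v). y s (pt b v))" by (force simp: split_beta)
  from continuous_on_open_invariant[THEN iffD1, OF this, rule_format, OF atlas_chart(1)[OF assms(2,5)]]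
  obtain W where W: "open W" "W \<inter> (I \<times> cimg b) = (\<lambda>(s, v). y s (pt b v)) -` fst c \<inter> (I \<times> cimg b)" by blast
  show ?thesis
  proof
    show "open (W \<inter> UNIV \<times> cimg b)"
      using W(1) atlas_chart(2)[OF assms(1,4)] by (auto intro!: open_Times)
  qed (use W(2) assms(6-8) in \<open>auto simp: set_eq_iff\<close>)
qed

text \<open>The image of a source chart need not fit into one target chart. Smoothness is local and
  the family is continuous, so it can be tested on pieces whose image lies in a single target
  chart.\<close>

lemma smooth_family_local:
  assumes "smooth_atlas B" "smooth_atlas A" "smooth_family B A I y" "b \<in> B" "Z \<subseteq> I \<times> cimg b"
    "\<And>c. c \<in> A \<Longrightarrow> smooth_on (Z \<inter> chart_domain I y b c) q"
  shows "smooth_on Z q"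
proof (rule smooth_on_local)
  fix z assume "z \<in> Z"
  then obtain t u where z: "z = (t, u)" "t \<in> I" "u \<in> cimg b" using assms(5) by blast
  obtain c where c: "c \<in> A" "y t (pt b u) \<in> fst c" using atlas_cover[OF assms(2)] by blast
  obtain U where U: "open U" "(t, u) \<in> U" "\<And>s v. (s, v) \<in> U \<Longrightarrow> v \<in> cimg b"
    "\<And>s v. (s, v) \<in> U \<Longrightarrow> s \<in> I \<Longrightarrow> y s (pt b v) \<in> fst c"
    using smooth_family_nhd[OF assms(1-4) c(1) z(2,3) c(2)] by blast
  have "smooth_on (Z \<inter> U) q"
    by (rule smooth_on_subset[OF assms(6)[OF c(1)]]) (use U(4) assms(5) in auto)
  then show "\<exists>U. open U \<and> z \<in> U \<and> smooth_on (Z \<inter> U) q" using U(1,2) z(1) by blast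
qed

lemma smooth_family_chart:
  assumes "smooth_family B A I y" "b \<in> B" "c \<in> A"
  shows "smooth_on (Z \<inter> chart_domain I y b c) (\<lambda>(t, u). snd c (y t (pt b u)))"
  using assms unfolding smooth_family_def by (blast intro: smooth_on_subset)

lemma smooth_family_compose:
  assumes "smooth_atlas B" "smooth_atlas A" "smooth_family B A I x" "smooth_family A C J \<psi>" "I \<subseteq> J"
  shows "smooth_family B C I (\<lambda>s p. \<psi> s (x s p))"
  unfolding smooth_family_def
proof (intro conjI ballI)
  have cx: "continuous_on (I \<times> UNIV) (\<lambda>(t, p). x t p)" using assms(3) by (simp add: smooth_family_def)
  have cp: "continuous_on (J \<times> UNIV) (\<lambda>(t, p). \<psi> t p)" using assms(4) by (simp add: smooth_family_def)
  have "continuous_on (I \<times> UNIV) (\<lambda>z. (fst z, x (fst z) (snd z)))"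
    using cx by (intro continuous_intros) (simp add: split_beta)
  from continuous_on_compose2[OF cp this] assms(5)
  show "continuous_on (I \<times> UNIV) (\<lambda>(t, p). \<psi> t (x t p))" by (force simp: split_beta)
  fix b d assume b: "b \<in> B" and d: "d \<in> C"
  let ?S = "{(t, u). t \<in> I \<and> u \<in> cimg b \<and> \<psi> t (x t (pt b u)) \<in> fst d}"
  show "smooth_on ?S (\<lambda>(t, u). snd d (\<psi> t (x t (pt b u))))"
  proof (rule smooth_family_local[OF assms(1-3) b])
    fix c assume c: "c \<in> A"
    let ?Z = "?S \<inter> chart_domain I x b c"
    let ?X = "\<lambda>(s, v). snd c (x s (pt b v))"
    have "smooth_on ?Z (\<lambda>z. (\<lambda>(s, v). snd d (\<psi> s (pt c v))) (fst z, ?X z))"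
    proof (rule smooth_on_compose[where f = "\<lambda>z. (fst z, ?X z)" and g = "\<lambda>(s, v). snd d (\<psi> s (pt c v))"])
      show "smooth_on ?Z (\<lambda>z. (fst z, ?X z))"
        by (rule smooth_on_Pair[OF smooth_on_bounded_linear[OF bounded_linear_fst] smooth_family_chart[OF assms(3) b c]])
      show "smooth_on (chart_domain J \<psi> c d) (\<lambda>(s, v). snd d (\<psi> s (pt c v)))"
        using assms(4) d c by (simp add: smooth_family_def)
    qed (use assms(5) atlas_chart(5)[OF assms(2) c] in auto)
    then show "smooth_on ?Z (\<lambda>(t, u). snd d (\<psi> t (x t (pt b u))))"
      by (rule smooth_on_cong) (use atlas_chart(5)[OF assms(2) c] in auto)
  qed auto
qed

lemma smooth_map_compose:
  assumes "smooth_atlas B" "smooth_atlas A" "smooth_map B A F" "smooth_map A C K"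
  shows "smooth_map B C (K \<circ> F)"
proof -
  have "smooth_family B C {0} (\<lambda>s p. K (F p))"
    by (rule smooth_family_compose[OF assms(1,2) smooth_family_const[OF assms(1,3)] smooth_family_const[OF assms(2,4)] subset_refl])
  from smooth_family_slice[OF assms(1) this, of 0] show ?thesis by (simp add: comp_def)
qed

text \<open>Functoriality of the pullback with a constant factor carried along. It transfers the
  relation between \<open>gbar t\<close> and the fixed metric to immersed hypersurfaces.\<close>

lemma pullback_metric_compose_scaled:
  assumes "smooth_atlas B" "smooth_atlas A" "smooth_atlas C" "smooth_map B A F" "smooth_map A C K" 
    "riemannian_metric C g"
    "\<And>p c. c \<in> charts_at A p \<Longrightarrow> G c p = r *\<^sub>R pullback_metric C K g c p"
    "b \<in> charts_at B p"
  shows "pullback_metric A F G b p = r *\<^sub>R pullback_metric C (K \<circ> F) g b p"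
proof -
  define c where "c = chart_at A (F p)"
  have c: "c \<in> charts_at A (F p)" unfolding c_def using chart_at_mem[OF assms(2)] .
  obtain d where d: "d \<in> charts_at C (K (F p))" using charts_at_cover[OF assms(3)] by blast
  have d': "d \<in> charts_at C ((K \<circ> F) p)" using d by simp
  have "pullback_metric A F G b p = r *\<^sub>R (transpose (jacobian (snd c \<circ> F \<circ> pt b) (at (snd b p))) **
     pullback_metric C K g c (F p) ** jacobian (snd c \<circ> F \<circ> pt b) (at (snd b p)))"
    unfolding pullback_metric_def[of A] Let_def c_def[symmetric] assms(7)[OF c] by (rule matrix_scaleR_mid)
  then show ?thesis
    unfolding pullback_metric_chart[OF assms(1,3) smooth_map_compose[OF assms(1,2,4,5)] assms(6,8) d']
      pullback_metric_chart[OF assms(2,3,5,6) c d] jacobian_chain[OF assms(1-5,8) c d]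
    by (simp add: matrix_transpose_mul matrix_mul_assoc)
qed

lemma smooth_family_fun:
  assumes "smooth_atlas B" "smooth_atlas A" "smooth_family B A I y" "smooth_fun A f" "b \<in> B"
  shows "smooth_on (I \<times> cimg b) (\<lambda>(s, u). f (y s (pt b u)))"
proof (rule smooth_family_local[OF assms(1-3,5) subset_refl])
  fix c assume c: "c \<in> A"
  let ?Z = "I \<times> cimg b \<inter> chart_domain I y b c"
  have "smooth_on (cimg c) (f \<circ> pt c)" using assms(4) c by (simp add: smooth_fun_def)
  with smooth_family_chart[OF assms(3,5) c]
  have "smooth_on ?Z (\<lambda>z. (f \<circ> pt c) ((\<lambda>(t, u). snd c (y t (pt b u))) z))"
    by (rule smooth_on_compose) auto
  then show "smooth_on ?Z (\<lambda>(s, u). f (y s (pt b u)))"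
    by (rule smooth_on_cong) (use atlas_chart(5)[OF assms(2) c] in auto)
qed

lemma gram_entry:
  fixes J :: "real ^ 'k ^ 'n" and M :: "real ^ 'n ^ 'n"
  shows "(transpose J ** M ** J) $ i $ j = (\<chi> a. J $ a $ i) \<bullet> (M *v (\<chi> a. J $ a $ j))"
  unfolding matrix_mul_assoc[symmetric] 
  by (simp add: matrix_matrix_mult_def matrix_vector_mult_def transpose_def inner_vec_def)

lemma pullback_metric_entry:
  assumes "smooth_atlas B" "smooth_atlas A" "smooth_map B A F" "riemannian_metric A g"
    "b \<in> charts_at B p" "c \<in> charts_at A (F p)"
  shows "pullback_metric A F g b p $ i $ j =
    pd i (snd c \<circ> F \<circ> pt b) (snd b p) \<bullet> (g c (F p) *v pd j (snd c \<circ> F \<circ> pt b) (snd b p))"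
proof -
  have "pd i f x = (\<chi> a. jacobian f (at x) $ a $ i)" for i and f :: "real^'b \<Rightarrow> real^'d" and x
    by (simp add: vec_eq_iff pd_jacobian)
  then show ?thesis unfolding pullback_metric_chart[OF assms] gram_entry by simp
qed

lemma smooth_family_slice_open:
  assumes "smooth_atlas B" "smooth_atlas A" "smooth_family B A I y" "b \<in> B" "c \<in> A"
  shows "open {u. (s, u) \<in> chart_domain I y b c}"
proof (cases "s \<in> I")
  case True
  from smooth_map_chart(1)[OF assms(1,2) smooth_family_slice[OF assms(1,3) True] assms(4,5)] True
  show ?thesis by (simp add: chart_image_eq[OF assms(1,4)])
qed simp

lemma smooth_on_quadratic:
  fixes X Y :: "'a::real_normed_vector \<Rightarrow> real ^ 'n" and M :: "'a \<Rightarrow> real ^ 'n ^ 'n"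
  assumes "smooth_on S X" "smooth_on S Y" "smooth_on S M"
  shows "smooth_on S (\<lambda>x. X x \<bullet> (M x *v Y x))"
  unfolding inner_vec_def matrix_vector_mult_def
  by (simp, intro smooth_on_sum smooth_on_mult smooth_on_vec_nth assms)

lemma smooth_family_pullback:
  assumes "smooth_atlas B" "smooth_atlas A" "smooth_family B A I y" "riemannian_metric A g" "b \<in> B"
  shows "smooth_on (I \<times> cimg b) (\<lambda>(s, u). pullback_metric A (y s) g b (pt b u) $ i $ j)"
proof (rule smooth_family_local[OF assms(1-3,5) subset_refl])
  fix c assume c: "c \<in> A"
  let ?N = "chart_domain I y b c"
  let ?Y = "\<lambda>(t, u). (snd c \<circ> y t \<circ> pt b) u"
  have Y: "smooth_on ?N ?Y"
    using smooth_family_chart[OF assms(3,5) c, of UNIV] by (simp add: comp_def)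
  note pdY = smooth_on_pd[OF Y smooth_family_slice_open[OF assms(1-3,5) c]]
  have "smooth_on (cimg c) (g c \<circ> pt c)" using assms(4) c by (simp add: riemannian_metric_def)
  then have "smooth_on ?N (\<lambda>z. (g c \<circ> pt c) (?Y z))"
    by (rule smooth_on_compose[OF Y]) auto
  from smooth_on_quadratic[OF pdY[of i] pdY[of j] this]
  have "smooth_on (I \<times> cimg b \<inter> ?N) (\<lambda>z. (case z of (s, u) \<Rightarrow> pd i (snd c \<circ> y s \<circ> pt b) u) \<bullet>
      ((g c \<circ> pt c) (?Y z) *v (case z of (s, u) \<Rightarrow> pd j (snd c \<circ> y s \<circ> pt b) u)))"
    by (rule smooth_on_subset) blast
  then show "smooth_on (I \<times> cimg b \<inter> ?N) (\<lambda>(s, u). pullback_metric A (y s) g b (pt b u) $ i $ j)"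
  proof (rule smooth_on_cong)
    fix z assume z: "z \<in> I \<times> cimg b \<inter> ?N"
    obtain s v where sv: "z = (s, v)" by force
    with z have s: "s \<in> I" "v \<in> cimg b" "y s (pt b v) \<in> fst c" by auto
    from pullback_metric_entry[OF assms(1,2) smooth_family_slice[OF assms(1,3) s(1)] assms(4)
          charts_at_pt[OF assms(5) s(2)] charts_atI[OF c s(3)], of i j] cimg_pt(2)[OF s(2)]
         atlas_chart(5)[OF assms(2) c s(3)]
    show "(case z of (s, u) \<Rightarrow> pd i (snd c \<circ> y s \<circ> pt b) u) \<bullet> ((g c \<circ> pt c) (?Y z) *v
        (case z of (s, u) \<Rightarrow> pd j (snd c \<circ> y s \<circ> pt b) u)) = (case z of (s, u) \<Rightarrow> pullback_metric A (y s) g b (pt b u) $ i $ j)"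
      by (simp add: sv)
  qed
qed

lemma inner_transpose_mult:
  fixes J :: "real ^ 'k ^ 'n"
  shows "v \<bullet> (transpose J *v w) = (J *v v) \<bullet> w"
  by (metis dot_lmul_matrix vector_transpose_matrix)

lemma pullback_metric_pos:
  assumes "smooth_atlas B" "smooth_atlas A" "immersion B A F" "riemannian_metric A g"
    "b \<in> charts_at B p" "v \<noteq> 0"
  shows "v \<bullet> (pullback_metric A F g b p *v v) > 0"
proof -
  obtain c where c: "c \<in> charts_at A (F p)" using charts_at_cover[OF assms(2)] by blast
  have sm: "smooth_map B A F" using assms(3) by (simp add: immersion_def)
  define J where "J = jacobian (snd c \<circ> F \<circ> pt b) (at (snd b p))"
  have "inj (frechet_derivative (snd c \<circ> F \<circ> pt b) (at (snd b p)))"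
    using assms(3,5) c by (auto simp: immersion_def)
  moreover have "frechet_derivative (snd c \<circ> F \<circ> pt b) (at (snd b p)) = (*v) J"
    using frechet_derivative_at[OF smooth_map_has_derivative[OF assms(1,2) sm assms(5) c]] by (simp add: J_def)
  ultimately have "J *v v \<noteq> J *v 0" using assms(6) by (metis injD)
  then have "(J *v v) \<bullet> (g c (F p) *v (J *v v)) > 0"
    using assms(4) c by (auto simp: riemannian_metric_def charts_at_def)
  then show ?thesis
    unfolding pullback_metric_chart[OF assms(1,2) sm assms(4,5) c] J_def[symmetric]
    by (simp only: matrix_vector_mul_assoc[symmetric] inner_transpose_mult)
qed

text \<open>The segment from the identity matrix to \<open>M\<close> consists of invertible matrices.\<close>

lemma det_pos_of_pos_form:
  fixes M :: "real ^ 'k ^ 'k"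
  assumes "\<And>v. v \<noteq> 0 \<Longrightarrow> v \<bullet> (M *v v) > 0"
  shows "det M > 0"
proof (rule ccontr)
  assume "\<not> det M > 0"
  define P where "P s = (1 - s) *\<^sub>R mat 1 + s *\<^sub>R M" for s
  have ne: "det (P s) \<noteq> 0" if s: "s \<in> {0..1}" for s
  proof
    assume "det (P s) = 0"
    then obtain v where v: "v \<noteq> 0" "P s *v v = 0"
      using invertible_det_nz[of "P s"] invertible_left_inverse[of "P s"] matrix_left_invertible_ker[of "P s"] by blast
    have "v \<bullet> (P s *v v) = (1 - s) * (v \<bullet> v) + s * (v \<bullet> (M *v v))"
      by (simp add: P_def matrix_vector_mult_add_rdistrib scaleR_matrix_vector_assoc[symmetric] inner_add_right)
    moreover have "(1 - s) * (v \<bullet> v) + s * (v \<bullet> (M *v v)) > 0"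
    proof (cases "s = 0")
      case False
      then show ?thesis using s assms[OF v(1)] by (intro add_nonneg_pos mult_pos_pos mult_nonneg_nonneg) auto
    qed (use v in simp)
    ultimately show False using v by simp
  qed
  have "continuous_on {0..1} (\<lambda>s. det (P s))"
    unfolding det_def P_def by (intro continuous_intros)
  moreover have "det (P 0) = 1" "det (P 1) = det M" by (simp_all add: P_def)
  ultimately obtain s where "s \<in> {0..1}" "det (P s) = 0"
    using IVT2'[of "\<lambda>s. det (P s)" 1 0 0] \<open>\<not> det M > 0\<close> by auto
  then show False using ne by blast
qed

text \<open>Supplies the two-sided calculus missing at an end point of \<open>I\<close>: a smooth
  function on an open set, with values in the image of the target chart, that has the values and
  spatial derivatives of the family at times in \<open>I\<close>.\<close>

lemma smooth_family_extension:
  assumes "smooth_atlas B" "smooth_atlas A" "smooth_family B A I y" "b \<in> B" "c \<in> A"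
    "t \<in> I" "u0 \<in> cimg b" "y t (pt b u0) \<in> fst c"
  shows "\<exists>U h. open U \<and> (t, u0) \<in> U \<and> (\<forall>k. Ck_on k U h) \<and> h ` U \<subseteq> cimg c \<and>
    (\<forall>s u. (s, u) \<in> U \<longrightarrow> s \<in> I \<longrightarrow> u \<in> cimg b \<and> y s (pt b u) \<in> fst c \<and> h (s, u) = snd c (y s (pt b u)) \<and>
       ((\<lambda>u. snd c (y s (pt b u))) has_derivative (\<lambda>v. frechet_derivative h (at (s, u)) (0, v))) (at u))"
proof -
  let ?N = "chart_domain I y b c"
  have "smooth_on ?N (\<lambda>(s, u). snd c (y s (pt b u)))"
    using smooth_family_chart[OF assms(3-5), of UNIV] by simp
  moreover have "(t, u0) \<in> ?N" using assms(6-8) by simp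
  ultimately obtain U1 h where U1: "open U1" "(t, u0) \<in> U1" "\<And>k. Ck_on k U1 h"
    "\<And>w. w \<in> U1 \<Longrightarrow> w \<in> ?N \<Longrightarrow> h w = (\<lambda>(s, u). snd c (y s (pt b u))) w"
    by (rule smooth_onE) blast
  obtain U2 where U2: "open U2" "(t, u0) \<in> U2" "\<And>s v. (s, v) \<in> U2 \<Longrightarrow> v \<in> cimg b"
    "\<And>s v. (s, v) \<in> U2 \<Longrightarrow> s \<in> I \<Longrightarrow> y s (pt b v) \<in> fst c"
    using smooth_family_nhd[OF assms] by blast
  \<comment> \<open>The last factor keeps \<open>h\<close> in coordinates of actual points also at
    times outside \<open>I\<close>, where the family says nothing about \<open>h\<close>.\<close>
  define U where "U = (U1 \<inter> U2) \<inter> h -` cimg c"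
  have h: "h (s, u) = snd c (y s (pt b u))" if "(s, u) \<in> U1 \<inter> U2" "s \<in> I" for s u
    using U1(4)[of "(s, u)"] U2(3,4)[of s u] that by auto
  have "continuous_on (U1 \<inter> U2) h"
    using Ck_on_imp_continuous_on[OF U1(3)[of 0]] by (rule continuous_on_subset) blast
  then have "open (h -` cimg c \<inter> (U1 \<inter> U2))"
    using U1(1) U2(1) atlas_chart(2)[OF assms(2,5)] continuous_on_open_vimage[of "U1 \<inter> U2" h] by blast
  then have U: "open U" by (simp add: U_def Int_commute)
  have C: "Ck_on k U h" for k using U1(3) by (rule Ck_on_subset) (auto simp: U_def)
  have der: "((\<lambda>u. snd c (y s (pt b u))) has_derivative (\<lambda>v. frechet_derivative h (at (s, u)) (0, v))) (at u)"
    if "(s, u) \<in> U" "s \<in> I" for s u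
    by (rule slice_agree_derivative[OF C[of "Suc 0"] U that(1) smooth_family_slice_open[OF assms(1-5), of s]])
       (use h U2(3,4) that in \<open>auto simp: U_def\<close>)
  show ?thesis
  proof (intro exI[of _ U] exI[of _ h] conjI allI impI)
    show "(t, u0) \<in> U" "h ` U \<subseteq> cimg c" using h[of t u0] U1(2) U2(2) assms(6,8) by (auto simp: U_def)
    fix s u assume "(s, u) \<in> U" "s \<in> I"
    then show "u \<in> cimg b" "y s (pt b u) \<in> fst c" "h (s, u) = snd c (y s (pt b u))"
      using h[of s u] U2(3,4)[of s u] by (auto simp: U_def)
  qed (use U C der in auto)
qed


section \<open>First variation of the weighted area density\<close>

lemma matrix_vector_nth: "(A *v x) $ i = (\<Sum>j\<in>UNIV. A $ i $ j * x $ j)"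
  by (simp add: matrix_vector_mult_def)

lemma matrix_inv_mult:
  fixes A :: "real ^ 'n ^ 'n"
  assumes "det A \<noteq> 0"
  shows "A ** matrix_inv A = mat 1" "matrix_inv A ** A = mat 1"
proof -
  have "\<exists>A'. A ** A' = mat 1 \<and> A' ** A = mat 1"
    using assms invertible_det_nz[of A] by (simp add: invertible_def)
  from someI_ex[OF this] show "A ** matrix_inv A = mat 1" "matrix_inv A ** A = mat 1"
    by (simp_all add: matrix_inv_def)
qed

lemma matrix_inv_eqI:
  fixes A :: "real ^ 'n ^ 'n"
  assumes "A ** B = mat 1"
  shows "matrix_inv A = B"
proof -
  have "det A * det B = 1" using assms det_mul[of A B] by simp
  then have "det A \<noteq> 0" by auto
  then show ?thesis
    using assms matrix_inv_mult(2)[of A] by (metis matrix_mul_assoc matrix_mul_lid matrix_mul_rid)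
qed

lemma matrix_inv_symmetric:
  fixes A :: "real ^ 'n ^ 'n"
  assumes "det A \<noteq> 0" "transpose A = A"
  shows "transpose (matrix_inv A) = matrix_inv A"
proof -
  have "A ** transpose (matrix_inv A) = transpose (matrix_inv A ** A)"
    by (simp only: matrix_transpose_mul assms(2))
  also have "\<dots> = mat 1" by (simp only: matrix_inv_mult(2)[OF assms(1)] transpose_mat)
  finally show ?thesis by (rule matrix_inv_eqI[symmetric])
qed

lemma matrix_inv_scaleR:
  fixes A :: "real ^ 'n ^ 'n"
  assumes "det A \<noteq> 0" "c \<noteq> 0"
  shows "matrix_inv (c *\<^sub>R A) = inverse c *\<^sub>R matrix_inv A"
  by (rule matrix_inv_eqI)
     (simp add: assms matrix_inv_mult matrix_scalar_ac scalar_matrix_assoc[symmetric])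

lemma det_scaleR:
  fixes A :: "real ^ 'n ^ 'n"
  shows "det (c *\<^sub>R A) = c ^ CARD('n) * det A"
proof -
  have "c *\<^sub>R A = (\<chi> i. c *s A $ i)" by (simp add: vec_eq_iff)
  then show ?thesis using det_rows_mul[of "\<lambda>_. c" "\<lambda>i. A $ i"] by simp
qed

text \<open>Inverse metrics under a change of coordinates, with \<open>S\<close> the inverse of
  \<open>T\<close>. It is used both for the diffeomorphisms of the soliton and for charts of the
  hypersurface.\<close>

lemma matrix_inv_transform:
  fixes H S T :: "real ^ 'k ^ 'k"
  assumes "det H \<noteq> 0" "S ** T = mat 1"
  shows "matrix_inv (transpose T ** H ** T) = S ** matrix_inv H ** transpose S"
proof (rule matrix_inv_eqI)
  have ts: "T ** S = mat 1" using assms(2) matrix_left_right_inverse by blast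
  then have "transpose T ** transpose S = mat 1"
    by (metis assms(2) matrix_transpose_mul transpose_mat)
  then show "transpose T ** H ** T ** (S ** matrix_inv H ** transpose S) = mat 1"
    by (metis (no_types, lifting) matrix_inv_mult(1)[OF assms(1)] matrix_mul_assoc matrix_mul_rid ts)
qed

text \<open>Jacobi's formula for the derivative of a determinant, with the trace written in
  indices.\<close>

lemma det_has_derivative:
  fixes M :: "'a::real_normed_vector \<Rightarrow> real ^ 'n ^ 'n"
  assumes "\<And>i j. ((\<lambda>x. M x $ i $ j) has_derivative (\<lambda>w. M' w $ i $ j)) (at x)" "det (M x) \<noteq> 0"
  shows "((\<lambda>x. det (M x)) has_derivative
    (\<lambda>w. det (M x) * (\<Sum>i\<in>UNIV. \<Sum>j\<in>UNIV. matrix_inv (M x) $ i $ j * M' w $ j $ i))) (at x)"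
proof -
  let ?P = "{p. p permutes (UNIV :: 'n set)}"
  have "((\<lambda>x. det (M x)) has_derivative
    (\<lambda>w. \<Sum>p\<in>?P. of_int (sign p) * (\<Sum>i\<in>UNIV. M' w $ i $ p i * (\<Prod>j\<in>UNIV - {i}. M x $ j $ p j)))) (at x)"
    unfolding det_def by (intro has_derivative_sum has_derivative_mult_right has_derivative_prod assms(1))
  moreover have "(\<Sum>p\<in>?P. of_int (sign p) * (\<Sum>i\<in>UNIV. M' w $ i $ p i * (\<Prod>j\<in>UNIV - {i}. M x $ j $ p j)))
    = det (M x) * (\<Sum>i\<in>UNIV. \<Sum>j\<in>UNIV. matrix_inv (M x) $ i $ j * M' w $ j $ i)" for w
  proof -
    \<comment> \<open>The product rule in the permutation expansion of the determinant replaces one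
      row at a time by the same row of \<open>M' w\<close>; \<open>R i\<close> is the matrix with
      row \<open>i\<close> replaced.\<close>
    define R where "R i = (\<chi> r. if r = i then M' w $ i else M x $ r)" for i
    define C where "C = M' w ** matrix_inv (M x)"
    have "(\<Prod>r\<in>UNIV. R i $ r $ p r) = M' w $ i $ p i * (\<Prod>j\<in>UNIV - {i}. M x $ j $ p j)" for i p
      by (subst prod.remove[of _ i]) (auto simp: R_def intro!: prod.cong)
    then have "(\<Sum>p\<in>?P. of_int (sign p) * (\<Sum>i\<in>UNIV. M' w $ i $ p i * (\<Prod>j\<in>UNIV - {i}. M x $ j $ p j)))
       = (\<Sum>p\<in>?P. \<Sum>i\<in>UNIV. of_int (sign p) * (\<Prod>r\<in>UNIV. R i $ r $ p r))"
      by (simp add: sum_distrib_left)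
    also have "\<dots> = (\<Sum>i\<in>UNIV. det (R i))" unfolding det_def by (rule sum.swap)
    also have "\<dots> = (\<Sum>i\<in>UNIV. C $ i $ i * det (M x))"
    proof (rule sum.cong[OF refl])
      fix i
      have "C ** M x = M' w"
        using matrix_inv_mult(2)[OF assms(2)] by (simp add: C_def matrix_mul_assoc[symmetric])
      \<comment> \<open>Row \<open>i\<close> of \<open>M' w\<close> is a combination of the rows of
        \<open>M x\<close> with coefficients from \<open>C\<close>. By Cramer's lemma only the
        coefficient of row \<open>i\<close> itself survives in \<open>det (R i)\<close>, which
        produces the trace of \<open>C\<close>.\<close>
      then have "M' w $ i = (\<Sum>l\<in>UNIV. C $ i $ l *s row l (M x))"
        by (auto simp: vec_eq_iff row_def matrix_matrix_mult_def)
      then have "R i = (\<chi> r. if r = i then \<Sum>l\<in>UNIV. C $ i $ l *s row l (M x) else row r (M x))"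
        by (simp add: R_def vec_eq_iff row_def)
      then show "det (R i) = C $ i $ i * det (M x)" using cramer_lemma_transpose[of i "C $ i" "M x"] by simp
    qed
    also have "\<dots> = det (M x) * (\<Sum>i\<in>UNIV. \<Sum>j\<in>UNIV. M' w $ i $ j * matrix_inv (M x) $ j $ i)"
      by (simp add: C_def matrix_matrix_mult_def sum_distrib_left mult_ac)
    also have "(\<Sum>i\<in>UNIV. \<Sum>j\<in>UNIV. M' w $ i $ j * matrix_inv (M x) $ j $ i)
       = (\<Sum>i\<in>UNIV. \<Sum>j\<in>UNIV. matrix_inv (M x) $ i $ j * M' w $ j $ i)"
      by (subst sum.swap) (simp add: mult.commute)
    finally show ?thesis .
  qed
  ultimately show ?thesis by simp
qed

lemma bounded_bilinear_matrix_vector_mult: "bounded_bilinear ((*v) :: real ^ 'n ^ 'm \<Rightarrow> real ^ 'n \<Rightarrow> real ^ 'm)"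
  unfolding bilinear_conv_bounded_bilinear[symmetric] bilinear_def
  by (auto intro!: linearI simp: matrix_vector_mult_add_rdistrib matrix_vector_right_distrib 
      scaleR_matrix_vector_assoc[symmetric] matrix_vector_mult_scaleR)

lemma has_derivative_quadratic:
  fixes P :: "'a::real_normed_vector \<Rightarrow> real ^ 'm" and Q :: "'a \<Rightarrow> real ^ 'n" and M :: "'a \<Rightarrow> real ^ 'n ^ 'm"
  assumes "(P has_derivative P') (at x)" "(M has_derivative M') (at x)" "(Q has_derivative Q') (at x)"
  shows "((\<lambda>x. P x \<bullet> (M x *v Q x)) has_derivative
     (\<lambda>w. P' w \<bullet> (M x *v Q x) + P x \<bullet> (M' w *v Q x) + P x \<bullet> (M x *v Q' w))) (at x)"
  by (rule has_derivative_eq_rhs[OF has_derivative_inner[OF assms(1) 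
        bounded_bilinear.FDERIV[OF bounded_bilinear_matrix_vector_mult assms(2,3)]]])
     (simp add: fun_eq_iff inner_add_right)

lemma symmetric_quadratic_commute:
  fixes M :: "real ^ 'n ^ 'n"
  assumes "transpose M = M"
  shows "v \<bullet> (M *v w) = w \<bullet> (M *v v)"
  using inner_transpose_mult[of v M w] assms by (simp add: inner_commute)

text \<open>Cramer's rule writes each component of the solution as a quotient of determinants, hence
  of polynomials in the entries, so smoothness of matrix inversion need not be proved
  separately.\<close>

lemma smooth_on_matrix_inv_mult:
  fixes M :: "'a::real_normed_vector \<Rightarrow> real ^ 'n ^ 'n"
  assumes "\<And>i j. smooth_on S (\<lambda>x. M x $ i $ j)" "\<And>i. smooth_on S (\<lambda>x. b x $ i)" "\<And>x. x \<in> S \<Longrightarrow> det (M x) \<noteq> 0"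
  shows "smooth_on S (\<lambda>x. (matrix_inv (M x) *v b x) $ k)"
proof -
  have "smooth_on S (\<lambda>x. det (\<chi> i j. if j = k then b x $ i else M x $ i $ j) / det (M x))"
  proof (intro smooth_on_divide smooth_on_det assms)
    show "smooth_on S (\<lambda>x. (\<chi> i j. if j = k then b x $ i else M x $ i $ j) $ i $ j)" for i j
      using assms(1,2) by (cases "j = k") auto
  qed
  then show ?thesis
  proof (rule smooth_on_cong)
    fix x assume "x \<in> S"
    note d = assms(3)[OF this]
    have "M x *v (matrix_inv (M x) *v b x) = b x"
      by (simp add: matrix_vector_mul_assoc matrix_inv_mult[OF d])
    then show "det (\<chi> i j. if j = k then b x $ i else M x $ i $ j) / det (M x) = (matrix_inv (M x) *v b x) $ k"
      unfolding cramer[OF d] by simp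
  qed
qed

text \<open>The vectors \<open>X i\<close> together with the unit normal \<open>E\<close> are
  independent, and by the dimension count they span the space. The tangential coefficients then
  solve the linear system with the Gram matrix \<open>H\<close>.\<close>

lemma tangent_normal_decomposition:
  fixes G :: "real ^ 'n ^ 'n" and X :: "'k::finite \<Rightarrow> real ^ 'n"
  assumes "CARD('n) = CARD('k) + 1" "transpose G = G" "\<And>v. v \<noteq> 0 \<Longrightarrow> v \<bullet> (G *v v) > 0"
    "E \<bullet> (G *v E) = 1" "\<And>i. X i \<bullet> (G *v E) = 0"
    "H = (\<chi> i j. X i \<bullet> (G *v X j))" "det H \<noteq> 0"
  shows "Y = (Y \<bullet> (G *v E)) *\<^sub>R E + (\<Sum>m\<in>UNIV. (matrix_inv H *v (\<chi> j. X j \<bullet> (G *v Y))) $ m *\<^sub>R X m)"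
proof -
  define W where "W = matrix_inv H *v (\<chi> j. X j \<bullet> (G *v Y))"
  define R where "R = Y - ((Y \<bullet> (G *v E)) *\<^sub>R E + (\<Sum>m\<in>UNIV. W $ m *\<^sub>R X m))"
  \<comment> \<open>\<open>L\<close> assembles a vector from tangential coefficients and a normal
    one. Its injectivity comes from pairing with \<open>E\<close> and the \<open>X j\<close>, its
    surjectivity from equality of dimensions.\<close>
  define L where "L z = (\<Sum>m\<in>UNIV. fst z $ m *\<^sub>R X m) + snd z *\<^sub>R E" for z :: "(real^'k) \<times> real"
  note sym = symmetric_quadratic_commute[OF assms(2)]
  have HW: "(H *v c) $ j = X j \<bullet> (G *v (\<Sum>m\<in>UNIV. c $ m *\<^sub>R X m))" for c j
    unfolding matrix_vector_nth[of H]
    by (simp add: assms(6) linear_sum[OF matrix_vector_mul_linear] inner_sum_right 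
        matrix_vector_mult_scaleR mult.commute)
  have EX: "E \<bullet> (G *v X i) = 0" for i using assms(5) sym by metis
  have EL: "E \<bullet> (G *v L z) = snd z" for z
    by (simp add: L_def linear_sum[OF matrix_vector_mul_linear] matrix_vector_right_distrib inner_sum_right inner_add_right
        matrix_vector_mult_scaleR EX assms(4))
  have XL: "X j \<bullet> (G *v L z) = (H *v fst z) $ j" for z j
    by (simp add: L_def HW matrix_vector_right_distrib inner_add_right matrix_vector_mult_scaleR assms(5))
  have lin: "linear L"
    by (rule linearI) (simp_all add: L_def scaleR_add_left sum.distrib scaleR_sum_right algebra_simps)
  have "z = 0" if "L z = 0" for z
  proof -
    have "snd z = 0" using EL[of z] that by simp
    moreover have "H *v fst z = 0" using XL[of _ z] that by (simp add: vec_eq_iff)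
    then have "fst z = 0"
      using matrix_inv_mult(2)[OF assms(7)] by (metis matrix_vector_mul_assoc matrix_vector_mul_lid matrix_vector_mult_0_right)
    ultimately show ?thesis by (simp add: prod_eq_iff)
  qed
  then have inj: "inj L" using linear_injective_0[OF lin] by blast
  have "dim (range L) = dim (UNIV :: ((real^'k) \<times> real) set)"
    using dim_image_eq[OF lin] inj by simp
  then have "dim (range L) = DIM(real^'n)" using assms(1) by (simp add: dim_UNIV)
  then have "span (range L) = UNIV" using dim_eq_full by blast
  then have "range L = UNIV"
    using linear_subspace_image[OF lin subspace_UNIV] span_eq_iff by metis
  \<comment> \<open>The remainder \<open>R\<close> is orthogonal to \<open>E\<close> and to every
    \<open>X j\<close>. Being itself a combination of these vectors, it is orthogonal to itself and
    vanishes.\<close>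
  then obtain z where z: "R = L z" by (metis rangeE UNIV_I)
  have "E \<bullet> (G *v R) = 0"
    unfolding R_def using sym[of E Y]
    by (simp add: linear_sum[OF matrix_vector_mul_linear] matrix_vector_right_distrib matrix_vector_mult_diff_distrib inner_sum_right inner_add_right inner_diff_right
        matrix_vector_mult_scaleR EX assms(4))
  moreover have "X j \<bullet> (G *v R) = 0" for j
  proof -
    have "(H *v W) $ j = X j \<bullet> (G *v Y)"
      by (simp add: W_def matrix_vector_mul_assoc matrix_inv_mult[OF assms(7)])
    then show ?thesis
      unfolding R_def HW
      by (simp add: matrix_vector_right_distrib matrix_vector_mult_diff_distrib inner_add_right inner_diff_right
        matrix_vector_mult_scaleR assms(5))
  qed
  ultimately have "R \<bullet> (G *v R) = 0"
    by (subst z) (simp add: L_def inner_add_left inner_sum_left)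
  then have "R = 0" using assms(3)[of R] by force
  then show ?thesis by (simp add: R_def W_def)
qed

lemma linear_axis_expansion:
  fixes l :: "real ^ 'n \<Rightarrow> 'c::real_vector"
  assumes "linear l"
  shows "l P = (\<Sum>k\<in>UNIV. P $ k *\<^sub>R l (axis k 1))"
proof -
  have "P = (\<Sum>k\<in>UNIV. P $ k *\<^sub>R axis k 1)"
    by (simp add: vec_eq_iff axis_def if_distrib cong: if_cong)
  then show ?thesis using linear_sum[OF assms] linear_scale[OF assms] by (metis (no_types, lifting) sum.cong)
qed

text \<open>Koszul's formula for coordinates. Pairing with \<open>G y *v E\<close> cancels the
  inverse metric in the Christoffel symbols, so that only directional derivatives of the metric
  remain.\<close>

lemma christoffel_inner:
  fixes G :: "real ^ 'n::finite \<Rightarrow> real ^ 'n ^ 'n"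
  assumes "(G has_derivative G') (at y)" "transpose (G y) = G y" "det (G y) \<noteq> 0"
  shows "(\<chi> a. \<Sum>k\<in>UNIV. \<Sum>l\<in>UNIV. christoffel G a k l y * P $ k * Q $ l) \<bullet> (G y *v E)
     = (Q \<bullet> (G' P *v E) + P \<bullet> (G' Q *v E) - P \<bullet> (G' E *v Q)) / 2"
proof -
  define g where "g k l r = G' (axis k 1) $ l $ r" for k l r
  define T where "T k l r = g k l r + g l k r - g r k l" for k l r
  have pd: "pd k (\<lambda>y. G y $ l $ r) y = g k l r" for k l r
  proof -
    have "((\<lambda>y. G y $ l $ r) has_derivative (\<lambda>v. G' v $ l $ r)) (at y)"
      using bounded_linear.has_derivative[OF bounded_linear_vec_nth bounded_linear.has_derivative[OF bounded_linear_vec_nth assms(1)]] .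
    from frechet_derivative_at[OF this] show ?thesis by (simp add: pd_def g_def fun_eq_iff)
  qed
  have lin: "linear G'" using assms(1) has_derivative_linear by blast
  have G': "G' P $ l $ r = (\<Sum>k\<in>UNIV. P $ k * g k l r)" for P l r
    by (subst linear_axis_expansion[OF lin]) (simp add: g_def)
  have GE: "(\<Sum>a\<in>UNIV. matrix_inv (G y) $ a $ r * (G y *v E) $ a) = E $ r" for r
  proof -
    have "(transpose (matrix_inv (G y)) *v (G y *v E)) $ r = E $ r"
      unfolding matrix_inv_symmetric[OF assms(3,2)]
      by (simp add: matrix_vector_mul_assoc matrix_inv_mult[OF assms(3)])
    then show ?thesis unfolding matrix_vector_nth[of "transpose _"] by (simp add: transpose_def)
  qed
  have "(\<chi> a. \<Sum>k\<in>UNIV. \<Sum>l\<in>UNIV. christoffel G a k l y * P $ k * Q $ l) \<bullet> (G y *v E)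
    = (\<Sum>a\<in>UNIV. \<Sum>k\<in>UNIV. \<Sum>l\<in>UNIV. \<Sum>r\<in>UNIV. (matrix_inv (G y) $ a $ r * (G y *v E) $ a) * (T k l r * P $ k * Q $ l / 2))"
    by (simp add: inner_vec_def christoffel_def pd T_def[symmetric] sum_distrib_left sum_distrib_right mult_ac)
  \<comment> \<open>The sum over \<open>a\<close> is moved innermost, where \<open>GE\<close>
    evaluates the product of inverse metric and metric to a component of \<open>E\<close>.\<close>
  also have "\<dots> = (\<Sum>k\<in>UNIV. \<Sum>l\<in>UNIV. \<Sum>r\<in>UNIV. \<Sum>a\<in>UNIV. (matrix_inv (G y) $ a $ r * (G y *v E) $ a) * (T k l r * P $ k * Q $ l / 2))"
    by (rule trans[OF sum.swap], rule sum.cong[OF refl], rule trans[OF sum.swap], rule sum.cong[OF refl], rule sum.swap)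
  also have "\<dots> = (\<Sum>k\<in>UNIV. \<Sum>l\<in>UNIV. \<Sum>r\<in>UNIV. E $ r * (T k l r * P $ k * Q $ l / 2))"
    unfolding sum_distrib_right[symmetric] GE ..
  also have "\<dots> = ((\<Sum>k\<in>UNIV. \<Sum>l\<in>UNIV. \<Sum>r\<in>UNIV. E $ r * P $ k * Q $ l * g k l r) + 
     (\<Sum>k\<in>UNIV. \<Sum>l\<in>UNIV. \<Sum>r\<in>UNIV. E $ r * P $ k * Q $ l * g l k r) - (\<Sum>k\<in>UNIV. \<Sum>l\<in>UNIV. \<Sum>r\<in>UNIV. E $ r * P $ k * Q $ l * g r k l)) / 2"
    unfolding sum.distrib[symmetric] sum_subtractf[symmetric] sum_divide_distrib
    by (intro sum.cong refl) (simp add: T_def algebra_simps)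
  also have "(\<Sum>k\<in>UNIV. \<Sum>l\<in>UNIV. \<Sum>r\<in>UNIV. E $ r * P $ k * Q $ l * g k l r) = Q \<bullet> (G' P *v E)"
    unfolding inner_vec_def matrix_vector_mult_def G'
    by (simp add: sum_distrib_left sum_distrib_right mult_ac)
       (rule trans[OF sum.swap], rule sum.cong[OF refl], rule sum.swap)
  also have "(\<Sum>k\<in>UNIV. \<Sum>l\<in>UNIV. \<Sum>r\<in>UNIV. E $ r * P $ k * Q $ l * g l k r) = P \<bullet> (G' Q *v E)"
    unfolding inner_vec_def matrix_vector_mult_def G'
    by (simp add: sum_distrib_left sum_distrib_right mult_ac)
       (rule sum.cong[OF refl], rule sum.swap)
  also have "(\<Sum>k\<in>UNIV. \<Sum>l\<in>UNIV. \<Sum>r\<in>UNIV. E $ r * P $ k * Q $ l * g r k l) = P \<bullet> (G' E *v Q)"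
    unfolding inner_vec_def matrix_vector_mult_def G'
    by (simp add: sum_distrib_left sum_distrib_right mult_ac)
  finally show ?thesis .
qed

text \<open>The velocity splits into \<open>a E\<close> with \<open>a = \<eta> + E \<phi>\<close> and the tangential field \<open>W\<close>. The latter only
  contributes a divergence.\<close>

lemma first_variation:
  fixes h :: "real \<times> (real ^ 'k::finite) \<Rightarrow> real ^ 'n::finite" and G :: "real ^ 'n \<Rightarrow> real ^ 'n ^ 'n" and \<phi> E \<eta> K and t :: real and u0 :: "real ^ 'k"
  defines "D \<equiv> \<lambda>i y. frechet_derivative h (at y) (0, axis i 1)"
    and "X \<equiv> \<lambda>u. h (t, u)"
  defines "W \<equiv> \<lambda>u. matrix_inv (K (t, u)) *v (\<chi> j. frechet_derivative \<phi> (at (X u)) (D j (t, u)))"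
    and "F \<equiv> \<lambda>y. exp (- \<phi> (h y)) * sqrt (det (K y))"
    and "II \<equiv> \<lambda>i j. (\<chi> a. pd i (pd j X) u0 $ a +
            (\<Sum>k\<in>UNIV. \<Sum>l\<in>UNIV. christoffel G a k l (X u0) * pd i X u0 $ k * pd j X u0 $ l)) \<bullet> (G (X u0) *v E u0)"
    and "a0 \<equiv> \<eta> u0 + frechet_derivative \<phi> (at (X u0)) (E u0)"
  assumes U: "open U" "\<And>k. Ck_on k U h"
    and Q: "open Q" "h ` U \<subseteq> Q" "\<And>k. Ck_on k Q G" "\<And>k. Ck_on k Q \<phi>"
    and G: "\<And>y. y \<in> Q \<Longrightarrow> transpose (G y) = G y" "\<And>y v. y \<in> Q \<Longrightarrow> v \<noteq> 0 \<Longrightarrow> v \<bullet> (G y *v v) > 0"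
    and N: "open N" "u0 \<in> N" "\<And>u. u \<in> N \<Longrightarrow> (t, u) \<in> U"
    and K: "\<And>y. y \<in> U \<Longrightarrow> K y = (\<chi> i j. D i y \<bullet> (G (h y) *v D j y))" "\<And>u. u \<in> N \<Longrightarrow> det (K (t, u)) > 0"
    and E: "E differentiable (at u0)" "\<And>u. u \<in> N \<Longrightarrow> E u \<bullet> (G (X u) *v E u) = 1"
      "\<And>u i. u \<in> N \<Longrightarrow> D i (t, u) \<bullet> (G (X u) *v E u) = 0"
    and V: "\<And>u. u \<in> N \<Longrightarrow> frechet_derivative h (at (t, u)) (1, 0) = \<eta> u *\<^sub>R E u + gradient_coord G \<phi> (X u)"
    and \<eta>: "\<eta> u0 = (\<Sum>i\<in>UNIV. \<Sum>j\<in>UNIV. matrix_inv (K (t, u0)) $ i $ j * II i j)"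
    and card: "CARD('n) = CARD('k) + 1"
  shows "((\<lambda>s. F (s, u0)) has_real_derivative
     - a0\<^sup>2 * F (t, u0) + (\<Sum>m\<in>UNIV. pd m (\<lambda>u. W u $ m * F (t, u)) u0)) (at t)"
proof -
  define V where "V y = frechet_derivative h (at y) (1, 0)" for y
  define a where "a u = V (t, u) \<bullet> (G (X u) *v E u)" for u
  define c where "c = (t, u0)"
  have c: "c \<in> U" using N by (simp add: c_def)
  have hU: "h y \<in> Q" if "y \<in> U" for y using Q(2) that by blast
  have XO: "X u \<in> Q" if "u \<in> N" for u using hU[OF N(3)[OF that]] by (simp add: X_def)
  have CD: "Ck_on k U (D i)" for i k using U(2)[of "Suc k"] by (simp add: D_def)
  have CV: "Ck_on k U V" for k using U(2)[of "Suc k"] by (simp add: V_def[abs_def])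
  note dh = Ck_on_has_derivative[OF U(2) U(1)]
  note dD = Ck_on_has_derivative[OF CD U(1)]
  note dG = Ck_on_has_derivative[OF Q(3) Q(1)]
  note d\<phi> = Ck_on_has_derivative[OF Q(4) Q(1)]
  define Dh where "Dh = frechet_derivative h (at c)"
  define DD where "DD i = frechet_derivative (D i) (at c)" for i
  define G0 where "G0 = G (X u0)"
  define G' where "G' = frechet_derivative G (at (X u0))"
  define \<phi>' where "\<phi>' = frechet_derivative \<phi> (at (X u0))"
  define E' where "E' = frechet_derivative E (at u0)"
  define e where "e i = ((0, axis i 1) :: real \<times> (real ^ 'k))" for i
  have X0: "h c = X u0" by (simp add: X_def c_def)
  have dh0: "(h has_derivative Dh) (at c)" unfolding Dh_def by (rule dh[OF c])
  have dD0: "(D i has_derivative DD i) (at c)" for i unfolding DD_def by (rule dD[OF c])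
  have dG0: "(G has_derivative G') (at (X u0))" unfolding G'_def by (rule dG[OF XO[OF N(2)]])
  have d\<phi>0: "(\<phi> has_derivative \<phi>') (at (X u0))" unfolding \<phi>'_def by (rule d\<phi>[OF XO[OF N(2)]])
  have dE0: "(E has_derivative E') (at u0)" unfolding E'_def using E(1) by (simp add: frechet_derivative_works)
  have linG': "linear G'" using dG0 has_derivative_linear by blast
  have lin\<phi>': "linear \<phi>'" using d\<phi>0 has_derivative_linear by blast
  have dslice: "((\<lambda>u. q (t, u)) has_derivative (\<lambda>v. q' (0, v))) (at u0)"
    if "(q has_derivative q') (at c)" for q :: "real \<times> (real ^ 'k) \<Rightarrow> 'z::real_normed_vector" and q'
  proof -
    have "((\<lambda>u. (t, u)) has_derivative (\<lambda>v. (0, v))) (at u0)" by (auto intro!: derivative_eq_intros)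
    from has_derivative_compose[OF this] that show ?thesis by (simp add: c_def)
  qed
  \<comment> \<open>Symmetry of second derivatives is used twice: for two spatial directions it
    makes the coordinate Hessian symmetric, and for one time direction it turns the rate of change
    of a coordinate vector into a spatial derivative of the velocity.\<close>
  have schwarz: "frechet_derivative (\<lambda>y. frechet_derivative h (at y) v) (at c) w = frechet_derivative (\<lambda>y. frechet_derivative h (at y) w) (at c) v" for v w
    by (rule second_derivative_symmetric[OF U(1) c U(2)])
  have DDsym: "DD i (e j) = DD j (e i)" for i j
    using schwarz[of "e i" "e j"] by (simp add: DD_def D_def e_def)
  have DV: "(V has_derivative frechet_derivative V (at c)) (at c)"
    by (rule Ck_on_has_derivative[OF CV[of "Suc 0"] U(1) c])
  have VD: "frechet_derivative V (at c) (e i) = DD i (1, 0)" for i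
    using schwarz[of "(1,0)" "e i"] by (simp add: DD_def D_def e_def V_def[abs_def])
  define Xd where "Xd i = D i c" for i
  have Xd: "Dh (e i) = Xd i" for i by (simp add: Xd_def D_def Dh_def e_def)
  define K' where "K' w i j = DD i w \<bullet> (G0 *v Xd j) + Xd i \<bullet> (G' (Dh w) *v Xd j) + Xd i \<bullet> (G0 *v DD j w)" for w i j
  have dK: "((\<lambda>y. K y $ i $ j) has_derivative (\<lambda>w. K' w i j)) (at c)" for i j
  proof -
    have "((\<lambda>y. G (h y)) has_derivative (\<lambda>w. G' (Dh w))) (at c)"
      using has_derivative_compose[OF dh0, of G G'] dG0 X0 by simp
    from has_derivative_quadratic[OF dD0 this dD0]
    have "((\<lambda>y. D i y \<bullet> (G (h y) *v D j y)) has_derivative (\<lambda>w. K' w i j)) (at c)"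
      by (simp add: K'_def X0 G0_def Xd_def)
    then show ?thesis
      by (rule has_derivative_transform_within_open[OF _ U(1) c]) (simp add: K(1))
  qed
  have G0sym: "transpose G0 = G0" unfolding G0_def using G(1) XO N(2) by blast
  note sym0 = symmetric_quadratic_commute[OF G0sym]
  define H where "H = K c"
  define Hi where "Hi = matrix_inv H"
  have Hij: "H $ i $ j = Xd i \<bullet> (G0 *v Xd j)" for i j 
    unfolding H_def K(1)[OF c] by (simp add: Xd_def X0 G0_def)
  have detH: "det H > 0" unfolding H_def c_def using K(2) N(2) by blast
  have Hsym: "transpose H = H" by (simp add: vec_eq_iff transpose_def Hij sym0)
  have Hisym: "Hi $ i $ j = Hi $ j $ i" for i j
  proof -
    have "transpose Hi = Hi" unfolding Hi_def using matrix_inv_symmetric[OF _ Hsym] detH by simp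
    then show ?thesis by (metis (no_types, lifting) transpose_def vec_lambda_beta)
  qed
  define F' where "F' w = F c * ((\<Sum>i\<in>UNIV. \<Sum>j\<in>UNIV. Hi $ i $ j * K' w i j) / 2 - \<phi>' (Dh w))" for w
  have dF: "(F has_derivative F') (at c)"
  proof -
    have 1: "((\<lambda>y. det (K y)) has_derivative
      (\<lambda>w. det (K c) * (\<Sum>i\<in>UNIV. \<Sum>j\<in>UNIV. matrix_inv (K c) $ i $ j * (\<chi> i j. K' w i j) $ j $ i))) (at c)"
      by (rule det_has_derivative) (use dK detH in \<open>auto simp: H_def\<close>)
    have 2: "((\<lambda>y. \<phi> (h y)) has_derivative (\<lambda>w. \<phi>' (Dh w))) (at c)"
      using has_derivative_compose[OF dh0, of \<phi> \<phi>'] d\<phi>0 X0 by simp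
    have sq: "sqrt (det H) * sqrt (det H) = det H" using detH by simp
    have swap: "(\<Sum>i\<in>UNIV. \<Sum>j\<in>UNIV. Hi $ i $ j * K' w j i) = (\<Sum>i\<in>UNIV. \<Sum>j\<in>UNIV. Hi $ i $ j * K' w i j)" for w
      by (subst sum.swap) (simp add: Hisym)
    have "(F has_derivative (\<lambda>w. exp (- \<phi> (h c)) * (det (K c) * (\<Sum>i\<in>UNIV. \<Sum>j\<in>UNIV. matrix_inv (K c) $ i $ j * (\<chi> i j. K' w i j) $ j $ i) * (inverse (sqrt (det (K c))) / 2))
        + (- \<phi>' (Dh w)) * exp (- \<phi> (h c)) * sqrt (det (K c)))) (at c)"
      unfolding F_def using detH
      by (intro has_derivative_mult[OF has_derivative_exp[OF has_derivative_minus[OF 2]] has_derivative_real_sqrt[OF _ 1]]) (simp add: H_def)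
    then show ?thesis
    proof (rule has_derivative_eq_rhs, intro ext)
      fix w
      have "det H * inverse (sqrt (det H)) = sqrt (det H)" using sq detH by (simp add: field_simps)
      moreover have "det H * S * (inverse (sqrt (det H)) / 2) = (det H * inverse (sqrt (det H))) * (S / 2)" for S
        by simp
      ultimately have eq: "det H * S * (inverse (sqrt (det H)) / 2) = sqrt (det H) * (S / 2)" for S
        by (simp only:)
      show "exp (- \<phi> (h c)) * (det (K c) * (\<Sum>i\<in>UNIV. \<Sum>j\<in>UNIV. matrix_inv (K c) $ i $ j * (\<chi> i j. K' w i j) $ j $ i) * (inverse (sqrt (det (K c))) / 2))
        + (- \<phi>' (Dh w)) * exp (- \<phi> (h c)) * sqrt (det (K c)) = F' w"
        unfolding H_def[symmetric] Hi_def[symmetric] vec_lambda_beta swap eq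
        by (simp add: F'_def F_def H_def[symmetric] right_diff_distrib mult_ac)
    qed
  qed
  \<comment> \<open>The splitting is proved on the whole neighbourhood \<open>N\<close>, not just at
    \<open>u0\<close>, because it is differentiated in space afterwards.\<close>
  have decomp: "V (t, u) = a u *\<^sub>R E u + (\<Sum>m\<in>UNIV. W u $ m *\<^sub>R D m (t, u))"
      and aeq: "a u = \<eta> u + frechet_derivative \<phi> (at (X u)) (E u)" if u: "u \<in> N" for u
  proof -
    define M where "M = G (X u)"
    define g where "g = gradient_coord G \<phi> (X u)"
    have M: "transpose M = M" "\<And>v. v \<noteq> 0 \<Longrightarrow> v \<bullet> (M *v v) > 0" using G XO[OF u] by (auto simp: M_def)
    have "det M > 0" using det_pos_of_pos_form M(2) by blast
    then have Mg: "M *v g = (\<chi> i. pd i \<phi> (X u))"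
      by (simp add: g_def gradient_coord_def M_def[symmetric] matrix_vector_mul_assoc matrix_inv_mult)
    have lin: "linear (frechet_derivative \<phi> (at (X u)))" using has_derivative_linear[OF d\<phi>[OF XO[OF u]]] .
    have Mg': "v \<bullet> (M *v g) = frechet_derivative \<phi> (at (X u)) v" for v
      unfolding Mg by (subst linear_axis_expansion[OF lin]) (simp add: inner_vec_def pd_def)
    have gE: "g \<bullet> (M *v E u) = frechet_derivative \<phi> (at (X u)) (E u)"
      using symmetric_quadratic_commute[OF M(1), of g "E u"] Mg'[of "E u"] by simp
    have Vu: "V (t, u) = \<eta> u *\<^sub>R E u + g" using V[OF u] by (simp add: V_def g_def)
    show aeq: "a u = \<eta> u + frechet_derivative \<phi> (at (X u)) (E u)"
      unfolding a_def M_def[symmetric] Vu using E(2)[OF u] gE by (simp add: inner_add_left M_def)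
    have Kt: "K (t, u) = (\<chi> i j. D i (t, u) \<bullet> (M *v D j (t, u)))"
      using K(1)[OF N(3)[OF u]] by (simp add: M_def X_def)
    have "g = (g \<bullet> (M *v E u)) *\<^sub>R E u + (\<Sum>m\<in>UNIV. (matrix_inv (K (t, u)) *v (\<chi> j. D j (t, u) \<bullet> (M *v g))) $ m *\<^sub>R D m (t, u))"
      using K(2)[OF u] E(2,3)[OF u] by (intro tangent_normal_decomposition[OF card M _ _ Kt]) (auto simp: M_def)
    then have "g = frechet_derivative \<phi> (at (X u)) (E u) *\<^sub>R E u + (\<Sum>m\<in>UNIV. W u $ m *\<^sub>R D m (t, u))"
      unfolding Mg' gE W_def .
    then show "V (t, u) = a u *\<^sub>R E u + (\<Sum>m\<in>UNIV. W u $ m *\<^sub>R D m (t, u))"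
      unfolding Vu aeq by (simp add: scaleR_add_left)
  qed
  have a0: "a u0 = a0" using aeq[OF N(2)] by (simp add: a0_def)
  have dGX: "((\<lambda>u. G (X u)) has_derivative (\<lambda>v. G' (Dh (0, v)))) (at u0)"
    unfolding X_def using has_derivative_compose[OF dslice[OF dh0], of G G'] dG0 by (simp add: X_def)
  obtain a' where da: "(a has_derivative a') (at u0)"
    unfolding a_def using has_derivative_quadratic[OF dslice[OF DV] dGX dE0] by blast
  \<comment> \<open>Only existence of the derivative of \<open>W\<close> matters: its entries enter
    the final formula through the divergence alone.\<close>
  have "\<exists>W'. ((\<lambda>u. W u $ m) has_derivative W') (at u0)" for m
  proof -
    have sN: "smooth_on N (\<lambda>u. (t, u))"
      by (intro smooth_on_Pair smooth_on_const smooth_on_bounded_linear bounded_linear_ident)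
    have im: "(\<lambda>u. (t, u)) ` N \<subseteq> U" using N(3) by auto
    have sl: "smooth_on N (\<lambda>u. q (t, u))" if "\<And>k. Ck_on k U q" for q :: "real \<times> (real ^ 'k) \<Rightarrow> 'z::real_normed_vector"
      by (rule smooth_on_compose[OF sN smooth_onI[OF U(1) subset_refl that] im])
    have sD: "smooth_on N (\<lambda>u. D i (t, u))" for i by (rule sl[OF CD])
    have sG: "smooth_on N (\<lambda>u. G (X u))"
      unfolding X_def by (rule sl, rule Ck_on_compose[OF U(1) Q(1,2) U(2) Q(3)])
    have sK: "smooth_on N (\<lambda>u. K (t, u) $ i $ j)" for i j
      by (rule smooth_on_cong[OF smooth_on_quadratic[OF sD[of i] sD[of j] sG]]) (simp add: K(1)[OF N(3)] X_def)
    have C\<phi>: "Ck_on k U (\<lambda>y. \<phi> (h y))" for k by (rule Ck_on_compose[OF U(1) Q(1,2) U(2) Q(4)])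
    have "Ck_on k U (\<lambda>y. frechet_derivative (\<lambda>y. \<phi> (h y)) (at y) (e j))" for k j
      using C\<phi>[of "Suc k"] unfolding Ck_on.simps by blast
    then have "smooth_on N (\<lambda>u. frechet_derivative (\<lambda>y. \<phi> (h y)) (at (t, u)) (e j))" for j by (rule sl)
    moreover have "frechet_derivative (\<lambda>y. \<phi> (h y)) (at (t, u)) (e j) = frechet_derivative \<phi> (at (X u)) (D j (t, u))" if u: "u \<in> N" for u j
    proof -
      have "((\<lambda>y. \<phi> (h y)) has_derivative (\<lambda>w. frechet_derivative \<phi> (at (X u)) (frechet_derivative h (at (t, u)) w))) (at (t, u))"
        by (rule has_derivative_compose[OF dh[OF N(3)[OF u]]]) (use d\<phi>[OF XO[OF u]] in \<open>simp add: X_def\<close>)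
      from frechet_derivative_at[OF this, symmetric] show ?thesis by (simp add: D_def e_def)
    qed
    ultimately have "smooth_on N (\<lambda>u. frechet_derivative \<phi> (at (X u)) (D j (t, u)))" for j
      by (rule smooth_on_cong)
    then have "smooth_on N (\<lambda>u. W u $ m)"
      unfolding W_def using K(2) by (intro smooth_on_matrix_inv_mult[OF sK]) force+
    from smooth_on_open_Ck[OF N(1) this, of "Suc 0"] show ?thesis
      using Ck_on_has_derivative[OF _ N(1,2)] by blast
  qed
  then obtain W' where dW: "\<And>m. ((\<lambda>u. W u $ m) has_derivative W' m) (at u0)" by metis
  define ax where "ax i = (axis i 1 :: real ^ 'k)" for i
  have DDV: "DD i (1, 0) = a' (ax i) *\<^sub>R E u0 + a0 *\<^sub>R E' (ax i) + (\<Sum>m\<in>UNIV. W' m (ax i) *\<^sub>R Xd m + W u0 $ m *\<^sub>R DD m (e i))" for i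
  proof -
    have "((\<lambda>u. a u *\<^sub>R E u + (\<Sum>m\<in>UNIV. W u $ m *\<^sub>R D m (t, u))) has_derivative
       (\<lambda>v. (a u0 *\<^sub>R E' v + a' v *\<^sub>R E u0) + (\<Sum>m\<in>UNIV. W u0 $ m *\<^sub>R DD m (0, v) + W' m v *\<^sub>R D m (t, u0)))) (at u0)"
      by (intro has_derivative_add has_derivative_sum has_derivative_scaleR da dE0 dW dslice[OF dD0])
    then have "((\<lambda>u. V (t, u)) has_derivative
       (\<lambda>v. (a u0 *\<^sub>R E' v + a' v *\<^sub>R E u0) + (\<Sum>m\<in>UNIV. W u0 $ m *\<^sub>R DD m (0, v) + W' m v *\<^sub>R D m (t, u0)))) (at u0)"
      by (rule has_derivative_transform_within_open[OF _ N(1,2)]) (simp add: decomp)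
    from has_derivative_unique[OF this dslice[OF DV]] VD[of i]
    show ?thesis by (auto simp: fun_eq_iff e_def ax_def a0 Xd_def c_def add.commute)
  qed
  have V0: "Dh (1, 0) = a0 *\<^sub>R E u0 + (\<Sum>m\<in>UNIV. W u0 $ m *\<^sub>R Xd m)"
    using decomp[OF N(2)] by (simp add: V_def Dh_def c_def a0 Xd_def)
  have normal0: "Xd j \<bullet> (G0 *v E u0) = 0" for j using E(3)[OF N(2)] by (simp add: Xd_def c_def G0_def)
  \<comment> \<open>Differentiating the orthogonality of \<open>E\<close> to the tangent vectors
    expresses the derivative of the normal by second derivatives of the immersion. With Koszul's
    formula these combine to the second fundamental form below.\<close>
  have dnormal: "DD j (e i) \<bullet> (G0 *v E u0) + Xd j \<bullet> (G' (Xd i) *v E u0) + Xd j \<bullet> (G0 *v E' (ax i)) = 0" for i j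
  proof -
    have "((\<lambda>u. 0::real) has_derivative (\<lambda>v. DD j (0, v) \<bullet> (G (X u0) *v E u0) + D j (t, u0) \<bullet> (G' (Dh (0, v)) *v E u0) + D j (t, u0) \<bullet> (G (X u0) *v E' v))) (at u0)"
      by (rule has_derivative_transform_within_open[OF has_derivative_quadratic[OF dslice[OF dD0] dGX dE0] N(1,2)]) (simp add: E(3))
    from has_derivative_unique[OF this has_derivative_const]
    have "DD j (0, ax i) \<bullet> (G (X u0) *v E u0) + D j (t, u0) \<bullet> (G' (Dh (0, ax i)) *v E u0) + D j (t, u0) \<bullet> (G (X u0) *v E' (ax i)) = 0"
      by (simp add: fun_eq_iff)
    then show ?thesis using Xd[of i] by (simp add: e_def ax_def G0_def Xd_def c_def)
  qed
  have pdX: "pd i X u = D i (t, u)" if "u \<in> N" for i u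
    unfolding X_def pd_def D_def
    using frechet_derivative_at[OF slice_space_derivative[OF U(2) U(1) N(3)[OF that]], symmetric] by simp
  have pdpd: "pd i (pd j X) u0 = DD j (e i)" for i j
  proof -
    have "pd i (pd j X) u0 = pd i (\<lambda>u. D j (t, u)) u0"
      unfolding pd_def[of i]
      by (simp only: frechet_derivative_cong_open[OF N(1,2), of "pd j X" "\<lambda>u. D j (t, u)", OF pdX])
    also have "\<dots> = DD j (e i)"
      unfolding pd_def[of i] using frechet_derivative_at[OF dslice[OF dD0[of j]], symmetric] by (simp add: e_def)
    finally show ?thesis .
  qed
  have II: "II i j = DD j (e i) \<bullet> (G0 *v E u0) +
     (Xd j \<bullet> (G' (Xd i) *v E u0) + Xd i \<bullet> (G' (Xd j) *v E u0) - Xd i \<bullet> (G' (E u0) *v Xd j)) / 2" for i j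
  proof -
    have "det G0 > 0" unfolding G0_def by (rule det_pos_of_pos_form) (use G(2) XO[OF N(2)] in blast)
    then have "(\<chi> a. \<Sum>k\<in>UNIV. \<Sum>l\<in>UNIV. christoffel G a k l (X u0) * Xd i $ k * Xd j $ l) \<bullet> (G0 *v E u0)
     = (Xd j \<bullet> (G' (Xd i) *v E u0) + Xd i \<bullet> (G' (Xd j) *v E u0) - Xd i \<bullet> (G' (E u0) *v Xd j)) / 2"
      unfolding G0_def using G0sym by (intro christoffel_inner[OF dG0]) (auto simp: G0_def)
    moreover have "(\<chi> a. p $ a + q a) = p + (\<chi> a. q a)" for p :: "real ^ 'n" and q by (simp add: vec_eq_iff)
    ultimately show ?thesis
      unfolding II_def pdpd pdX[OF N(2)] G0_def[symmetric] c_def[symmetric] Xd_def[symmetric] by (simp add: inner_add_left)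
  qed
  \<comment> \<open>Variation of the induced metric: the normal speed contributes
    \<open>- 2 * a0\<close> times the second fundamental form, and the sum over \<open>m\<close> is
    the Lie derivative of the induced metric along \<open>W\<close>.\<close>
  have key: "K' (1, 0) i j = - 2 * a0 * II i j + (\<Sum>m\<in>UNIV. W u0 $ m * K' (e m) i j + W' m (ax i) * H $ m $ j + W' m (ax j) * H $ i $ m)" for i j
  proof -
    have dn: "E' (ax i) \<bullet> (G0 *v Xd j) = - (DD j (e i) \<bullet> (G0 *v E u0)) - Xd j \<bullet> (G' (Xd i) *v E u0)" for i j
      using dnormal[of j i] sym0[of "E' (ax i)" "Xd j"] by simp
    have dn': "Xd i \<bullet> (G0 *v E' (ax j)) = - (DD j (e i) \<bullet> (G0 *v E u0)) - Xd i \<bullet> (G' (Xd j) *v E u0)"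
      using dnormal[of i j] DDsym[of i j] by simp
    have n': "E u0 \<bullet> (G0 *v Xd j) = 0" using normal0[of j] sym0 by metis
    have 1: "DD i (1, 0) \<bullet> (G0 *v Xd j) = a0 * (E' (ax i) \<bullet> (G0 *v Xd j)) +
      (\<Sum>m\<in>UNIV. W' m (ax i) * H $ m $ j + W u0 $ m * (DD m (e i) \<bullet> (G0 *v Xd j)))"
      unfolding DDV by (simp add: inner_add_left inner_sum_left n' Hij)
    have 2: "Xd i \<bullet> (G0 *v DD j (1, 0)) = a0 * (Xd i \<bullet> (G0 *v E' (ax j))) +
      (\<Sum>m\<in>UNIV. W' m (ax j) * H $ i $ m + W u0 $ m * (Xd i \<bullet> (G0 *v DD m (e j))))"
      unfolding DDV by (simp add: inner_add_right matrix_vector_right_distrib linear_sum[OF matrix_vector_mul_linear]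
          inner_sum_right matrix_vector_mult_scaleR normal0 Hij)
    have 3: "Xd i \<bullet> (G' (Dh (1, 0)) *v Xd j) = a0 * (Xd i \<bullet> (G' (E u0) *v Xd j)) +
      (\<Sum>m\<in>UNIV. W u0 $ m * (Xd i \<bullet> (G' (Xd m) *v Xd j)))"
    proof -
      have l: "linear (\<lambda>v. Xd i \<bullet> (G' v *v Xd j))"
        by (rule linearI) (simp_all add: linear_add[OF linG'] linear_scale[OF linG'] matrix_vector_mult_add_rdistrib 
            inner_add_right scaleR_matrix_vector_assoc[symmetric])
      show ?thesis unfolding V0 by (simp add: linear_add[OF l] linear_scale[OF l] linear_sum[OF l])
    qed
    have "K' (1, 0) i j = a0 * (E' (ax i) \<bullet> (G0 *v Xd j) + Xd i \<bullet> (G0 *v E' (ax j)) + Xd i \<bullet> (G' (E u0) *v Xd j))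
       + (\<Sum>m\<in>UNIV. W u0 $ m * K' (e m) i j + W' m (ax i) * H $ m $ j + W' m (ax j) * H $ i $ m)"
      unfolding K'_def[of "(1, 0)"] 1 2 3 unfolding K'_def DDsym[of i] DDsym[of j] Xd
      by (simp add: sum.distrib algebra_simps)
    also have "E' (ax i) \<bullet> (G0 *v Xd j) + Xd i \<bullet> (G0 *v E' (ax j)) + Xd i \<bullet> (G' (E u0) *v Xd j) = - 2 * II i j"
      unfolding dn dn' II by (simp add: field_simps)
    finally show ?thesis by simp
  qed
  have HiH: "(\<Sum>j\<in>UNIV. Hi $ i $ j * H $ j $ m) = (if i = m then 1 else 0)" for i m
    using arg_cong[where f = "\<lambda>M. M $ i $ m", OF matrix_inv_mult(2)[of H]] detH
    by (simp add: Hi_def matrix_matrix_mult_def mat_def)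
  have Hsym': "H $ i $ j = H $ j $ i" for i j using sym0 by (simp add: Hij)
  have tr1: "(\<Sum>i\<in>UNIV. \<Sum>j\<in>UNIV. Hi $ i $ j * (\<Sum>m\<in>UNIV. W' m (ax i) * H $ m $ j)) = (\<Sum>m\<in>UNIV. W' m (ax m))"
  proof -
    have "(\<Sum>j\<in>UNIV. Hi $ i $ j * (\<Sum>m\<in>UNIV. W' m (ax i) * H $ m $ j)) = W' i (ax i)" for i
    proof -
      have "(\<Sum>j\<in>UNIV. Hi $ i $ j * (\<Sum>m\<in>UNIV. W' m (ax i) * H $ m $ j)) = (\<Sum>m\<in>UNIV. W' m (ax i) * (\<Sum>j\<in>UNIV. Hi $ i $ j * H $ j $ m))"
        unfolding sum_distrib_left by (subst sum.swap) (simp add: mult_ac Hsym')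
      then show ?thesis by (simp add: HiH if_distrib[where f = "(*) _"] cong: if_cong)
    qed
    then show ?thesis by simp
  qed
  have tr2: "(\<Sum>i\<in>UNIV. \<Sum>j\<in>UNIV. Hi $ i $ j * (\<Sum>m\<in>UNIV. W' m (ax j) * H $ i $ m)) = (\<Sum>m\<in>UNIV. W' m (ax m))"
    unfolding tr1[symmetric] by (subst sum.swap) (simp add: Hisym Hsym')
  \<comment> \<open>Tracing with the inverse induced metric turns the second fundamental form into
    \<open>\<eta> u0\<close>. The two terms with derivatives of \<open>W\<close> each give its
    coordinate divergence, whence the factor 2 that Jacobi's formula for the square root
    halves.\<close>
  have trK: "(\<Sum>i\<in>UNIV. \<Sum>j\<in>UNIV. Hi $ i $ j * K' (1, 0) i j) = - 2 * a0 * \<eta> u0 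
     + (\<Sum>m\<in>UNIV. W u0 $ m * (\<Sum>i\<in>UNIV. \<Sum>j\<in>UNIV. Hi $ i $ j * K' (e m) i j)) + 2 * (\<Sum>m\<in>UNIV. W' m (ax m))"
  proof -
    have "(\<Sum>i\<in>UNIV. \<Sum>j\<in>UNIV. Hi $ i $ j * K' (1, 0) i j) = 
       - 2 * a0 * (\<Sum>i\<in>UNIV. \<Sum>j\<in>UNIV. Hi $ i $ j * II i j) + (\<Sum>i\<in>UNIV. \<Sum>j\<in>UNIV. Hi $ i $ j * (\<Sum>m\<in>UNIV. W u0 $ m * K' (e m) i j))
       + (\<Sum>i\<in>UNIV. \<Sum>j\<in>UNIV. Hi $ i $ j * (\<Sum>m\<in>UNIV. W' m (ax i) * H $ m $ j))
       + (\<Sum>i\<in>UNIV. \<Sum>j\<in>UNIV. Hi $ i $ j * (\<Sum>m\<in>UNIV. W' m (ax j) * H $ i $ m))"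
      unfolding key sum.distrib distrib_left sum_distrib_left[of "- 2 * a0"] by (simp add: mult_ac)
    also have "(\<Sum>i\<in>UNIV. \<Sum>j\<in>UNIV. Hi $ i $ j * (\<Sum>m\<in>UNIV. W u0 $ m * K' (e m) i j))
      = (\<Sum>m\<in>UNIV. W u0 $ m * (\<Sum>i\<in>UNIV. \<Sum>j\<in>UNIV. Hi $ i $ j * K' (e m) i j))"
      unfolding sum_distrib_left
      by (rule trans[OF sum.cong[OF refl sum.swap]], rule trans[OF sum.swap]) (simp add: mult_ac)
    also have "(\<Sum>i\<in>UNIV. \<Sum>j\<in>UNIV. Hi $ i $ j * II i j) = \<eta> u0" unfolding \<eta> Hi_def H_def c_def ..
    finally show ?thesis unfolding tr1 tr2 by simp
  qed
  have pdWF: "pd m (\<lambda>u. W u $ m * F (t, u)) u0 = W u0 $ m * F' (e m) + W' m (ax m) * F c" for m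
  proof -
    have "((\<lambda>u. W u $ m * F (t, u)) has_derivative (\<lambda>v. W u0 $ m * F' (0, v) + W' m v * F (t, u0))) (at u0)"
      by (rule has_derivative_mult[OF dW dslice[OF dF]])
    from frechet_derivative_at[OF this, symmetric] show ?thesis by (simp add: pd_def e_def ax_def c_def)
  qed
  have "F' (1, 0) = - a0\<^sup>2 * F c + (\<Sum>m\<in>UNIV. pd m (\<lambda>u. W u $ m * F (t, u)) u0)"
  proof -
    have \<phi>V: "\<phi>' (Dh (1, 0)) = a0 * \<phi>' (E u0) + (\<Sum>m\<in>UNIV. W u0 $ m * \<phi>' (Xd m))"
      unfolding V0 by (simp add: linear_add[OF lin\<phi>'] linear_scale[OF lin\<phi>'] linear_sum[OF lin\<phi>'])
    define q where "q m = (\<Sum>i\<in>UNIV. \<Sum>j\<in>UNIV. Hi $ i $ j * K' (e m) i j) / 2 - \<phi>' (Xd m)" for m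
    have a0': "a0 = \<eta> u0 + \<phi>' (E u0)" by (simp add: a0_def \<phi>'_def)
    have "F' (1, 0) = F c * (- a0 * \<eta> u0 - a0 * \<phi>' (E u0) + (\<Sum>m\<in>UNIV. W' m (ax m)) + 
       (\<Sum>m\<in>UNIV. W u0 $ m * ((\<Sum>i\<in>UNIV. \<Sum>j\<in>UNIV. Hi $ i $ j * K' (e m) i j) / 2 - \<phi>' (Xd m))))"
      unfolding F'_def trK \<phi>V by (simp add: field_simps sum_subtractf sum_distrib_left sum_divide_distrib)
    \<comment> \<open>The normal speed \<open>a0\<close> multiplies the mean curvature and the
      normal derivative of the weight, whose sum is again \<open>a0\<close>; this produces the
      square that fixes the sign.\<close>
    also have "- a0 * \<eta> u0 - a0 * \<phi>' (E u0) = - a0\<^sup>2" by (simp add: a0' power2_eq_square algebra_simps)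
    finally have "F' (1, 0) = F c * (- a0\<^sup>2 + (\<Sum>m\<in>UNIV. W' m (ax m)) + (\<Sum>m\<in>UNIV. W u0 $ m * q m))"
      by (simp add: q_def)
    moreover have "F' (e m) = F c * q m" for m by (simp add: F'_def Xd q_def)
    ultimately show ?thesis
      unfolding pdWF by (simp add: sum.distrib sum_distrib_left distrib_left right_diff_distrib mult_ac)
  qed
  moreover have "((\<lambda>s. F (s, u0)) has_real_derivative F' (1, 0)) (at t)"
  proof -
    have "((\<lambda>s. (s, u0)) has_derivative (\<lambda>r. (r, 0))) (at t)" by (auto intro!: derivative_eq_intros)
    from has_derivative_compose[OF this, of F F'] dF
    have "((\<lambda>s. F (s, u0)) has_derivative (\<lambda>r. F' (r, 0))) (at t)" by (simp add: c_def)
    moreover have "F' (r, 0) = F' (1, 0) * r" for r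
      using linear_scale[OF has_derivative_linear[OF dF], of r "(1, 0)"] by simp
    then have "(\<lambda>r. F' (r, 0)) = (*) (F' (1, 0))" by (rule ext)
    ultimately show ?thesis by (simp only: has_field_derivative_def)
  qed
  ultimately show ?thesis by (simp only: c_def)
qed


section \<open>Partitions of unity\<close>

lemma Ck_on_extend_zero:
  assumes "open \<Omega>" "closed C" "C \<subseteq> \<Omega>" "Ck_on k \<Omega> f" "\<And>u. u \<in> \<Omega> \<Longrightarrow> u \<notin> C \<Longrightarrow> f u = 0"
  shows "Ck_on k UNIV (\<lambda>u. if u \<in> \<Omega> then f u else 0)"
proof (rule Ck_on_local)
  fix x
  show "\<exists>U. open U \<and> x \<in> U \<and> Ck_on k U (\<lambda>u. if u \<in> \<Omega> then f u else 0)"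
  proof (cases "x \<in> \<Omega>")
    case True
    have "Ck_on k \<Omega> (\<lambda>u. if u \<in> \<Omega> then f u else 0)"
      by (rule Ck_on_cong_imp[OF assms(1) _ assms(4)]) simp
    then show ?thesis using assms(1) True by blast
  next
    case False
    have "open (- C)" "x \<in> - C" using assms False by auto
    moreover have "Ck_on k (- C) (\<lambda>u. if u \<in> \<Omega> then f u else 0)"
      by (rule Ck_on_cong_imp[OF \<open>open (- C)\<close> _ Ck_on_const[OF \<open>open (- C)\<close>, of k 0]]) (use assms(5) in auto)
    ultimately show ?thesis by blast
  qed
qed simp

text \<open>The integral of \<open>P\<close> does not change when \<open>P\<close> is translated along the axis \<open>m\<close>.\<close>

lemma integral_pd_compact_support:
  fixes P :: "real ^ 'k::finite \<Rightarrow> real"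
  assumes "Ck_on 1 UNIV P" "\<And>u. u \<notin> cbox a b \<Longrightarrow> P u = 0"
  shows "integral (cbox a b) (pd m P) = 0"
proof -
  define e where "e = (axis m 1 :: real ^ 'k)"
  \<comment> \<open>A margin of 1 on every side keeps the support inside the translated box for all
    shifts \<open>s\<close> between -1 and 1, so the integral over the fixed larger box is constant
    in \<open>s\<close>.\<close>
  define A where "A = a - One"
  define B where "B = b + One"
  have C1: "Ck_on (Suc 0) UNIV P" using assms(1) by simp
  have cP: "continuous_on X P" for X
    using Ck_on_imp_continuous_on[OF assms(1)] continuous_on_subset by blast
  have cpd: "continuous_on X (pd m P)" for X
    using C1 continuous_on_subset[of UNIV] by (auto simp: pd_def[abs_def])
  have dP: "(P has_derivative frechet_derivative P (at u)) (at u)" for u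
    by (rule Ck_on_has_derivative[OF C1]) auto
  have e1: "\<bar>(s *\<^sub>R e) \<bullet> i\<bar> \<le> 1" if "s \<in> {-1..1}" "i \<in> Basis" for s i
  proof -
    have "\<bar>(s *\<^sub>R e) \<bullet> i\<bar> \<le> norm (s *\<^sub>R e)" using Basis_le_norm[OF that(2)] .
    also have "\<dots> \<le> 1" using that by (auto simp: e_def)
    finally show ?thesis .
  qed
  have sub: "cbox a b \<subseteq> cbox (A + s *\<^sub>R e) (B + s *\<^sub>R e)" if s: "s \<in> {-1..1}" for s
  proof
    fix u assume u: "u \<in> cbox a b"
    show "u \<in> cbox (A + s *\<^sub>R e) (B + s *\<^sub>R e)"
      unfolding mem_box
    proof
      fix i :: "real ^ 'k" assume i: "i \<in> Basis"
      have "One \<bullet> i = 1" using i by simp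
      moreover have "a \<bullet> i \<le> u \<bullet> i \<and> u \<bullet> i \<le> b \<bullet> i" using u i by (simp add: mem_box)
      ultimately show "(A + s *\<^sub>R e) \<bullet> i \<le> u \<bullet> i \<and> u \<bullet> i \<le> (B + s *\<^sub>R e) \<bullet> i"
        using e1[OF s i] by (simp only: A_def B_def inner_add_left inner_diff_left abs_le_iff) linarith
    qed
  qed
  have const: "integral (cbox A B) (\<lambda>u. P (u + s *\<^sub>R e)) = integral (cbox a b) P" if s: "s \<in> {-1..1}" for s
  proof -
    have "(P has_integral integral (cbox a b) P) (cbox (A + s *\<^sub>R e) (B + s *\<^sub>R e))"
      by (rule has_integral_on_superset[OF integrable_integral[OF integrable_continuous[OF cP]] assms(2) sub[OF s]])
    then show ?thesis using integral_shift_cbox_plus[of A B P "s *\<^sub>R e"] by (simp add: o_def add.commute integral_unique)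
  qed
  have "((\<lambda>s. integral (cbox A B) (\<lambda>u. P (u + s *\<^sub>R e))) has_vector_derivative
      integral (cbox A B) (\<lambda>u. pd m P (u + 0 *\<^sub>R e))) (at 0 within {-1..1})"
  proof (rule leibniz_rule_vector_derivative)
    fix s :: real and u
    have "((\<lambda>s. u + s *\<^sub>R e) has_derivative (\<lambda>r. r *\<^sub>R e)) (at s within {-1..1})" by (auto intro!: derivative_eq_intros)
    from has_derivative_compose[OF this dP]
    show "((\<lambda>s. P (u + s *\<^sub>R e)) has_vector_derivative pd m P (u + s *\<^sub>R e)) (at s within {-1..1})"
      unfolding has_vector_derivative_def pd_def e_def[symmetric]
      by (rule has_derivative_eq_rhs) (rule ext, rule linear_scale[OF has_derivative_linear[OF dP]])
    show "(\<lambda>u. P (u + s *\<^sub>R e)) integrable_on cbox A B"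
      by (intro integrable_continuous continuous_on_compose2[OF cP[of UNIV]] continuous_intros) auto
    show "continuous_on ({-1..1} \<times> cbox A B) (\<lambda>(s, u). pd m P (u + s *\<^sub>R e))"
      unfolding split_beta by (intro continuous_on_compose2[OF cpd[of UNIV]] continuous_intros) auto
  qed auto
  then have "((\<lambda>s. integral (cbox a b) P) has_vector_derivative
      integral (cbox A B) (\<lambda>u. pd m P (u + 0 *\<^sub>R e))) (at 0 within {-1..1})"
    by (rule has_vector_derivative_transform[rotated 2]) (simp_all add: const)
  moreover have "((\<lambda>s. integral (cbox a b) P) has_vector_derivative 0) (at 0 within {-1..1})"
    by (rule has_vector_derivative_const)
  ultimately have "integral (cbox A B) (\<lambda>u. pd m P (u + 0 *\<^sub>R e)) = 0"
    by (intro vector_derivative_unique_within_closed_interval[of "-1" 1 0]) auto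
  then have 0: "integral (cbox A B) (pd m P) = 0" by simp
  have "pd m P u = 0" if "u \<notin> cbox a b" for u
  proof -
    have "frechet_derivative P (at u) = frechet_derivative (\<lambda>_. 0) (at u)"
      by (rule frechet_derivative_cong_open[of "- cbox a b"]) (use that assms(2) in auto)
    then show ?thesis by (simp add: pd_def)
  qed
  moreover have "cbox a b \<subseteq> cbox A B" using sub[of 0] by simp
  ultimately have "(pd m P has_integral integral (cbox a b) (pd m P)) (cbox A B)"
    by (intro has_integral_on_superset[OF integrable_integral[OF integrable_continuous[OF cpd]]])
  with 0 show ?thesis by (metis integral_unique)
qed

lemma positive_part_square_derivative:
  "((\<lambda>z::real. (max 0 z)\<^sup>2) has_real_derivative 2 * max 0 z) (at z)"
proof -
  \<comment> \<open>At the kink, Caratheodory's slope function is \<open>max 0\<close> itself: it is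
    continuous and its value 0 at the origin is the derivative.\<close>
  have "\<exists>g. (\<forall>y. (max 0 y)\<^sup>2 - (max 0 z)\<^sup>2 = g y * (y - z)) \<and> isCont g z \<and> g z = 2 * max 0 z"
    if "z = 0"
    using that by (intro exI[of _ "max 0"]) (auto simp: power2_eq_square max_def intro!: continuous_intros)
  then have 0: ?thesis if "z = 0" using that unfolding CARAT_DERIV by blast
  have 1: ?thesis if "z > 0"
  proof -
    have "((\<lambda>z. z\<^sup>2) has_real_derivative 2 * max 0 z) (at z)" using that by (auto intro!: derivative_eq_intros)
    then show ?thesis by (rule has_field_derivative_transform_within_open[where S = "{0<..}"]) (use that in auto)
  qed
  have 2: ?thesis if "z < 0"
  proof -
    have "((\<lambda>z. 0) has_real_derivative 2 * max 0 z) (at z)" using that by (auto intro!: derivative_eq_intros)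
    then show ?thesis by (rule has_field_derivative_transform_within_open[where S = "{..<0}"]) (use that in auto)
  qed
  show ?thesis using 0 1 2 by linarith
qed

text \<open>Once differentiable bumps suffice, so that the square of the positive part can replace the
  usual exponential.\<close>

lemma bump_function:
  fixes u0 :: "real ^ 'k::finite"
  assumes "open \<Omega>" "u0 \<in> \<Omega>"
  obtains \<beta> a b where "Ck_on 1 UNIV \<beta>" "cbox a b \<subseteq> \<Omega>" "\<And>u. \<beta> u \<ge> (0::real)" "\<beta> u0 > 0" "\<And>u. u \<notin> cbox a b \<Longrightarrow> \<beta> u = 0" "box a b \<noteq> {}"
proof -
  obtain a b where ab: "cbox a b \<subseteq> \<Omega>" "u0 \<in> box a b"
    using assms open_contains_cbox by metis
  obtain r where r: "r > 0" "ball u0 r \<subseteq> box a b" using ab(2) open_box open_contains_ball by blast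
  \<comment> \<open>The squared positive part of \<open>r\<^sup>2\<close> minus the squared distance
    from \<open>u0\<close>: positive at the centre and zero off the ball, hence off the box that
    contains it.\<close>
  define \<beta> where "\<beta> u = (max 0 (r\<^sup>2 + - ((u - u0) \<bullet> (u - u0))))\<^sup>2" for u
  have q: "Ck_on 1 UNIV (\<lambda>z::real. (max 0 z)\<^sup>2)"
    unfolding One_nat_def
  proof (rule Ck_on_SucI)
    show "((\<lambda>z::real. (max 0 z)\<^sup>2) has_derivative (*) (2 * max 0 z)) (at z)" for z
      using positive_part_square_derivative by (simp add: has_field_derivative_def)
    show "Ck_on 0 UNIV (\<lambda>z::real. 2 * max 0 z * v)" for v by (simp, intro continuous_intros)
  qed simp
  have "Ck_on 1 UNIV (\<lambda>u. u - u0)"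
    using Ck_on_add[OF _ Ck_on_id Ck_on_const, of UNIV 1 "- u0"] by simp
  then have "Ck_on 1 UNIV (\<lambda>u. r\<^sup>2 + - ((u - u0) \<bullet> (u - u0)))"
    by (intro Ck_on_add Ck_on_const Ck_on_linear_compose[OF bounded_linear_minus[OF bounded_linear_ident]] Ck_on_inner) auto
  then have "Ck_on 1 UNIV \<beta>" unfolding \<beta>_def using Ck_on_compose[OF _ _ _ _ q] by blast
  moreover have "\<beta> u = 0" if "u \<notin> cbox a b" for u
  proof -
    have "u \<notin> ball u0 r" using that r(2) box_subset_cbox by blast
    then have "r \<le> norm (u - u0)" by (simp add: dist_norm norm_minus_commute)
    then have "r\<^sup>2 \<le> (u - u0) \<bullet> (u - u0)" using r(1) by (metis abs_le_square_iff abs_norm_cancel abs_of_pos power2_norm_eq_inner)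
    then show ?thesis by (simp add: \<beta>_def)
  qed
  moreover have "box a b \<noteq> {}" using ab(2) by blast
  ultimately show ?thesis using that[of \<beta> a b] ab(1) r(1) by (simp add: \<beta>_def)
qed

text \<open>The set is the continuous image of a compact box, and compact sets in a Hausdorff space
  are closed. Points outside it thus have neighbourhoods on which functions supported there
  vanish.\<close>

lemma chart_box_closed:
  fixes S :: "('s::t2_space, 'k::finite) chart set"
  assumes "smooth_atlas S" "b \<in> S" "cbox lo hi \<subseteq> cimg b"
  shows "closed {p \<in> fst b. snd b p \<in> cbox lo hi}"
proof -
  have "compact (pt b ` cbox lo hi)"
    by (rule compact_continuous_image[OF continuous_on_subset[OF atlas_chart(4)[OF assms(1,2)] assms(3)] compact_cbox])
  moreover have "pt b ` cbox lo hi = {p \<in> fst b. snd b p \<in> cbox lo hi}"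
  proof (rule equalityI)
    show "pt b ` cbox lo hi \<subseteq> {p \<in> fst b. snd b p \<in> cbox lo hi}"
      using cimg_pt[OF subsetD[OF assms(3)]] by (auto simp del: image_iff)
    show "{p \<in> fst b. snd b p \<in> cbox lo hi} \<subseteq> pt b ` cbox lo hi"
      using atlas_chart(5)[OF assms(1,2)] by (metis (mono_tags, lifting) image_eqI mem_Collect_eq subsetI)
  qed
  ultimately show ?thesis using compact_imp_closed by metis
qed

text \<open>A bump made in the chart \<open>b\<close> and extended by zero remains regular in any
  other chart: inside the domain of \<open>b\<close> by the transition map, and outside it because
  the closed box that carries the bump stays away.\<close>

lemma Ck_on_chart_zero:
  fixes S :: "('s::t2_space, 'k::finite) chart set"
  assumes "smooth_atlas S" "b \<in> S" "c \<in> S" "cbox lo hi \<subseteq> cimg b" "Ck_on k UNIV \<beta>" "\<And>u. u \<notin> cbox lo hi \<Longrightarrow> \<beta> u = 0"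
  shows "Ck_on k (cimg c) (\<lambda>u. if pt c u \<in> fst b then \<beta> (snd b (pt c u)) else (0::real))"
proof (rule Ck_on_local[OF atlas_chart(2)[OF assms(1,3)]])
  fix u assume u: "u \<in> cimg c"
  let ?f = "\<lambda>u. if pt c u \<in> fst b then \<beta> (snd b (pt c u)) else 0"
  show "\<exists>U. open U \<and> u \<in> U \<and> Ck_on k U ?f"
  proof (cases "pt c u \<in> fst b")
    case True
    define U where "U = snd c ` (fst c \<inter> fst b)"
    have U: "open U" unfolding U_def by (rule open_chart_image[OF assms(1,3) atlas_chart(1)[OF assms(1,2)]])
    have "smooth_on U (snd b \<circ> pt c)" using assms(1-3) unfolding smooth_atlas_def U_def by blast
    then have "Ck_on k U (snd b \<circ> pt c)" by (rule smooth_on_open_Ck[OF U])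
    from Ck_on_compose[OF U open_UNIV _ this assms(5)] have "Ck_on k U (\<lambda>u. \<beta> ((snd b \<circ> pt c) u))" by simp
    then have "Ck_on k U ?f"
      by (rule Ck_on_cong_imp[OF U, rotated]) (auto simp: U_def chart_image_eq[OF assms(1,3)])
    moreover have "u \<in> U" using u True unfolding U_def chart_image_eq[OF assms(1,3)] by blast
    ultimately show ?thesis using U by (intro exI[of _ U] conjI)
  next
    case False
    define C where "C = {p \<in> fst b. snd b p \<in> cbox lo hi}"
    have "open (- C)" unfolding C_def by (rule open_Compl[OF chart_box_closed[OF assms(1,2,4)]])
    define U where "U = snd c ` (fst c \<inter> - C)"
    have U: "open U" unfolding U_def by (rule open_chart_image[OF assms(1,3) \<open>open (- C)\<close>])
    have "u \<in> U" using u False by (simp add: U_def C_def chart_image_eq[OF assms(1,3)] del: image_iff)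
    moreover have "Ck_on k U ?f"
      by (rule Ck_on_cong_imp[OF U _ Ck_on_const[OF U, of k 0]])
         (use assms(6) in \<open>auto simp: U_def C_def chart_image_eq[OF assms(1,3)]\<close>)
    ultimately show ?thesis using U by (intro exI[of _ U] conjI)
  qed
qed

text \<open>By compactness finitely many bumps, indexed by their centres, have positive sum, and
  dividing by that sum normalises them. Boxes with nonempty interior are recorded so that a
  nonnegative continuous integrand with zero integral can later be shown to vanish on them.\<close>

lemma C1_partition_of_unity:
  fixes S :: "('s::t2_space, 'k::finite) chart set"
  assumes "smooth_atlas S" "compact (UNIV :: 's set)"
  obtains J :: "'s set" and b lo hi and \<zeta> :: "'s \<Rightarrow> 's \<Rightarrow> real" where
    "finite J" "\<And>i. i \<in> J \<Longrightarrow> b i \<in> S" "\<And>i. i \<in> J \<Longrightarrow> cbox (lo i) (hi i) \<subseteq> cimg (b i)"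
    "\<And>i p. \<zeta> i p \<ge> 0" "\<And>i p. i \<in> J \<Longrightarrow> \<zeta> i p \<noteq> 0 \<Longrightarrow> p \<in> fst (b i) \<and> snd (b i) p \<in> cbox (lo i) (hi i)"
    "\<And>i c. i \<in> J \<Longrightarrow> c \<in> S \<Longrightarrow> Ck_on 1 (cimg c) (\<lambda>u. \<zeta> i (pt c u))"
    "\<And>p. (\<Sum>i\<in>J. \<zeta> i p) = 1" "\<And>i. i \<in> J \<Longrightarrow> box (lo i) (hi i) \<noteq> {}"
proof -
  have "\<exists>b lo hi \<beta>. b \<in> S \<and> i \<in> fst b \<and> cbox lo hi \<subseteq> cimg b \<and> Ck_on 1 UNIV \<beta> \<and> (\<forall>u. \<beta> u \<ge> (0::real)) \<and> \<beta> (snd b i) > 0 \<and>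
     (\<forall>u. u \<notin> cbox lo hi \<longrightarrow> \<beta> u = 0) \<and> box lo hi \<noteq> {}" for i :: 's
  proof -
    obtain b where b: "b \<in> S" "i \<in> fst b" using atlas_cover[OF assms(1)] by blast
    then have "snd b i \<in> cimg b" by blast
    from bump_function[OF atlas_chart(2)[OF assms(1) b(1)] this] b show ?thesis by metis
  qed
  then obtain b lo hi \<beta> where b: "\<And>i. b i \<in> S" "\<And>i. i \<in> fst (b i)" "\<And>i. cbox (lo i) (hi i) \<subseteq> cimg (b i)"
    "\<And>i. Ck_on 1 UNIV (\<beta> i)" "\<And>i u. \<beta> i u \<ge> (0::real)" "\<And>i. \<beta> i (snd (b i) i) > 0"
    "\<And>i u. u \<notin> cbox (lo i) (hi i) \<Longrightarrow> \<beta> i u = 0" "\<And>i. box (lo i) (hi i) \<noteq> {}" by metis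
  define \<eta> where "\<eta> i p = (if p \<in> fst (b i) then \<beta> i (snd (b i) p) else 0)" for i p
  have C: "Ck_on 1 (cimg c) (\<lambda>u. \<eta> i (pt c u))" if "c \<in> S" for c i
    unfolding \<eta>_def using Ck_on_chart_zero[OF assms(1) b(1) that b(3) b(4) b(7)] .
  have nonneg: "\<eta> i p \<ge> 0" for i p using b(5) by (simp add: \<eta>_def)
  define T where "T i = {p \<in> fst (b i). \<beta> i (snd (b i) p) > 0}" for i
  have "open (T i)" for i
  proof -
    have "open {u. \<beta> i u > 0}"
      using Ck_on_imp_continuous_on[OF b(4)] by (intro open_Collect_less continuous_on_const) auto
    then have "open (snd (b i) -` {u. \<beta> i u > 0} \<inter> fst (b i))"
      using atlas_chart(1,3)[OF assms(1) b(1)] continuous_on_open_vimage by metis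
    moreover have "T i = snd (b i) -` {u. \<beta> i u > 0} \<inter> fst (b i)" by (auto simp: T_def)
    ultimately show ?thesis by simp
  qed
  moreover have "UNIV \<subseteq> (\<Union>i\<in>UNIV. T i)" using b(2,6) by (auto simp: T_def)
  ultimately obtain J where J: "finite J" "UNIV \<subseteq> (\<Union>i\<in>J. T i)"
    using compactE_image[OF assms(2), of UNIV T] by metis
  define B where "B p = (\<Sum>i\<in>J. \<eta> i p)" for p
  have Bpos: "B p > 0" for p
  proof -
    obtain i where "i \<in> J" "p \<in> T i" using J(2) by blast
    then show ?thesis unfolding B_def using J(1) nonneg
      by (intro sum_pos2[of J i]) (auto simp: T_def \<eta>_def)
  qed
  show ?thesis
  proof (rule that[of J b lo hi "\<lambda>i p. \<eta> i p * inverse (B p)"])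
    fix i p
    show "\<eta> i p * inverse (B p) \<ge> 0" using nonneg Bpos by (simp add: less_imp_le)
    show "p \<in> fst (b i) \<and> snd (b i) p \<in> cbox (lo i) (hi i)" if "\<eta> i p * inverse (B p) \<noteq> 0"
      using that b(7) by (auto simp: \<eta>_def split: if_splits)
    show "(\<Sum>i\<in>J. \<eta> i p * inverse (B p)) = 1"
      using Bpos[of p] by (simp add: sum_distrib_right[symmetric] B_def[symmetric])
  next
    fix i c assume c: "c \<in> S"
    have o: "open (cimg c)" using atlas_chart(2)[OF assms(1) c] .
    have "Ck_on 1 (cimg c) (\<lambda>u. B (pt c u))" unfolding B_def by (intro Ck_on_sum o C c)
    moreover have "(\<lambda>u. B (pt c u)) ` cimg c \<subseteq> - {0}" using Bpos by (metis ComplI image_subsetI less_irrefl singletonD)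
    ultimately have "Ck_on 1 (cimg c) (\<lambda>u. inverse (B (pt c u)))"
      by (rule Ck_on_compose[OF o open_Compl[OF closed_singleton], OF _ _ Ck_on_inverse, rotated])
    then show "Ck_on 1 (cimg c) (\<lambda>u. \<eta> i (pt c u) * inverse (B (pt c u)))" by (intro Ck_on_mult o C c)
  qed (use J b in auto)
qed


section \<open>Integration in charts\<close>

text \<open>Restricted to a chart domain, the measure is the image of an explicit density on
  coordinate space. The inverse chart is made total by a default value, which does no harm since the
  density is zero off the chart image.\<close>

lemma riemannian_measure_chart:
  fixes B :: "('a::t2_space, 'k::finite) chart set"
  assumes "smooth_atlas B" "b \<in> B" "riemannian_measure B h \<mu>"
    and d: "continuous_on (cimg b) (\<lambda>u. sqrt (det (h b (pt b u))))"
    and f: "f = (\<lambda>u. if u \<in> cimg b then pt b u else undefined)"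
  shows "f \<in> borel_measurable borel"
    and "density \<mu> (indicator (fst b)) =
      distr (density lborel (\<lambda>u. ennreal (indicator (cimg b) u * sqrt (det (h b (pt b u)))))) borel f"
proof -
  note ch = atlas_chart[OF assms(1,2)]
  show mf: "f \<in> borel_measurable borel"
    unfolding f using borel_measurable_continuous_on_if[OF _ ch(4), of "\<lambda>_. undefined"] ch(2) by simp
  have sets: "sets \<mu> = sets borel" using assms(3) by (simp add: riemannian_measure_def)
  let ?d = "\<lambda>u. ennreal (indicator (cimg b) u * sqrt (det (h b (pt b u))))"
  have "(\<lambda>u. indicator (cimg b) u *\<^sub>R sqrt (det (h b (pt b u)))) \<in> borel_measurable borel"
    using borel_measurable_continuous_on_indicator[OF _ d] ch(2) by simp
  then have md: "?d \<in> borel_measurable borel" by simp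
  show "density \<mu> (indicator (fst b)) = distr (density lborel ?d) borel f"
  proof (rule measure_eqI)
    show "sets (density \<mu> (indicator (fst b))) = sets (distr (density lborel ?d) borel f)" by (simp add: sets)
    fix E assume "E \<in> sets (density \<mu> (indicator (fst b)))"
    then have E: "E \<in> sets borel" by (simp add: sets)
    have fb: "fst b \<in> sets borel" using ch(1) by simp
    have "emeasure (density \<mu> (indicator (fst b))) E = emeasure \<mu> (fst b \<inter> E)"
      using E fb by (subst emeasure_density) (auto simp: sets indicator_inter_arith[symmetric] nn_integral_indicator measurable_cong_sets[OF sets refl])
    also have "\<dots> = (\<integral>\<^sup>+ u\<in>snd b ` (fst b \<inter> E). ennreal (sqrt (det (h b (pt b u)))) \<partial>lborel)"
    proof -
      have all: "\<forall>E\<in>sets borel. E \<subseteq> fst b \<longrightarrow>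
        emeasure \<mu> E = (\<integral>\<^sup>+ u\<in>snd b ` E. ennreal (sqrt (det (h b (pt b u)))) \<partial>lborel)"
        using assms(3) \<open>b \<in> B\<close> unfolding riemannian_measure_def by (elim conjE bspec)
      have "fst b \<inter> E \<in> sets borel" using E fb by (rule sets.Int[rotated])
      from mp[OF bspec[OF all this] Int_lower1] show ?thesis .
    qed
    also have "\<dots> = (\<integral>\<^sup>+ u. ?d u * indicator (f -` E) u \<partial>lborel)"
    proof (rule nn_integral_cong)
      fix u
      have "indicator (snd b ` (fst b \<inter> E)) u = (indicator (cimg b) u * indicator (f -` E) u :: ennreal)"
        unfolding chart_image_eq[OF assms(1,2)] by (auto simp: f indicator_def)
      moreover have "?d u = indicator (cimg b) u * ennreal (sqrt (det (h b (pt b u))))"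
        by (simp add: indicator_def)
      ultimately show "ennreal (sqrt (det (h b (pt b u)))) * indicator (snd b ` (fst b \<inter> E)) u = ?d u * indicator (f -` E) u"
        by (simp add: mult_ac)
    qed
    also have "\<dots> = emeasure (density lborel ?d) (f -` E)"
      using md measurable_sets[OF mf E] by (subst emeasure_density) auto
    also have "\<dots> = emeasure (distr (density lborel ?d) borel f) E"
      using mf E by (subst emeasure_distr) auto
    finally show "emeasure (density \<mu> (indicator (fst b))) E = emeasure (distr (density lborel ?d) borel f) E" .
  qed
qed

text \<open>The support condition confines the integrand to a compact box on which it is continuous
  in coordinates. This yields integrability and converts the Lebesgue integral into a gauge
  integral, for which differentiation under the integral sign is available.\<close>

lemma riemannian_integral_chart:
  fixes B :: "('a::t2_space, 'k::finite) chart set" and \<zeta> :: "'a \<Rightarrow> real"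
  assumes "smooth_atlas B" "b \<in> B" "riemannian_measure B h \<mu>"
    and d: "continuous_on (cimg b) (\<lambda>u. sqrt (det (h b (pt b u))))" "\<And>u. u \<in> cimg b \<Longrightarrow> det (h b (pt b u)) \<ge> 0"
    and \<zeta>: "continuous_on (cimg b) (\<lambda>u. \<zeta> (pt b u))"
      "\<And>p. \<zeta> p \<noteq> 0 \<Longrightarrow> p \<in> fst b \<and> snd b p \<in> cbox lo hi" and box: "cbox lo hi \<subseteq> cimg b"
  shows "integrable \<mu> \<zeta>"
    and "(LINT p|\<mu>. \<zeta> p) = integral (cbox lo hi) (\<lambda>u. \<zeta> (pt b u) * sqrt (det (h b (pt b u))))"
proof -
  note ch = atlas_chart[OF assms(1,2)]
  define f where "f = (\<lambda>u. if u \<in> cimg b then pt b u else undefined)"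
  note mf = riemannian_measure_chart(1)[OF assms(1-3) d(1) f_def]
  note meq = riemannian_measure_chart(2)[OF assms(1-3) d(1) f_def]
  have sets: "sets \<mu> = sets borel" using assms(3) by (simp add: riemannian_measure_def)
  let ?d = "\<lambda>u. indicator (cimg b) u * sqrt (det (h b (pt b u)))"
  have "(\<lambda>u. indicator (cimg b) u *\<^sub>R sqrt (det (h b (pt b u)))) \<in> borel_measurable borel"
    using borel_measurable_continuous_on_indicator[OF _ d(1)] ch(2) by simp
  then have md: "?d \<in> borel_measurable borel" by simp
  have "continuous_on (fst b) (\<lambda>p. \<zeta> (pt b (snd b p)))"
    using continuous_on_compose2[OF \<zeta>(1) ch(3)] by auto
  then have "continuous_on (fst b) \<zeta>" by (rule continuous_on_eq) (simp add: ch(5))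
  from borel_measurable_continuous_on_indicator[OF _ this] ch(1)
  have "(\<lambda>p. indicator (fst b) p *\<^sub>R \<zeta> p) \<in> borel_measurable borel" by simp
  moreover have "(\<lambda>p. indicator (fst b) p *\<^sub>R \<zeta> p) = \<zeta>" using \<zeta>(2) by (auto simp: fun_eq_iff indicator_def)
  ultimately have m\<zeta>: "\<zeta> \<in> borel_measurable borel" by simp
  have m\<zeta>': "\<zeta> \<in> borel_measurable \<mu>" using m\<zeta> measurable_cong_sets[OF sets refl] by blast
  have mi: "(indicator (fst b) :: _ \<Rightarrow> real) \<in> borel_measurable \<mu>"
    using ch(1) by (intro borel_measurable_indicator) (simp add: sets)
  have dens: "density \<mu> (\<lambda>p. ennreal (indicator (fst b) p)) = density \<mu> (indicator (fst b))"
    by (simp add: ennreal_indicator)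
  have i\<zeta>: "indicator (fst b) p *\<^sub>R \<zeta> p = \<zeta> p" for p using \<zeta>(2) by (auto simp: indicator_def)
  have dnn: "AE u in lborel. 0 \<le> ?d u" using d(2) by (auto simp: indicator_def)
  have mdl: "?d \<in> borel_measurable lborel" using md by simp
  have mzf: "(\<lambda>u. \<zeta> (f u)) \<in> borel_measurable lborel" using mf m\<zeta> by simp
  define g where "g u = \<zeta> (pt b u) * sqrt (det (h b (pt b u)))" for u
  have g: "?d u *\<^sub>R \<zeta> (f u) = indicator (cbox lo hi) u *\<^sub>R g u" for u
  proof (cases "u \<in> cimg b")
    case True
    then have "\<zeta> (pt b u) = 0" if "u \<notin> cbox lo hi" using \<zeta>(2)[of "pt b u"] cimg_pt(2)[of u b] that by auto
    then show ?thesis using True by (auto simp: g_def f_def indicator_def)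
  next
    case False
    then show ?thesis using box by (auto simp: indicator_def)
  qed
  have cg: "continuous_on (cbox lo hi) g"
    unfolding g_def using continuous_on_subset[OF d(1) box] continuous_on_subset[OF \<zeta>(1) box] by (intro continuous_on_mult)
  have ig: "set_integrable lborel (cbox lo hi) g"
    unfolding set_integrable_def by (rule borel_integrable_compact[OF compact_cbox cg])
  have "integrable \<mu> \<zeta> \<longleftrightarrow> integrable (density \<mu> (\<lambda>p. ennreal (indicator (fst b) p))) \<zeta>"
    using integrable_density[OF m\<zeta>' mi] unfolding i\<zeta> by simp
  also have "\<dots> \<longleftrightarrow> integrable (density lborel (\<lambda>u. ennreal (?d u))) (\<lambda>u. \<zeta> (f u))"
    unfolding dens meq by (rule integrable_distr_eq) (use mf m\<zeta> in simp_all)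
  also have "\<dots> \<longleftrightarrow> integrable lborel (\<lambda>u. ?d u *\<^sub>R \<zeta> (f u))"
    by (rule integrable_density[OF mzf mdl dnn])
  also have "\<dots>" unfolding g using ig by (simp add: set_integrable_def)
  finally show "integrable \<mu> \<zeta>" .
  have "(LINT p|\<mu>. \<zeta> p) = (LINT p|density \<mu> (\<lambda>p. ennreal (indicator (fst b) p)). \<zeta> p)"
    using integral_density[OF m\<zeta>' mi] unfolding i\<zeta> by simp
  also have "\<dots> = (LINT u|density lborel (\<lambda>u. ennreal (?d u)). \<zeta> (f u))"
    unfolding dens meq by (rule integral_distr) (use mf m\<zeta> in simp_all)
  also have "\<dots> = (LINT u|lborel. ?d u *\<^sub>R \<zeta> (f u))"
    by (rule integral_density[OF mzf mdl dnn])
  also have "\<dots> = (LINT u:cbox lo hi|lborel. g u)" unfolding g set_lebesgue_integral_def ..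
  also have "\<dots> = integral (cbox lo hi) g" by (rule set_borel_integral_eq_integral(2)[OF ig])
  finally show "(LINT p|\<mu>. \<zeta> p) = integral (cbox lo hi) (\<lambda>u. \<zeta> (pt b u) * sqrt (det (h b (pt b u))))"
    by (simp add: g_def[abs_def])
qed


section \<open>The flow in the fixed manifold\<close>

text \<open>Differentials pull back by the transposed Jacobian. The case of the soliton
  diffeomorphism gives the gradient of \<open>fbar t\<close>; the identity map gives a change of
  chart.\<close>

lemma chart_gradient_chain:
  fixes q :: "'m::topological_space \<Rightarrow> real"
  assumes "smooth_atlas B" "smooth_atlas A" "smooth_map B A F" "b \<in> charts_at B p" "c \<in> charts_at A (F p)"
    "(q \<circ> pt c) differentiable (at (snd c (F p)))"
  shows "(\<chi> i. pd i (q \<circ> F \<circ> pt b) (snd b p)) =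
     transpose (jacobian (snd c \<circ> F \<circ> pt b) (at (snd b p))) *v (\<chi> a. pd a (q \<circ> pt c) (snd c (F p)))"
proof -
  note b = charts_atD[OF assms(4)]
  note c = charts_atD[OF assms(5)]
  define J where "J = jacobian (snd c \<circ> F \<circ> pt b) (at (snd b p))"
  define q' where "q' = frechet_derivative (q \<circ> pt c) (at (snd c (F p)))"
  have dq: "((q \<circ> pt c) has_derivative q') (at (snd c (F p)))"
    unfolding q'_def using assms(6) by (simp add: frechet_derivative_works)
  have dJ: "((snd c \<circ> F \<circ> pt b) has_derivative (*v) J) (at (snd b p))"
    unfolding J_def by (rule smooth_map_has_derivative[OF assms(1-5)])
  have "(snd c \<circ> F \<circ> pt b) (snd b p) = snd c (F p)" using atlas_chart(5)[OF assms(1) b] by simp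
  with has_derivative_compose[OF dJ, of "q \<circ> pt c" q'] dq
  have "((\<lambda>u. (q \<circ> pt c) ((snd c \<circ> F \<circ> pt b) u)) has_derivative (\<lambda>w. q' (J *v w))) (at (snd b p))" by metis
  then have "((q \<circ> F \<circ> pt b) has_derivative (\<lambda>w. q' (J *v w))) (at (snd b p))"
  proof (rule has_derivative_transform_within_open)
    show "open (snd b ` (fst b \<inter> F -` fst c))" by (rule smooth_map_chart(1)[OF assms(1-3) b(1) c(1)])
    show "snd b p \<in> snd b ` (fst b \<inter> F -` fst c)" using b(2) c(2) by auto
    fix u assume "u \<in> snd b ` (fst b \<inter> F -` fst c)"
    then have "F (pt b u) \<in> fst c" using atlas_chart(5)[OF assms(1) b(1)] by auto
    then show "(q \<circ> pt c) ((snd c \<circ> F \<circ> pt b) u) = (q \<circ> F \<circ> pt b) u"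
      using atlas_chart(5)[OF assms(2) c(1)] by simp
  qed
  from frechet_derivative_at[OF this, symmetric]
  have pd: "pd i (q \<circ> F \<circ> pt b) (snd b p) = q' (J *v axis i 1)" for i by (simp add: pd_def)
  have "pd i (q \<circ> F \<circ> pt b) (snd b p) = (transpose J *v (\<chi> a. pd a (q \<circ> pt c) (snd c (F p)))) $ i" for i
    unfolding pd linear_axis_expansion[OF has_derivative_linear[OF dq], of "J *v axis i 1"]
      matrix_vector_nth[of "transpose J"]
    by (simp add: q'_def pd_def transpose_def matrix_vector_mult_basis column_def)
  then show ?thesis by (simp add: vec_eq_iff J_def)
qed

text \<open>The three kinds of soliton are merged into one positive scale. \<open>T\<close> is open,
  so the diffeomorphisms have two-sided time derivatives, whereas the interval \<open>I\<close> of
  the flow may contain end points.\<close>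

locale pulled_back_flow =
  fixes A :: "('m::t2_space, 'n::finite) chart set"
    and S :: "('s::t2_space, 'k::finite) chart set"
    and T I :: "real set"
    and \<sigma> :: "real \<Rightarrow> real"
    and g :: "('m, 'n) metric"
    and f :: "'m \<Rightarrow> real"
    and \<psi> :: "real \<Rightarrow> 'm \<Rightarrow> 'm"
    and gbar :: "real \<Rightarrow> ('m, 'n) metric"
    and fbar :: "real \<Rightarrow> 'm \<Rightarrow> real"
    and x :: "real \<Rightarrow> 's \<Rightarrow> 'm"
    and e :: "real \<Rightarrow> ('s, 'm, 'n) field_along"
  assumes atlasA: "smooth_atlas A" and atlasS: "smooth_atlas S"
    and card: "CARD('n) = CARD('k) + 1"
    and openT: "open T" and IT: "I \<subseteq> T" and intI: "is_interval I" "interior I \<noteq> {}"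
    and scale_pos: "\<And>t. t \<in> T \<Longrightarrow> \<sigma> t > 0"
    and metric: "riemannian_metric A g" and potential: "smooth_fun A f"
    and family: "smooth_family A A T \<psi>"
    and diffeo: "\<And>t. t \<in> T \<Longrightarrow> diffeomorphism A (\<psi> t)"
    and family_velocity: "\<And>t p c. t \<in> T \<Longrightarrow> c \<in> charts_at A (\<psi> t p) \<Longrightarrow>
       ((\<lambda>s. snd c (\<psi> s p)) has_vector_derivative (1 / \<sigma> t) *\<^sub>R gradient g f c (\<psi> t p)) (at t)"
    and gbar: "\<And>t p c. t \<in> T \<Longrightarrow> c \<in> charts_at A p \<Longrightarrow> gbar t c p = \<sigma> t *\<^sub>R pullback_metric A (\<psi> t) g c p"
    and fbar: "\<And>t p. t \<in> T \<Longrightarrow> fbar t p = f (\<psi> t p)"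
    and metric_bar: "\<And>t. t \<in> T \<Longrightarrow> riemannian_metric A (gbar t)"
    and flow: "mean_curvature_flow S A I gbar x e"
begin

definition y :: "real \<Rightarrow> 's \<Rightarrow> 'm" where "y s p = \<psi> s (x s p)"

text \<open>Measured in the fixed metric \<open>g\<close>, this density lacks the power of the scale
  present in the area for \<open>gbar\<close>, which is the power that the normalisation of
  \<open>Phi\<close> removes.\<close>

definition dens :: "('s, 'k) chart \<Rightarrow> real \<Rightarrow> real ^ 'k \<Rightarrow> real" where
  "dens b s u = exp (- f (y s (pt b u))) * sqrt (det (pullback_metric A (y s) g b (pt b u)))"

text \<open>The gradient of \<open>fbar t\<close> along the hypersurface, taken in the induced
  metric: on \<open>T\<close>, \<open>f (y t p)\<close> equals
  \<open>fbar t (x t p)\<close>.\<close>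

definition tangential :: "real \<Rightarrow> ('s, 'k) chart \<Rightarrow> real ^ 'k \<Rightarrow> real ^ 'k" where
  "tangential t b u = matrix_inv (pullback_metric A (x t) (gbar t) b (pt b u)) *v (\<chi> j. pd j (\<lambda>u. f (y t (pt b u))) u)"

definition defect :: "real \<Rightarrow> ('s, 'k) chart \<Rightarrow> ('m, 'n) chart \<Rightarrow> 's \<Rightarrow> real" where
  "defect t b c p = mean_curvature A b c (gbar t) (x t) (e t) p + dir_deriv c (fbar t) (x t p) (e t p c)"

lemma x_family: "smooth_family S A I x"
  and x_immersion: "t \<in> I \<Longrightarrow> immersion S A (x t)"
  and e_field: "smooth_field_family S A I x e"
  and e_normal: "t \<in> I \<Longrightarrow> unit_normal S A (gbar t) (x t) (e t)"
  and x_velocity: "t \<in> I \<Longrightarrow> b \<in> charts_at S p \<Longrightarrow> c \<in> charts_at A (x t p) \<Longrightarrow>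
      ((\<lambda>s. snd c (x s p)) has_vector_derivative
           mean_curvature A b c (gbar t) (x t) (e t) p *\<^sub>R e t p c) (at t within I)"
  using flow unfolding mean_curvature_flow_def by blast+

lemma IT': "t \<in> I \<Longrightarrow> t \<in> T" using IT by blast

lemma y_family: "smooth_family S A I y"
  unfolding y_def[abs_def] by (rule smooth_family_compose[OF atlasS atlasA x_family family IT])

lemma x_map: "t \<in> I \<Longrightarrow> smooth_map S A (x t)" by (rule smooth_family_slice[OF atlasS x_family])

lemma psi_map: "t \<in> T \<Longrightarrow> smooth_map A A (\<psi> t)" by (rule smooth_family_slice[OF atlasA family])

lemma psi_inv: "t \<in> T \<Longrightarrow> inv (\<psi> t) (\<psi> t p) = p" "t \<in> T \<Longrightarrow> \<psi> t (inv (\<psi> t) q) = q"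
  "t \<in> T \<Longrightarrow> smooth_map A A (inv (\<psi> t))"
  using diffeo by (auto simp: diffeomorphism_def bij_def surj_f_inv_f)

lemma induced_metric_x:
  assumes "t \<in> I" "b \<in> charts_at S p"
  shows "pullback_metric A (x t) (gbar t) b p = \<sigma> t *\<^sub>R pullback_metric A (y t) g b p"
proof -
  have "\<psi> t \<circ> x t = y t" by (simp add: fun_eq_iff y_def)
  then show ?thesis
    using pullback_metric_compose_scaled[OF atlasS atlasA atlasA x_map[OF assms(1)] psi_map metric gbar assms(2)]
      IT'[OF assms(1)] by metis
qed

text \<open>Undoing the time \<open>t\<close> diffeomorphism compares the nearby hypersurfaces with the one metric
  \<open>gbar t\<close>, in which the mean curvature at time \<open>t\<close> is given. The price is a gradient term in the
  velocity.\<close>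

lemma pulled_back_velocity:
  assumes t: "t \<in> I" and c: "c \<in> charts_at A (x t p)"
    and vel: "((\<lambda>s. snd c (x s p)) has_vector_derivative vel) (at t within I)"
  shows "((\<lambda>s. snd c (inv (\<psi> t) (y s p))) has_vector_derivative
     vel + gradient_coord (gbar t c \<circ> pt c) (fbar t \<circ> pt c) (snd c (x t p))) (at t within I)"
proof -
  note tT = IT'[OF t]
  define q where "q = x t p"
  define v0 where "v0 = snd c q"
  note cA = charts_atD[OF c, folded q_def]
  have cq: "c \<in> charts_at A q" using c by (simp add: q_def)
  note ptc = atlas_chart(5)[OF atlasA cA(1)]
  have v0: "v0 \<in> cimg c" "pt c v0 = q" using cA(2) ptc by (auto simp: v0_def)
  obtain d where d: "d \<in> charts_at A (\<psi> t q)" using charts_at_cover[OF atlasA] by blast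
  note dA = charts_atD[OF d]
  note ptd = atlas_chart(5)[OF atlasA dA(1)]
  have "\<psi> t (pt c v0) \<in> fst d" using v0(2) dA(2) by simp
  from smooth_family_extension[OF atlasA atlasA family cA(1) dA(1) tT v0(1) this]
  obtain U h where U: "open U" "(t, v0) \<in> U" "\<forall>k. Ck_on k U h" and ext: "\<forall>s v. (s, v) \<in> U \<longrightarrow> s \<in> T \<longrightarrow>
    v \<in> cimg c \<and> \<psi> s (pt c v) \<in> fst d \<and> h (s, v) = snd d (\<psi> s (pt c v)) \<and>
    ((\<lambda>v. snd d (\<psi> s (pt c v))) has_derivative (\<lambda>w. frechet_derivative h (at (s, v)) (0, w))) (at v)"
    by (elim exE conjE)
  note CU = U(3)[rule_format]
  have hU: "\<psi> s (pt c v) \<in> fst d" "h (s, v) = snd d (\<psi> s (pt c v))" if "(s, v) \<in> U" "s \<in> T" for s v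
    using ext[rule_format, OF that] by simp_all
  define Dh where "Dh = frechet_derivative h (at (t, v0))"
  have dh: "(h has_derivative Dh) (at (t, v0))"
    unfolding Dh_def by (rule Ck_on_has_derivative[OF CU U(1,2)])
  define J where "J = jacobian (snd d \<circ> \<psi> t \<circ> pt c) (at v0)"
  define L where "L = jacobian (snd c \<circ> inv (\<psi> t) \<circ> pt d) (at (snd d (\<psi> t q)))"
  have dJ: "((snd d \<circ> \<psi> t \<circ> pt c) has_derivative (*v) J) (at v0)"
    unfolding J_def v0_def by (rule smooth_map_has_derivative[OF atlasA atlasA psi_map[OF tT] cq d])
  have ci: "c \<in> charts_at A (inv (\<psi> t) (\<psi> t q))" using cq psi_inv(1)[OF tT] by simp
  have dL: "((snd c \<circ> inv (\<psi> t) \<circ> pt d) has_derivative (*v) L) (at (snd d (\<psi> t q)))"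
    unfolding L_def by (rule smooth_map_has_derivative[OF atlasA atlasA psi_inv(3)[OF tT] d ci])
  have LJ: "L ** J = mat 1"
  proof -
    have "inv (\<psi> t) \<circ> \<psi> t = id" using psi_inv(1)[OF tT] by (auto simp: fun_eq_iff)
    then have "jacobian (snd c \<circ> id \<circ> pt c) (at (snd c q)) = L ** J"
      using jacobian_chain[OF atlasA atlasA atlasA psi_map[OF tT] psi_inv(3)[OF tT] cq d ci]
      by (simp add: L_def J_def v0_def)
    \<comment> \<open>The Jacobian of the identity in a single chart squares to the identity matrix
      and, by the next step, equals its own square; hence it is the identity matrix.\<close>
    moreover have "trans_jac c c q ** trans_jac c c q = mat 1" by (rule trans_jac_inverse[OF atlasA cq cq])
    moreover have "trans_jac c c q = trans_jac c c q ** trans_jac c c q"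
      using jacobian_chain[OF atlasA atlasA atlasA smooth_map_id[OF atlasA] smooth_map_id[OF atlasA] cq, of c c] cq
      by (simp add: trans_jac_def)
    ultimately show ?thesis by (simp add: trans_jac_def)
  qed
  have space: "Dh (0, v) = J *v v" for v
  proof -
    have "((\<lambda>v. snd d (\<psi> t (pt c v))) has_derivative (\<lambda>v. Dh (0, v))) (at v0)"
      unfolding Dh_def using ext[rule_format, OF U(2) tT] by blast
    from has_derivative_unique[OF this] dJ show ?thesis by (auto simp: o_def fun_eq_iff)
  qed
  have time: "Dh (1, 0) = (1 / \<sigma> t) *\<^sub>R gradient g f d (\<psi> t q)"
  proof (rule vector_derivative_unique_at)
    have "((\<lambda>s. h (s, v0)) has_vector_derivative Dh (1, 0)) (at t)"
      unfolding Dh_def by (rule slice_time_derivative[OF CU U(1,2)])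
    moreover have "open ((\<lambda>s. (s, v0)) -` U \<inter> T)"
      using U(1) openT by (intro open_Int open_vimage continuous_intros)
    ultimately show "((\<lambda>s. snd d (\<psi> s q)) has_vector_derivative Dh (1, 0)) (at t)"
      by (rule has_vector_derivative_transform_within_open) (use U(2) tT hU(2) v0(2) in auto)
    show "((\<lambda>s. snd d (\<psi> s q)) has_vector_derivative (1 / \<sigma> t) *\<^sub>R gradient g f d (\<psi> t q)) (at t)"
      by (rule family_velocity[OF tT d])
  qed
  \<comment> \<open>Along this space-time curve the extension \<open>h\<close> of the soliton
    diffeomorphisms traces \<open>y s p\<close> in the chart \<open>d\<close>, so the chain rule
    collects the motion of the hypersurface and that of the diffeomorphisms.\<close>
  define \<gamma> where "\<gamma> s = (s, snd c (x s p))" for s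
  have d\<gamma>: "(\<gamma> has_derivative (\<lambda>r. (r, r *\<^sub>R vel))) (at t within I)"
    unfolding \<gamma>_def using vel by (auto intro!: derivative_eq_intros simp: has_vector_derivative_def)
  have \<gamma>t: "\<gamma> t = (t, v0)" by (simp add: \<gamma>_def v0_def q_def)
  have 1: "((\<lambda>s. h (\<gamma> s)) has_derivative (\<lambda>r. Dh (r, r *\<^sub>R vel))) (at t within I)"
    using has_derivative_compose[OF d\<gamma>, of h Dh] dh \<gamma>t by simp
  have ht: "h (\<gamma> t) = snd d (\<psi> t q)" using hU(2)[OF U(2) tT] v0(2) \<gamma>t by simp
  have 2: "((\<lambda>s. (snd c \<circ> inv (\<psi> t) \<circ> pt d) (h (\<gamma> s))) has_derivative (\<lambda>r. L *v Dh (r, r *\<^sub>R vel))) (at t within I)"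
    using has_derivative_compose[OF 1, of "snd c \<circ> inv (\<psi> t) \<circ> pt d" "(*v) L"] dL ht by simp
  have eq: "(snd c \<circ> inv (\<psi> t) \<circ> pt d) (h (\<gamma> s)) = snd c (inv (\<psi> t) (y s p))"
    if "\<gamma> s \<in> U" "s \<in> I" "x s p \<in> fst c" for s
    using hU[of s "snd c (x s p)"] that IT' ptc[OF that(3)] ptd by (simp add: \<gamma>_def y_def)
  have ev1: "\<forall>\<^sub>F s in at t within I. \<gamma> s \<in> U"
  proof -
    have "continuous (at t within I) \<gamma>" using d\<gamma> has_derivative_continuous by blast
    then show ?thesis using U \<gamma>t unfolding continuous_within by (metis topological_tendstoD)
  qed
  have ev2: "\<forall>\<^sub>F s in at t within I. x s p \<in> fst c"
  proof -
    have cx: "continuous_on (I \<times> UNIV) (\<lambda>(t, p). x t p)" using x_family by (simp add: smooth_family_def)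
    have "continuous_on I (\<lambda>s. (s, p))" by (intro continuous_intros)
    from continuous_on_compose2[OF cx this] have "continuous_on I (\<lambda>s. x s p)" by auto
    then have "((\<lambda>s. x s p) \<longlongrightarrow> x t p) (at t within I)" using t by (simp add: continuous_on_def)
    then show ?thesis using atlas_chart(1)[OF atlasA cA(1)] cA(2) by (metis topological_tendstoD q_def)
  qed
  have ev3: "\<forall>\<^sub>F s in at t within I. s \<in> I" by (simp add: eventually_at_filter)
  have "((\<lambda>s. snd c (inv (\<psi> t) (y s p))) has_derivative (\<lambda>r. L *v Dh (r, r *\<^sub>R vel))) (at t within I)"
  proof (rule has_derivative_transform_eventually[OF 2 _ _ t])
    show "\<forall>\<^sub>F s in at t within I. (snd c \<circ> inv (\<psi> t) \<circ> pt d) (h (\<gamma> s)) = snd c (inv (\<psi> t) (y s p))"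
      using ev1 ev2 ev3 by eventually_elim (rule eq)
    show "(snd c \<circ> inv (\<psi> t) \<circ> pt d) (h (\<gamma> t)) = snd c (inv (\<psi> t) (y t p))"
      by (rule eq) (use U(2) \<gamma>t t cA(2) in \<open>auto simp: q_def\<close>)
  qed
  \<comment> \<open>\<open>L\<close> inverts the spatial derivative \<open>J\<close>, so the
    velocity of the flow returns unchanged, and only the time derivative of the diffeomorphisms has
    to be transported back.\<close>
  moreover have "L *v Dh (r, r *\<^sub>R vel) = r *\<^sub>R (vel + L *v Dh (1, 0))" for r
  proof -
    have "Dh (r, r *\<^sub>R vel) = Dh (r *\<^sub>R (1, 0) + (0, r *\<^sub>R vel))" by simp
    also have "\<dots> = r *\<^sub>R Dh (1, 0) + J *v (r *\<^sub>R vel)"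
      by (simp only: linear_add[OF has_derivative_linear[OF dh]] linear_scale[OF has_derivative_linear[OF dh]] space)
    finally show ?thesis
      by (simp add: matrix_vector_right_distrib matrix_vector_mult_scaleR matrix_vector_mul_assoc LJ scaleR_add_right)
  qed
  \<comment> \<open>The factor \<open>1 / \<sigma> t\<close> in the generating field is the one by
    which the inverse of \<open>gbar t\<close> differs from the inverse of the pulled back metric.
    Transport by \<open>L\<close> therefore turns the scaled \<open>g\<close>-gradient of
    \<open>f\<close> into the \<open>gbar t\<close>-gradient of \<open>fbar t\<close>.\<close>
  moreover have "L *v Dh (1, 0) = gradient_coord (gbar t c \<circ> pt c) (fbar t \<circ> pt c) v0"
  proof -
    define M where "M = g d (\<psi> t q)"
    define df where "df = (\<chi> a. pd a (f \<circ> pt d) (snd d (\<psi> t q)))"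
    have "v \<bullet> (M *v v) > 0" if "v \<noteq> 0" for v
      using metric dA that unfolding riemannian_metric_def M_def by blast
    then have detM: "det M \<noteq> 0" using det_pos_of_pos_form[of M] by fastforce
    have JL: "J ** L = mat 1" using LJ matrix_left_right_inverse by blast
    have "gbar t c q = \<sigma> t *\<^sub>R (transpose J ** M ** J)"
      using gbar[OF tT cq] pullback_metric_chart[OF atlasA atlasA psi_map[OF tT] metric cq d]
      by (simp add: M_def J_def v0_def)
    moreover have "det (transpose J ** M ** J) \<noteq> 0"
    proof -
      have "det L * det J = 1" using LJ by (metis det_I det_mul)
      then have "det J \<noteq> 0" by auto
      then show ?thesis using detM by (simp add: det_mul)
    qed
    ultimately have inv: "matrix_inv (gbar t c q) = inverse (\<sigma> t) *\<^sub>R (L ** matrix_inv M ** transpose L)"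
      using scale_pos[OF tT] matrix_inv_transform[OF detM LJ] by (simp add: matrix_inv_scaleR)
    have "(\<chi> i. pd i (fbar t \<circ> pt c) v0) = transpose J *v df"
    proof -
      have "smooth_on (cimg d) (f \<circ> pt d)" using potential dA(1) by (simp add: smooth_fun_def)
      then have "Ck_on (Suc 0) (cimg d) (f \<circ> pt d)" using smooth_on_open_Ck atlas_chart(2)[OF atlasA dA(1)] by blast
      from Ck_on_has_derivative[OF this atlas_chart(2)[OF atlasA dA(1)], of "snd d (\<psi> t q)"] dA(2)
      have "(f \<circ> pt d) differentiable (at (snd d (\<psi> t q)))" using differentiableI by blast
      from chart_gradient_chain[OF atlasA atlasA psi_map[OF tT] cq d this]
      show ?thesis using fbar[OF tT] by (simp add: J_def df_def v0_def comp_def)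
    qed
    moreover have "transpose L *v (transpose J *v df) = df"
      by (metis JL matrix_transpose_mul matrix_vector_mul_assoc matrix_vector_mul_lid transpose_mat)
    ultimately have "gradient_coord (gbar t c \<circ> pt c) (fbar t \<circ> pt c) v0 = inverse (\<sigma> t) *\<^sub>R (L *v (matrix_inv M *v df))"
      unfolding gradient_coord_def comp_apply[of "gbar t c"] v0(2) inv
      by (simp add: scaleR_matrix_vector_assoc[symmetric] matrix_vector_mul_assoc[symmetric] comp_def)
    moreover have "gradient g f d (\<psi> t q) = matrix_inv M *v df"
      unfolding gradient_def gradient_coord_def by (simp add: M_def df_def ptd[OF dA(2)])
    ultimately show ?thesis
      unfolding time by (simp add: matrix_vector_mult_scaleR inverse_eq_divide)
  qed
  ultimately show ?thesis
    unfolding has_vector_derivative_def by (simp add: v0_def q_def)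
qed

lemma fbar_smooth:
  assumes "t \<in> T" "c \<in> A"
  shows "smooth_on (cimg c) (fbar t \<circ> pt c)"
proof -
  have "smooth_on {v. (t, v) \<in> T \<times> cimg c} (\<lambda>v. f (\<psi> t (pt c v)))"
    by (rule smooth_on_slice[OF smooth_family_fun[OF atlasA atlasA family potential assms(2)]])
  then show ?thesis using assms(1) fbar by (simp add: comp_def)
qed

lemma dens_smooth:
  assumes "b \<in> S"
  shows "smooth_on (I \<times> cimg b) (\<lambda>(s, u). dens b s u)"
    and "\<And>s u. s \<in> I \<Longrightarrow> u \<in> cimg b \<Longrightarrow> det (pullback_metric A (y s) g b (pt b u)) > 0"
proof -
  show pos: "det (pullback_metric A (y s) g b (pt b u)) > 0" if s: "s \<in> I" and u: "u \<in> cimg b" for s u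
  proof (rule det_pos_of_pos_form)
    fix v :: "real ^ 'k" assume "v \<noteq> 0"
    have b: "b \<in> charts_at S (pt b u)" using charts_at_pt[OF assms u] .
    have "v \<bullet> (pullback_metric A (x s) (gbar s) b (pt b u) *v v) > 0"
      by (rule pullback_metric_pos[OF atlasS atlasA x_immersion[OF s] metric_bar[OF IT'[OF s]] b \<open>v \<noteq> 0\<close>])
    then have "\<sigma> s * (v \<bullet> (pullback_metric A (y s) g b (pt b u) *v v)) > 0"
      unfolding induced_metric_x[OF s b] by (simp add: scaleR_matrix_vector_assoc[symmetric])
    then show "v \<bullet> (pullback_metric A (y s) g b (pt b u) *v v) > 0"
      using scale_pos[OF IT'[OF s]] by (simp add: zero_less_mult_iff)
  qed
  have "smooth_on (I \<times> cimg b) (\<lambda>z. f (y (fst z) (pt b (snd z))))"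
    using smooth_family_fun[OF atlasS atlasA y_family potential assms] by (simp add: case_prod_unfold)
  moreover have "smooth_on (I \<times> cimg b) (\<lambda>z. pullback_metric A (y (fst z)) g b (pt b (snd z)) $ i $ j)" for i j
    using smooth_family_pullback[OF atlasS atlasA y_family metric assms, of i j] by (simp add: case_prod_unfold)
  then have "smooth_on (I \<times> cimg b) (\<lambda>z. det (pullback_metric A (y (fst z)) g b (pt b (snd z))))"
    by (rule smooth_on_det)
  ultimately have "smooth_on (I \<times> cimg b) (\<lambda>z. exp (- f (y (fst z) (pt b (snd z)))) * sqrt (det (pullback_metric A (y (fst z)) g b (pt b (snd z)))))"
    by (intro smooth_on_mult smooth_on_exp smooth_on_minus smooth_on_sqrt) (use pos in auto)
  then show "smooth_on (I \<times> cimg b) (\<lambda>(s, u). dens b s u)"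
    by (simp add: dens_def case_prod_unfold)
qed

lemma tangential_smooth:
  assumes "t \<in> I" "b \<in> S"
  shows "smooth_on (cimg b) (\<lambda>u. tangential t b u $ m)"
    and "\<And>u. u \<in> cimg b \<Longrightarrow> det (pullback_metric A (x t) (gbar t) b (pt b u)) > 0"
proof -
  note tT = IT'[OF assms(1)]
  show pos: "det (pullback_metric A (x t) (gbar t) b (pt b u)) > 0" if u: "u \<in> cimg b" for u
    by (rule det_pos_of_pos_form, rule pullback_metric_pos[OF atlasS atlasA x_immersion[OF assms(1)] metric_bar[OF tT] charts_at_pt[OF assms(2) u]])
  have fam: "smooth_family S A {t} (\<lambda>_. x t)" by (rule smooth_family_const[OF atlasS x_map[OF assms(1)]])
  have 1: "smooth_on (cimg b) (\<lambda>u. pullback_metric A (x t) (gbar t) b (pt b u) $ i $ j)" for i j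
    using smooth_on_slice[OF smooth_family_pullback[OF atlasS atlasA fam metric_bar[OF tT] assms(2), of i j], of t] by simp
  have "open {u. (s, u) \<in> I \<times> cimg b}" for s
    using atlas_chart(2)[OF atlasS assms(2)] by (cases "s \<in> I") auto
  from smooth_on_slice[OF smooth_on_pd[OF smooth_family_fun[OF atlasS atlasA y_family potential assms(2)] this], of t] assms(1)
  have 2: "smooth_on (cimg b) (pd j (\<lambda>u. f (y t (pt b u))))" for j by simp
  show "smooth_on (cimg b) (\<lambda>u. tangential t b u $ m)"
    unfolding tangential_def
    by (rule smooth_on_matrix_inv_mult[OF 1]) (use 2 pos in \<open>auto simp: less_imp_neq[symmetric]\<close>)
qed

text \<open>This is \<open>first_variation\<close> for the pulled back family in the metric
  \<open>gbar t\<close>. Its density and \<open>dens\<close> differ by a factor that depends on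
  \<open>t\<close> but not on the varying time \<open>s\<close>, so the factor cancels.\<close>

lemma density_derivative:
  assumes t: "t \<in> I" and b: "b \<in> S" and u0: "u0 \<in> cimg b" and c: "c \<in> charts_at A (x t (pt b u0))"
  shows "((\<lambda>s. dens b s u0) has_real_derivative
     - (defect t b c (pt b u0))\<^sup>2 * dens b t u0 + (\<Sum>m\<in>UNIV. pd m (\<lambda>u. tangential t b u $ m * dens b t u) u0)) (at t within I)"
proof -
  note tT = IT'[OF t]
  note cA = charts_atD[OF c]
  \<comment> \<open>At \<open>s = t\<close> this is the original immersion, so its normal and
    curvature are those of the flow; at other times it is still measured in
    \<open>gbar t\<close>.\<close>
  define z where "z s p = inv (\<psi> t) (y s p)" for s p
  have zt: "z t p = x t p" for p by (simp add: z_def y_def psi_inv[OF tT])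
  have zy: "\<psi> t (z s p) = y s p" for s p by (simp add: z_def psi_inv[OF tT])
  have z_family: "smooth_family S A I z"
    unfolding z_def[abs_def]
    by (rule smooth_family_compose[OF atlasS atlasA y_family smooth_family_const[OF atlasA psi_inv(3)[OF tT]] subset_refl])
  have z_map: "smooth_map S A (z s)" if "s \<in> I" for s by (rule smooth_family_slice[OF atlasS z_family that])
  have psi_z: "\<psi> t \<circ> z s = y s" for s by (simp add: fun_eq_iff zy)
  have z_metric: "pullback_metric A (z s) (gbar t) b' p = \<sigma> t *\<^sub>R pullback_metric A (y s) g b' p"
    if "s \<in> I" "b' \<in> charts_at S p" for s b' p
    using pullback_metric_compose_scaled[OF atlasS atlasA atlasA z_map[OF that(1)] psi_map[OF tT] metric gbar[OF tT] that(2)]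
    unfolding psi_z .
  have "z t (pt b u0) \<in> fst c" using cA(2) by (simp add: zt)
  from smooth_family_extension[OF atlasS atlasA z_family b cA(1) t u0 this]
  obtain U h where oU: "open U" and tU: "(t, u0) \<in> U" and C: "\<forall>k. Ck_on k U h" and him: "h ` U \<subseteq> cimg c"
    and ext: "\<forall>s u. (s, u) \<in> U \<longrightarrow> s \<in> I \<longrightarrow>
      u \<in> cimg b \<and> z s (pt b u) \<in> fst c \<and> h (s, u) = snd c (z s (pt b u)) \<and>
      ((\<lambda>u. snd c (z s (pt b u))) has_derivative (\<lambda>v. frechet_derivative h (at (s, u)) (0, v))) (at u)"
    by (elim exE conjE)
  note CU = C[rule_format]
  have hU: "h (s, u) = snd c (z s (pt b u))" "z s (pt b u) \<in> fst c" "u \<in> cimg b"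
    and dhU: "((\<lambda>u. snd c (z s (pt b u))) has_derivative (\<lambda>v. frechet_derivative h (at (s, u)) (0, v))) (at u)"
    if "(s, u) \<in> U" "s \<in> I" for s u
    using ext[rule_format, OF that] by simp_all
  define N where "N = {u. (t, u) \<in> U}"
  have oN: "open N"
  proof -
    have "N = Pair t -` U" by (auto simp: N_def)
    then show ?thesis using oU by (auto intro!: open_vimage continuous_intros)
  qed
  have u0N: "u0 \<in> N" using tU by (simp add: N_def)
  have hN: "h (t, u) = snd c (x t (pt b u))" "x t (pt b u) \<in> fst c" "u \<in> cimg b" "(t, u) \<in> U" if "u \<in> N" for u
    using hU[of t u] that t by (auto simp: N_def zt)
  have ptc: "pt c (snd c q) = q" if "q \<in> fst c" for q using atlas_chart(5)[OF atlasA cA(1) that] .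
  define D where "D i w = frechet_derivative h (at w) (0, axis i 1)" for i w
  have pdz: "pd i (snd c \<circ> z s \<circ> pt b) u = D i (s, u)" if "(s, u) \<in> U" "s \<in> I" for s u i
    using frechet_derivative_at[OF dhU[OF that], symmetric] by (simp add: pd_def D_def comp_def)
  define G where "G = gbar t c \<circ> pt c"
  define \<phi> where "\<phi> = fbar t \<circ> pt c"
  have oc: "open (cimg c)" using atlas_chart(2)[OF atlasA cA(1)] .
  have CG: "Ck_on k (cimg c) G" for k
    using metric_bar[OF tT] cA(1) smooth_on_open_Ck[OF oc] unfolding G_def riemannian_metric_def by blast
  have C\<phi>: "Ck_on k (cimg c) \<phi>" for k
    unfolding \<phi>_def by (rule smooth_on_open_Ck[OF oc fbar_smooth[OF tT cA(1)]])
  have Gsym: "transpose (G v) = G v" "\<And>w. w \<noteq> 0 \<Longrightarrow> w \<bullet> (G v *v w) > 0" if "v \<in> cimg c" for v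
    using metric_bar[OF tT] cA(1) cimg_pt(1)[OF that] unfolding G_def riemannian_metric_def comp_apply by blast+
  define K where "K w = (\<chi> i j. D i w \<bullet> (G (h w) *v D j w))" for w
  have Kz: "K (s, u) = pullback_metric A (z s) (gbar t) b (pt b u)" if "(s, u) \<in> U" "s \<in> I" for s u
  proof -
    note bs = charts_at_pt[OF b hU(3)[OF that]]
    have "pullback_metric A (z s) (gbar t) b (pt b u) $ i $ j = K (s, u) $ i $ j" for i j
      using pullback_metric_entry[OF atlasS atlasA z_map[OF that(2)] metric_bar[OF tT] bs charts_atI[OF cA(1) hU(2)[OF that]], of i j]
      by (simp add: K_def cimg_pt(2)[OF hU(3)[OF that]] pdz[OF that] hU(1)[OF that] G_def ptc[OF hU(2)[OF that]])
    then show ?thesis by (simp add: vec_eq_iff)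
  qed
  have zxt: "z t = x t" by (simp add: fun_eq_iff zt)
  have Kx: "K (t, u) = pullback_metric A (x t) (gbar t) b (pt b u)" if "u \<in> N" for u
    using Kz[of t u] hN(4)[OF that] t by (simp add: zxt)
  have pdx: "pd i (snd c \<circ> x t \<circ> pt b) u = D i (t, u)" if "u \<in> N" for u i
    using pdz[of t u i] hN(4)[OF that] t by (simp add: zxt)
  define E where "E u = e t (pt b u) c" for u
  have dE: "E differentiable (at u0)"
  proof -
    let ?M = "chart_domain I x b c"
    have "smooth_on ?M (\<lambda>(t, u). e t (pt b u) c)"
      using e_field b cA(1) by (simp add: smooth_field_family_def)
    from smooth_on_slice[OF this, of t] have "smooth_on {u. (t, u) \<in> ?M} E" by (simp add: E_def[abs_def])
    moreover have oM: "open {u. (t, u) \<in> ?M}" by (rule smooth_family_slice_open[OF atlasS atlasA x_family b cA(1)])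
    ultimately have "Ck_on (Suc 0) {u. (t, u) \<in> ?M} E" using smooth_on_open_Ck by blast
    from Ck_on_has_derivative[OF this oM, of u0] show ?thesis
      using t u0 cA(2) differentiableI by auto
  qed
  have normal: "E u \<bullet> (G (h (t, u)) *v E u) = 1" "D i (t, u) \<bullet> (G (h (t, u)) *v E u) = 0" if "u \<in> N" for u i
  proof -
    note bs = charts_at_pt[OF b hN(3)[OF that]]
    note cs = charts_atI[OF cA(1) hN(2)[OF that]]
    from e_normal[OF t] bs cs
    have *: "e t (pt b u) c \<bullet> (gbar t c (x t (pt b u)) *v e t (pt b u) c) = 1"
      "pd i (snd c \<circ> x t \<circ> pt b) (snd b (pt b u)) \<bullet> (gbar t c (x t (pt b u)) *v e t (pt b u) c) = 0"
      unfolding unit_normal_def by blast+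
    have Gh: "G (h (t, u)) = gbar t c (x t (pt b u))" by (simp add: G_def hN(1)[OF that] ptc[OF hN(2)[OF that]])
    show "E u \<bullet> (G (h (t, u)) *v E u) = 1" "D i (t, u) \<bullet> (G (h (t, u)) *v E u) = 0"
      using * unfolding Gh E_def cimg_pt(2)[OF hN(3)[OF that]] pdx[OF that] by auto
  qed
  define \<eta> where "\<eta> u = mean_curvature A b c (gbar t) (x t) (e t) (pt b u)" for u
  \<comment> \<open>The two-sided time derivative of the extension is identified from one-sided
    data: \<open>h\<close> is differentiable at time \<open>t\<close>, and the derivative within
    \<open>I\<close> is unique.\<close>
  have velocity: "frechet_derivative h (at (t, u)) (1, 0) = \<eta> u *\<^sub>R E u + gradient_coord G \<phi> (h (t, u))" if "u \<in> N" for u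
  proof (rule vector_derivative_unique_within)
    note bs = charts_at_pt[OF b hN(3)[OF that]]
    note cs = charts_atI[OF cA(1) hN(2)[OF that]]
    show "at t within I \<noteq> bot" by (rule interval_at_within_nontrivial[OF intI t])
    show "((\<lambda>s. snd c (z s (pt b u))) has_vector_derivative \<eta> u *\<^sub>R E u + gradient_coord G \<phi> (h (t, u))) (at t within I)"
      using pulled_back_velocity[OF t cs x_velocity[OF t bs cs]]
      unfolding \<eta>_def E_def G_def \<phi>_def hN(1)[OF that] z_def .
    have "((\<lambda>s. h (s, u)) has_vector_derivative frechet_derivative h (at (t, u)) (1, 0)) (at t within I)"
      by (rule slice_time_derivative[OF CU[of "Suc 0"] oU hN(4)[OF that]])
    then show "((\<lambda>s. snd c (z s (pt b u))) has_vector_derivative frechet_derivative h (at (t, u)) (1, 0)) (at t within I)"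
      unfolding has_vector_derivative_def
    proof (rule has_derivative_transform_eventually[OF _ _ _ t])
      have "open ((\<lambda>s. (s, u)) -` U)" using oU by (intro open_vimage continuous_intros)
      then show "\<forall>\<^sub>F s in at t within I. h (s, u) = snd c (z s (pt b u))"
        unfolding eventually_at_topological using hU(1) hN(4)[OF that] by (intro exI[of _ "(\<lambda>s. (s, u)) -` U"]) auto
      show "h (t, u) = snd c (z t (pt b u))" using hU(1)[OF hN(4)[OF that] t] .
    qed
  qed
  have Kpos: "det (K (t, u)) > 0" if "u \<in> N" for u
    unfolding Kx[OF that] by (rule tangential_smooth(2)[OF t b hN(3)[OF that]])
  have pt0: "snd b (pt b u0) = u0" using cimg_pt(2)[OF u0] .
  have second: "second_ff b c (gbar t) (x t) (e t) i j (pt b u0) =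
    (\<chi> a. pd i (pd j (\<lambda>u. h (t, u))) u0 $ a + (\<Sum>k\<in>UNIV. \<Sum>l\<in>UNIV. christoffel G a k l (h (t, u0)) *
        pd i (\<lambda>u. h (t, u)) u0 $ k * pd j (\<lambda>u. h (t, u)) u0 $ l)) \<bullet> (G (h (t, u0)) *v E u0)" for i j
  proof -
    have pdh: "pd j (\<lambda>u. h (t, u)) u = pd j (snd c \<circ> x t \<circ> pt b) u" if "u \<in> N" for u j
      unfolding pd_def by (subst frechet_derivative_cong_open[OF oN that, of "\<lambda>u. h (t, u)" "snd c \<circ> x t \<circ> pt b"]) (simp_all add: hN(1))
    have pdpd: "pd i (pd j (\<lambda>u. h (t, u))) u0 = pd i (pd j (snd c \<circ> x t \<circ> pt b)) u0"
      unfolding pd_def[of i] by (simp only: frechet_derivative_cong_open[OF oN u0N, of "pd j (\<lambda>u. h (t, u))" "pd j (snd c \<circ> x t \<circ> pt b)", OF pdh])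
    have Gx: "G (h (t, u0)) = gbar t c (x t (pt b u0))" by (simp add: G_def hN(1)[OF u0N] ptc[OF hN(2)[OF u0N]])
    have Xu: "(snd c \<circ> x t \<circ> pt b) u0 = h (t, u0)" by (simp add: hN(1)[OF u0N])
    show ?thesis
      unfolding second_ff_def cov_deriv_def Let_def pt0 pdpd pdh[OF u0N] Gx E_def G_def[symmetric] Xu ..
  qed
  have \<eta>0: "\<eta> u0 = (\<Sum>i\<in>UNIV. \<Sum>j\<in>UNIV. matrix_inv (K (t, u0)) $ i $ j *
     ((\<chi> a. pd i (pd j (\<lambda>u. h (t, u))) u0 $ a + (\<Sum>k\<in>UNIV. \<Sum>l\<in>UNIV. christoffel G a k l (h (t, u0)) *
        pd i (\<lambda>u. h (t, u)) u0 $ k * pd j (\<lambda>u. h (t, u)) u0 $ l)) \<bullet> (G (h (t, u0)) *v E u0)))"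
    unfolding \<eta>_def mean_curvature_def second Kx[OF u0N] ..
  define F where "F w = exp (- \<phi> (h w)) * sqrt (det (K w))" for w
  define W where "W u = matrix_inv (K (t, u)) *v (\<chi> j. frechet_derivative \<phi> (at (h (t, u))) (D j (t, u)))" for u
  have Kdef: "K w = (\<chi> i j. frechet_derivative h (at w) (0, axis i 1) \<bullet> (G (h w) *v frechet_derivative h (at w) (0, axis j 1)))" for w
    by (simp add: K_def D_def)
  have fv: "((\<lambda>s. F (s, u0)) has_real_derivative
     - (\<eta> u0 + frechet_derivative \<phi> (at (h (t, u0))) (E u0))\<^sup>2 * F (t, u0) + (\<Sum>m\<in>UNIV. pd m (\<lambda>u. W u $ m * F (t, u)) u0)) (at t)"
    using first_variation[OF oU CU oc him CG C\<phi> Gsym oN u0N hN(4) Kdef Kpos dE normal[unfolded D_def] velocity \<eta>0 card]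
    unfolding F_def W_def D_def .
  have defect0: "\<eta> u0 + frechet_derivative \<phi> (at (h (t, u0))) (E u0) = defect t b c (pt b u0)"
    by (simp add: defect_def dir_deriv_def \<eta>_def \<phi>_def E_def hN(1)[OF u0N])
  \<comment> \<open>Scaling a metric by \<open>\<sigma> t\<close> multiplies the determinant in
    dimension \<open>CARD('k)\<close> by the corresponding power, and the area density by its square
    root.\<close>
  define C where "C = sqrt (\<sigma> t ^ CARD('k))"
  have C: "C > 0" using scale_pos[OF tT] by (simp add: C_def)
  have \<phi>h: "\<phi> (h (s, u)) = f (y s (pt b u))" if "(s, u) \<in> U" "s \<in> I" for s u
    using hU(1,2)[OF that] by (simp add: \<phi>_def ptc fbar[OF tT] zy)
  have FC: "F (s, u) = C * dens b s u" if "(s, u) \<in> U" "s \<in> I" for s u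
    unfolding F_def \<phi>h[OF that] Kz[OF that] z_metric[OF that(2) charts_at_pt[OF b hU(3)[OF that]]] det_scaleR
    by (simp add: C_def dens_def real_sqrt_mult)
  have Wt: "W u = tangential t b u" if u: "u \<in> N" for u
  proof -
    have "frechet_derivative \<phi> (at (h (t, u))) (D j (t, u)) = pd j (\<lambda>u. f (y t (pt b u))) u" for j
    proof -
      have hc: "h (t, u) \<in> cimg c" using him hN(4)[OF u] by blast
      have "((\<lambda>u. \<phi> (h (t, u))) has_derivative (\<lambda>v. frechet_derivative \<phi> (at (h (t, u))) (frechet_derivative h (at (t, u)) (0, v)))) (at u)"
        by (rule has_derivative_compose[OF slice_space_derivative[OF CU[of "Suc 0"] oU hN(4)[OF u]] Ck_on_has_derivative[OF C\<phi>[of "Suc 0"] oc hc]])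
      then have "((\<lambda>u. f (y t (pt b u))) has_derivative (\<lambda>v. frechet_derivative \<phi> (at (h (t, u))) (frechet_derivative h (at (t, u)) (0, v)))) (at u)"
        by (rule has_derivative_transform_within_open[OF _ oN u]) (use \<phi>h hN(4) t in auto)
      from frechet_derivative_at[OF this, symmetric] show ?thesis by (simp add: pd_def D_def)
    qed
    then show ?thesis by (simp add: W_def tangential_def Kx[OF u])
  qed
  have pdWF: "pd m (\<lambda>u. W u $ m * F (t, u)) u0 = C * pd m (\<lambda>u. tangential t b u $ m * dens b t u) u0" for m
  proof -
    let ?q = "\<lambda>u. tangential t b u $ m * dens b t u"
    have ob: "open (cimg b)" using atlas_chart(2)[OF atlasS b] .
    have "smooth_on (cimg b) (dens b t)"
      using smooth_on_slice[OF dens_smooth(1)[OF b], of t] t by simp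
    then have "smooth_on (cimg b) ?q" by (intro smooth_on_mult tangential_smooth(1)[OF t b])
    from Ck_on_has_derivative[OF smooth_on_open_Ck[OF ob this, of "Suc 0"] ob u0]
    have q: "(?q has_derivative frechet_derivative ?q (at u0)) (at u0)" .
    have "((\<lambda>u. W u $ m * F (t, u)) has_derivative (\<lambda>v. C * frechet_derivative ?q (at u0) v)) (at u0)"
      by (rule has_derivative_transform_within_open[OF has_derivative_mult_right[OF q] oN u0N])
         (use Wt FC hN(4) t in auto)
    from frechet_derivative_at[OF this, symmetric] show ?thesis by (simp add: pd_def)
  qed
  \<comment> \<open>\<open>F\<close> is \<open>C\<close> times the density only for times in
    \<open>I\<close>; here the two-sided derivative is therefore weakened to one within
    \<open>I\<close>.\<close>
  have "((\<lambda>s. C * dens b s u0) has_derivative (*) (- (defect t b c (pt b u0))\<^sup>2 * (C * dens b t u0)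
     + (\<Sum>m\<in>UNIV. C * pd m (\<lambda>u. tangential t b u $ m * dens b t u) u0))) (at t within I)"
  proof (rule has_derivative_transform_eventually[OF _ _ _ t])
    show "((\<lambda>s. F (s, u0)) has_derivative (*) (- (defect t b c (pt b u0))\<^sup>2 * (C * dens b t u0)
     + (\<Sum>m\<in>UNIV. C * pd m (\<lambda>u. tangential t b u $ m * dens b t u) u0))) (at t within I)"
      using has_derivative_at_withinI[OF fv[unfolded has_field_derivative_def]]
      unfolding defect0 pdWF FC[OF tU t] .
    have "open ((\<lambda>s. (s, u0)) -` U)" using oU by (intro open_vimage continuous_intros)
    then show "\<forall>\<^sub>F s in at t within I. F (s, u0) = C * dens b s u0"
      unfolding eventually_at_topological using FC tU by (intro exI[of _ "(\<lambda>s. (s, u0)) -` U"]) auto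
    show "F (t, u0) = C * dens b t u0" using FC[OF tU t] .
  qed
  then have "((\<lambda>s. C * dens b s u0) has_real_derivative C * (- (defect t b c (pt b u0))\<^sup>2 * dens b t u0
     + (\<Sum>m\<in>UNIV. pd m (\<lambda>u. tangential t b u $ m * dens b t u) u0))) (at t within I)"
    by (simp add: has_field_derivative_def sum_distrib_left[symmetric] right_diff_distrib mult_ac)
  note DERIV_cmult[OF this, of "inverse C"]
  moreover have "inverse C * (C * r) = r" for r using C by simp
  ultimately show ?thesis by (simp only:)
qed

end


section \<open>Derivative of the weighted area\<close>

text \<open>The partition of unity lives on the parameter manifold and does not depend on time, so
  it passes unchanged through time derivatives. Having it as a parameter makes it available to
  definitions.\<close>

locale closed_pulled_back_flow = pulled_back_flow A S T I \<sigma> g f \<psi> gbar fbar x e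
  for A :: "('m::t2_space, 'n::finite) chart set"
    and S :: "('s::t2_space, 'k::finite) chart set"
    and T I :: "real set" and \<sigma> g f \<psi> gbar fbar x e +
  fixes dA :: "real \<Rightarrow> 's measure"
    and J :: "'s set" and b :: "'s \<Rightarrow> ('s, 'k) chart" and lo hi :: "'s \<Rightarrow> real ^ 'k"
    and \<zeta> :: "'s \<Rightarrow> 's \<Rightarrow> real"
  assumes measure: "\<And>t. t \<in> I \<Longrightarrow> riemannian_measure S (pullback_metric A (x t) (gbar t)) (dA t)"
    and finJ: "finite J" and bS: "\<And>i. i \<in> J \<Longrightarrow> b i \<in> S"
    and box: "\<And>i. i \<in> J \<Longrightarrow> cbox (lo i) (hi i) \<subseteq> cimg (b i)"
    and nonneg: "\<And>i p. \<zeta> i p \<ge> 0"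
    and supp: "\<And>i p. i \<in> J \<Longrightarrow> \<zeta> i p \<noteq> 0 \<Longrightarrow> p \<in> fst (b i) \<and> snd (b i) p \<in> cbox (lo i) (hi i)"
    and \<zeta>C1: "\<And>i c. i \<in> J \<Longrightarrow> c \<in> S \<Longrightarrow> Ck_on 1 (cimg c) (\<lambda>u. \<zeta> i (pt c u))"
    and partition: "\<And>p. (\<Sum>i\<in>J. \<zeta> i p) = 1"
    and box_nonempty: "\<And>i. i \<in> J \<Longrightarrow> box (lo i) (hi i) \<noteq> {}"
begin

section \<open>The weighted area as a sum of integrals over coordinate boxes\<close>

lemma dens_continuous: "t \<in> I \<Longrightarrow> c \<in> S \<Longrightarrow> continuous_on (cimg c) (dens c t)"
  using smooth_on_slice[OF dens_smooth(1), of c t] smooth_on_continuous_on[of "cimg c"] by simp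

text \<open>Stated for an arbitrary \<open>\<xi>\<close> because it is needed twice: for the
  partition functions themselves and for the pairings of their differentials with the tangential
  field.\<close>

lemma chart_integral:
  assumes t: "t \<in> I" and i: "i \<in> J"
    and \<xi>: "continuous_on (cimg (b i)) (\<lambda>u. \<xi> (pt (b i) u))"
      "\<And>p. \<xi> p \<noteq> 0 \<Longrightarrow> p \<in> fst (b i) \<and> snd (b i) p \<in> cbox (lo i) (hi i)"
  shows "integrable (dA t) (\<lambda>p. \<xi> p * exp (- fbar t (x t p)))"
    and "(LINT p|dA t. \<xi> p * exp (- fbar t (x t p))) =
      sqrt (\<sigma> t ^ CARD('k)) * integral (cbox (lo i) (hi i)) (\<lambda>u. \<xi> (pt (b i) u) * dens (b i) t u)"
proof -
  note tT = IT'[OF t]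
  have fy: "fbar t (x t p) = f (y t p)" for p by (simp add: fbar[OF tT] y_def)
  have ex: "sqrt (det (pullback_metric A (x t) (gbar t) (b i) (pt (b i) u))) =
    sqrt (\<sigma> t ^ CARD('k)) * (dens (b i) t u * exp (f (y t (pt (b i) u))))" if "u \<in> cimg (b i)" for u
    unfolding induced_metric_x[OF t charts_at_pt[OF bS[OF i] that]] det_scaleR
    by (simp add: dens_def real_sqrt_mult exp_minus field_simps)
  have "smooth_on (cimg (b i)) (\<lambda>u. f (y t (pt (b i) u)))"
    using smooth_on_slice[OF smooth_family_fun[OF atlasS atlasA y_family potential bS[OF i]], of t] t by simp
  then have cf: "continuous_on (cimg (b i)) (\<lambda>u. f (y t (pt (b i) u)))" by (rule smooth_on_continuous_on)
  have cd: "continuous_on (cimg (b i)) (\<lambda>u. sqrt (det (pullback_metric A (x t) (gbar t) (b i) (pt (b i) u))))"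
    using dens_continuous[OF t bS[OF i]] cf
    by (subst continuous_on_cong[OF refl ex]) (auto intro!: continuous_intros)
  have c\<xi>: "continuous_on (cimg (b i)) (\<lambda>u. \<xi> (pt (b i) u) * exp (- fbar t (x t (pt (b i) u))))"
    unfolding fy by (intro continuous_intros \<xi>(1) cf)
  note ri = riemannian_integral_chart[OF atlasS bS[OF i] measure[OF t] cd _ c\<xi> _ box[OF i]]
  show "integrable (dA t) (\<lambda>p. \<xi> p * exp (- fbar t (x t p)))"
    by (rule ri(1)) (use tangential_smooth(2)[OF t bS[OF i]] \<xi>(2) in \<open>auto intro: less_imp_le\<close>)
  have "(LINT p|dA t. \<xi> p * exp (- fbar t (x t p))) = integral (cbox (lo i) (hi i))
     (\<lambda>u. \<xi> (pt (b i) u) * exp (- fbar t (x t (pt (b i) u))) * sqrt (det (pullback_metric A (x t) (gbar t) (b i) (pt (b i) u))))"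
    by (rule ri(2)) (use tangential_smooth(2)[OF t bS[OF i]] \<xi>(2) in \<open>auto intro: less_imp_le\<close>)
  also have "\<dots> = integral (cbox (lo i) (hi i)) (\<lambda>u. sqrt (\<sigma> t ^ CARD('k)) * (\<xi> (pt (b i) u) * dens (b i) t u))"
  proof (rule integral_cong)
    fix u assume "u \<in> cbox (lo i) (hi i)"
    then have "u \<in> cimg (b i)" using box[OF i] by blast
    from ex[OF this] show "\<xi> (pt (b i) u) * exp (- fbar t (x t (pt (b i) u))) * sqrt (det (pullback_metric A (x t) (gbar t) (b i) (pt (b i) u)))
      = sqrt (\<sigma> t ^ CARD('k)) * (\<xi> (pt (b i) u) * dens (b i) t u)"
      by (simp add: fy exp_minus field_simps)
  qed
  finally show "(LINT p|dA t. \<xi> p * exp (- fbar t (x t p))) =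
      sqrt (\<sigma> t ^ CARD('k)) * integral (cbox (lo i) (hi i)) (\<lambda>u. \<xi> (pt (b i) u) * dens (b i) t u)"
    by simp
qed

text \<open>The weighted area of \<open>y t\<close> in the fixed metric, written without the
  measures \<open>dA\<close>, so that time enters through the smooth densities alone.\<close>

definition mass :: "real \<Rightarrow> real" where
  "mass t = (\<Sum>i\<in>J. integral (cbox (lo i) (hi i)) (\<lambda>u. \<zeta> i (pt (b i) u) * dens (b i) t u))"

lemma \<zeta>_continuous: "i \<in> J \<Longrightarrow> c \<in> S \<Longrightarrow> continuous_on (cimg c) (\<lambda>u. \<zeta> i (pt c u))"
  using Ck_on_imp_continuous_on[OF \<zeta>C1] .

lemma weighted_area_eq:
  assumes t: "t \<in> I"
  shows "weighted_area (dA t) (fbar t) (x t) = sqrt (\<sigma> t ^ CARD('k)) * mass t"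
proof -
  have "weighted_area (dA t) (fbar t) (x t) = (LINT p|dA t. (\<Sum>i\<in>J. \<zeta> i p * exp (- fbar t (x t p))))"
    unfolding weighted_area_def sum_distrib_right[symmetric] partition by simp
  also have "\<dots> = (\<Sum>i\<in>J. LINT p|dA t. \<zeta> i p * exp (- fbar t (x t p)))"
    by (rule Bochner_Integration.integral_sum) (rule chart_integral(1)[OF t _ \<zeta>_continuous], use supp bS in auto)
  also have "\<dots> = sqrt (\<sigma> t ^ CARD('k)) * mass t"
    unfolding mass_def sum_distrib_left
    by (intro sum.cong refl chart_integral(2)[OF t _ \<zeta>_continuous]) (use supp bS in auto)
  finally show ?thesis .
qed

section \<open>Integration by parts and the divergence theorem\<close>

definition pairing :: "real \<Rightarrow> ('s, 'k) chart \<Rightarrow> ('s \<Rightarrow> real) \<Rightarrow> 's \<Rightarrow> real" where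
  "pairing t c q p = (\<chi> j. pd j (q \<circ> pt c) (snd c p)) \<bullet> tangential t c (snd c p)"

lemma \<zeta>_differentiable:
  assumes "i \<in> J" "c \<in> charts_at S p"
  shows "(\<zeta> i \<circ> pt c) differentiable (at (snd c p))"
proof -
  note c = charts_atD[OF assms(2)]
  have "Ck_on (Suc 0) (cimg c) (\<lambda>u. \<zeta> i (pt c u))" using \<zeta>C1[OF assms(1) c(1)] by simp
  from Ck_on_has_derivative[OF this atlas_chart(2)[OF atlasS c(1)], of "snd c p"] c(2)
  show ?thesis using differentiableI by (auto simp: comp_def)
qed

text \<open>The differential of \<open>q\<close> transforms by the transposed Jacobian and the
  vector \<open>tangential\<close> by the inverse one, so the two changes cancel.\<close>

lemma pairing_chart_independent:
  assumes t: "t \<in> I" and c: "c \<in> charts_at S p" "c' \<in> charts_at S p"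
    and q: "(q \<circ> pt c') differentiable (at (snd c' p))"
  shows "pairing t c q p = pairing t c' q p"
proof -
  define M where "M = trans_jac c c' p"
  define N where "N = trans_jac c' c p"
  have NM: "N ** M = mat 1" unfolding M_def N_def by (rule trans_jac_inverse[OF atlasS c])
  then have MN: "M ** N = mat 1" using matrix_left_right_inverse by blast
  have grad: "(\<chi> i. pd i (r \<circ> pt c) (snd c p)) = transpose M *v (\<chi> i. pd i (r \<circ> pt c') (snd c' p))"
    if "(r \<circ> pt c') differentiable (at (snd c' p))" for r :: "'s \<Rightarrow> real"
    using chart_gradient_chain[OF atlasS atlasS smooth_map_id[OF atlasS] c(1), of c' r] c(2) that
    by (simp add: M_def trans_jac_def)
  note cS = charts_atD[OF c(1)] charts_atD[OF c(2)]
  note ptc = atlas_chart(5)[OF atlasS cS(1,2)] atlas_chart(5)[OF atlasS cS(3,4)]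
  have df: "((\<lambda>p. f (y t p)) \<circ> pt c') differentiable (at (snd c' p))"
  proof -
    have "smooth_on (cimg c') (\<lambda>u. f (y t (pt c' u)))"
      using smooth_on_slice[OF smooth_family_fun[OF atlasS atlasA y_family potential cS(3)], of t] t by simp
    then have "Ck_on (Suc 0) (cimg c') (\<lambda>u. f (y t (pt c' u)))"
      by (rule smooth_on_open_Ck[OF atlas_chart(2)[OF atlasS cS(3)]])
    from Ck_on_has_derivative[OF this atlas_chart(2)[OF atlasS cS(3)], of "snd c' p"] cS(4)
    show ?thesis using differentiableI by (auto simp: comp_def)
  qed
  define H where "H = pullback_metric A (x t) (gbar t) c' p"
  define v where "v = (\<chi> i. pd i ((\<lambda>p. f (y t p)) \<circ> pt c') (snd c' p))"
  define w where "w = (\<chi> i. pd i (q \<circ> pt c') (snd c' p))"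
  have H: "pullback_metric A (x t) (gbar t) c p = transpose M ** H ** M"
    unfolding H_def M_def by (rule pullback_metric_source[OF atlasS atlasA x_map[OF t] metric_bar[OF IT'[OF t]] c])
  have detH: "det H \<noteq> 0"
    using tangential_smooth(2)[OF t cS(3), of "snd c' p"] cS(4) ptc by (simp add: H_def)
  have inv: "matrix_inv (transpose M ** H ** M) = N ** matrix_inv H ** transpose N"
    by (rule matrix_inv_transform[OF detH NM])
  have tan': "tangential t c' (snd c' p) = matrix_inv H *v v"
    by (simp add: tangential_def H_def v_def ptc comp_def)
  have "transpose N *v (transpose M *v v) = v"
    by (metis MN matrix_transpose_mul matrix_vector_mul_assoc matrix_vector_mul_lid transpose_mat)
  moreover have "tangential t c (snd c p) = matrix_inv (transpose M ** H ** M) *v (transpose M *v v)"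
    using grad[OF df] by (simp add: tangential_def H v_def ptc comp_def)
  ultimately have tan: "tangential t c (snd c p) = N *v (matrix_inv H *v v)"
    unfolding inv by (simp only: matrix_vector_mul_assoc[symmetric])
  have "pairing t c q p = (transpose M *v w) \<bullet> (N *v (matrix_inv H *v v))"
    unfolding pairing_def tan grad[OF q] w_def ..
  also have "\<dots> = (M *v (N *v (matrix_inv H *v v))) \<bullet> w"
    by (subst inner_commute) (rule inner_transpose_mult)
  also have "\<dots> = w \<bullet> (matrix_inv H *v v)"
    by (simp add: matrix_vector_mul_assoc[of M] MN inner_commute)
  finally show ?thesis unfolding pairing_def tan' w_def .
qed

text \<open>The differentials of the partition functions add up to the differential of the constant
  1.\<close>

lemma pairing_partition:
  assumes "c \<in> charts_at S p"
  shows "(\<Sum>i\<in>J. pairing t c (\<zeta> i) p) = 0"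
proof -
  have "((\<lambda>u. \<Sum>i\<in>J. (\<zeta> i \<circ> pt c) u) has_derivative (\<lambda>v. \<Sum>i\<in>J. frechet_derivative (\<zeta> i \<circ> pt c) (at (snd c p)) v)) (at (snd c p))"
    by (rule has_derivative_sum) (rule frechet_derivative_works[THEN iffD1, OF \<zeta>_differentiable[OF _ assms]])
  moreover have "(\<lambda>u. \<Sum>i\<in>J. (\<zeta> i \<circ> pt c) u) = (\<lambda>u. 1)" by (simp add: fun_eq_iff partition)
  ultimately have "((\<lambda>u. 1 :: real) has_derivative (\<lambda>v. \<Sum>i\<in>J. frechet_derivative (\<zeta> i \<circ> pt c) (at (snd c p)) v)) (at (snd c p))"
    by (simp only:)
  from has_derivative_unique[OF this has_derivative_const]
  have "(\<lambda>v. \<Sum>i\<in>J. frechet_derivative (\<zeta> i \<circ> pt c) (at (snd c p)) v) = (\<lambda>v. 0)" .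
  then have "(\<Sum>i\<in>J. pd j (\<zeta> i \<circ> pt c) (snd c p)) = 0" for j by (auto simp: pd_def fun_eq_iff)
  then have "(\<Sum>i\<in>J. (\<chi> j. pd j (\<zeta> i \<circ> pt c) (snd c p))) = 0" by (simp add: vec_eq_iff)
  then show ?thesis unfolding pairing_def inner_sum_left[symmetric] by simp
qed

text \<open>The coordinate form of a weighted divergence: the Riemannian volume factor and the
  weight are both contained in \<open>dens\<close>.\<close>

definition divergence :: "real \<Rightarrow> ('s, 'k) chart \<Rightarrow> real ^ 'k \<Rightarrow> real" where
  "divergence t c u = (\<Sum>m\<in>UNIV. pd m (\<lambda>u. tangential t c u $ m * dens c t u) u)"

lemma flux_smooth:
  assumes "t \<in> I" "c \<in> S"
  shows "smooth_on (cimg c) (\<lambda>u. tangential t c u $ m * dens c t u)"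
  using smooth_on_slice[OF dens_smooth(1)[OF assms(2)], of t] assms(1)
  by (intro smooth_on_mult tangential_smooth(1)[OF assms]) simp

lemma continuous_on_pd:
  assumes "Ck_on 1 U h"
  shows "continuous_on U (pd m h)"
  using assms unfolding One_nat_def pd_def[abs_def] by simp

lemma divergence_continuous:
  assumes "t \<in> I" "c \<in> S"
  shows "continuous_on (cimg c) (divergence t c)"
  unfolding divergence_def[abs_def]
  by (intro continuous_on_sum continuous_on_pd smooth_on_open_Ck flux_smooth[OF assms] atlas_chart(2)[OF atlasS assms(2)])

lemma pairing_chart: "u \<in> cimg c \<Longrightarrow> pairing t c q (pt c u) = (\<Sum>m\<in>UNIV. pd m (\<lambda>u. q (pt c u)) u * tangential t c u $ m)"
  by (simp add: pairing_def cimg_pt(2) inner_vec_def comp_def del: image_iff)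

lemma pairing_continuous:
  assumes "t \<in> I" "i \<in> J" "c \<in> S"
  shows "continuous_on (cimg c) (\<lambda>u. pairing t c (\<zeta> i) (pt c u))"
proof -
  have "continuous_on (cimg c) (\<lambda>u. \<Sum>m\<in>UNIV. pd m (\<lambda>u. \<zeta> i (pt c u)) u * tangential t c u $ m)"
    by (intro continuous_on_sum continuous_on_mult continuous_on_pd \<zeta>C1[OF assms(2,3)]
        smooth_on_continuous_on[OF tangential_smooth(1)[OF assms(1,3)]])
  then show ?thesis by (rule continuous_on_eq) (simp add: pairing_chart)
qed

lemma integral_by_parts:
  assumes t: "t \<in> I" and i: "i \<in> J"
  shows "integral (cbox (lo i) (hi i)) (\<lambda>u. \<zeta> i (pt (b i) u) * divergence t (b i) u)
    = - integral (cbox (lo i) (hi i)) (\<lambda>u. pairing t (b i) (\<zeta> i) (pt (b i) u) * dens (b i) t u)"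
proof -
  define B where "B = cbox (lo i) (hi i)"
  define \<Omega> where "\<Omega> = cimg (b i)"
  have o: "open \<Omega>" unfolding \<Omega>_def by (rule atlas_chart(2)[OF atlasS bS[OF i]])
  have B\<Omega>: "B \<subseteq> \<Omega>" unfolding B_def \<Omega>_def by (rule box[OF i])
  define z where "z u = \<zeta> i (pt (b i) u)" for u
  define q where "q m u = tangential t (b i) u $ m * dens (b i) t u" for m u
  have Cz: "Ck_on 1 \<Omega> z" unfolding \<Omega>_def z_def[abs_def] by (rule \<zeta>C1[OF i bS[OF i]])
  have Cq: "Ck_on 1 \<Omega> (q m)" for m
    unfolding \<Omega>_def q_def[abs_def] by (rule smooth_on_open_Ck[OF o[unfolded \<Omega>_def] flux_smooth[OF t bS[OF i]]])
  have z0: "z u = 0" if "u \<in> \<Omega>" "u \<notin> B" for u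
    using supp[OF i, of "pt (b i) u"] that cimg_pt(2)[of u "b i"] unfolding z_def B_def \<Omega>_def by auto
  \<comment> \<open>Cut off by the partition function and extended by zero, the flux component is of
    class C1 on the whole space and supported in the box, so the integral of its partial derivative
    is zero.\<close>
  define P where "P m u = (if u \<in> \<Omega> then z u * q m u else 0)" for m u
  have CP: "Ck_on 1 UNIV (P m)" for m
    unfolding P_def[abs_def]
    by (rule Ck_on_extend_zero[OF o _ B\<Omega> Ck_on_mult[OF o Cz Cq]]) (auto simp: z0 B_def[THEN arg_cong[where f = closed]] closed_cbox)
  have P0: "integral B (pd m (P m)) = 0" for m
    unfolding B_def by (rule integral_pd_compact_support[OF CP]) (use z0 in \<open>auto simp: P_def B_def\<close>)
  have pdP: "pd m (P m) u = z u * pd m (q m) u + pd m z u * q m u" if u: "u \<in> \<Omega>" for m u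
  proof -
    have dz: "(z has_derivative frechet_derivative z (at u)) (at u)"
      using Ck_on_has_derivative[OF _ o u, of 0 z] Cz by simp
    have dq: "(q m has_derivative frechet_derivative (q m) (at u)) (at u)"
      using Ck_on_has_derivative[OF _ o u, of 0 "q m"] Cq by simp
    have "(P m has_derivative (\<lambda>v. z u * frechet_derivative (q m) (at u) v + frechet_derivative z (at u) v * q m u)) (at u)"
      by (rule has_derivative_transform_within_open[OF has_derivative_mult[OF dz dq] o u]) (simp add: P_def)
    from frechet_derivative_at[OF this, symmetric] show ?thesis by (simp add: pd_def)
  qed
  have cont: "continuous_on B h" if "continuous_on \<Omega> h" for h :: "real ^ 'k \<Rightarrow> real"
    using that B\<Omega> continuous_on_subset by blast
  have int: "h integrable_on B" if "continuous_on \<Omega> h" for h :: "real ^ 'k \<Rightarrow> real"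
    unfolding B_def by (rule integrable_continuous) (use cont[OF that] in \<open>simp add: B_def\<close>)
  have cz: "continuous_on \<Omega> z" "continuous_on \<Omega> (q m)" "continuous_on \<Omega> (pd m z)" "continuous_on \<Omega> (pd m (q m))" for m
    using Cz Cq Ck_on_imp_continuous_on continuous_on_pd by blast+
  have "0 = (\<Sum>m\<in>UNIV. integral B (pd m (P m)))" by (simp add: P0)
  also have "\<dots> = (\<Sum>m\<in>UNIV. integral B (\<lambda>u. z u * pd m (q m) u + pd m z u * q m u))"
    by (intro sum.cong refl integral_cong pdP) (use B\<Omega> in blast)
  also have "\<dots> = integral B (\<lambda>u. \<Sum>m\<in>UNIV. z u * pd m (q m) u + pd m z u * q m u)"
    by (rule integral_sum[symmetric]) (auto intro!: int continuous_intros cz)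
  also have "\<dots> = integral B (\<lambda>u. z u * divergence t (b i) u + pairing t (b i) (\<zeta> i) (pt (b i) u) * dens (b i) t u)"
  proof (rule integral_cong)
    fix u assume "u \<in> B"
    then have u: "u \<in> cimg (b i)" using B\<Omega> unfolding \<Omega>_def by blast
    show "(\<Sum>m\<in>UNIV. z u * pd m (q m) u + pd m z u * q m u) = z u * divergence t (b i) u + pairing t (b i) (\<zeta> i) (pt (b i) u) * dens (b i) t u"
    proof -
      have "divergence t (b i) u = (\<Sum>m\<in>UNIV. pd m (q m) u)" by (simp only: divergence_def q_def[abs_def])
      moreover have "pairing t (b i) (\<zeta> i) (pt (b i) u) * dens (b i) t u = (\<Sum>m\<in>UNIV. pd m z u * q m u)"
        unfolding pairing_chart[OF u] by (simp only: z_def[abs_def] q_def sum_distrib_right mult.assoc)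
      ultimately show ?thesis by (simp only: sum.distrib sum_distrib_left)
    qed
  qed
  also have "\<dots> = integral B (\<lambda>u. z u * divergence t (b i) u) + integral B (\<lambda>u. pairing t (b i) (\<zeta> i) (pt (b i) u) * dens (b i) t u)"
    by (rule integral_add; rule int; intro continuous_on_mult cz)
       (use divergence_continuous[OF t bS[OF i]] pairing_continuous[OF t i bS[OF i]] dens_continuous[OF t bS[OF i]] in \<open>simp_all add: \<Omega>_def\<close>)
  finally show ?thesis by (simp add: B_def z_def[abs_def])
qed

text \<open>After integration by parts in each box the integrands are restrictions of global
  functions. They can therefore be added up against the one measure \<open>dA t\<close>, where they
  cancel pointwise.\<close>

lemma divergence_theorem:
  assumes t: "t \<in> I"
  shows "(\<Sum>i\<in>J. integral (cbox (lo i) (hi i)) (\<lambda>u. \<zeta> i (pt (b i) u) * divergence t (b i) u)) = 0"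
proof -
  \<comment> \<open>The chosen chart makes the pairing a function on the hypersurface; chart
    independence identifies it with its expression in the chart \<open>b i\<close>.\<close>
  define \<omega> where "\<omega> i p = pairing t (chart_at S p) (\<zeta> i) p" for i p
  have \<omega>: "\<omega> i p = pairing t c (\<zeta> i) p" if "i \<in> J" "c \<in> charts_at S p" for i p c
    unfolding \<omega>_def by (rule pairing_chart_independent[OF t chart_at_mem[OF atlasS] that(2) \<zeta>_differentiable[OF that]])
  have \<omega>b: "\<omega> i (pt (b i) u) = pairing t (b i) (\<zeta> i) (pt (b i) u)" if "i \<in> J" "u \<in> cimg (b i)" for i u
    by (rule \<omega>[OF that(1) charts_at_pt[OF bS[OF that(1)] that(2)]])
  have c\<omega>: "continuous_on (cimg (b i)) (\<lambda>u. \<omega> i (pt (b i) u))" if "i \<in> J" for i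
    by (rule continuous_on_eq[OF pairing_continuous[OF t that bS[OF that]]]) (simp only: \<omega>b[OF that])
  \<comment> \<open>Off the closed set carried by the box the partition function vanishes on a
    neighbourhood, so its differential vanishes as well.\<close>
  have s\<omega>: "p \<in> fst (b i) \<and> snd (b i) p \<in> cbox (lo i) (hi i)" if i: "i \<in> J" and ne: "\<omega> i p \<noteq> 0" for i p
  proof (rule ccontr)
    assume not: "\<not> (p \<in> fst (b i) \<and> snd (b i) p \<in> cbox (lo i) (hi i))"
    define C where "C = {p \<in> fst (b i). snd (b i) p \<in> cbox (lo i) (hi i)}"
    have oC: "open (- C)" unfolding C_def by (rule open_Compl[OF chart_box_closed[OF atlasS bS[OF i] box[OF i]]])
    define c where "c = chart_at S p"
    have c: "c \<in> charts_at S p" unfolding c_def by (rule chart_at_mem[OF atlasS])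
    note cS = charts_atD[OF c]
    have o: "open (snd c ` (fst c \<inter> - C))" by (rule open_chart_image[OF atlasS cS(1) oC])
    have mem: "snd c p \<in> snd c ` (fst c \<inter> - C)" using not cS(2) by (simp add: C_def)
    have "(\<zeta> i \<circ> pt c) u = 0" if "u \<in> snd c ` (fst c \<inter> - C)" for u
    proof -
      have "pt c u \<notin> C" using that atlas_chart(5)[OF atlasS cS(1)] by auto
      then show ?thesis using supp[OF i, of "pt c u"] by (auto simp: C_def)
    qed
    from frechet_derivative_cong_open[OF o mem, of "\<zeta> i \<circ> pt c" "\<lambda>_. 0", OF this]
    have "pd j (\<zeta> i \<circ> pt c) (snd c p) = 0" for j by (simp add: pd_def)
    then have "\<omega> i p = 0" unfolding \<omega>_def c_def[symmetric] pairing_def by (simp add: inner_vec_def)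
    then show False using ne by simp
  qed
  have "(\<Sum>i\<in>J. LINT p|dA t. \<omega> i p * exp (- fbar t (x t p))) = (LINT p|dA t. (\<Sum>i\<in>J. \<omega> i p * exp (- fbar t (x t p))))"
    by (rule Bochner_Integration.integral_sum[symmetric]) (rule chart_integral(1)[OF t _ c\<omega> s\<omega>])
  also have "\<dots> = 0"
    unfolding sum_distrib_right[symmetric] \<omega>_def pairing_partition[OF chart_at_mem[OF atlasS]] by simp
  finally have lint: "(\<Sum>i\<in>J. LINT p|dA t. \<omega> i p * exp (- fbar t (x t p))) = 0" .
  have "sqrt (\<sigma> t ^ CARD('k)) * (\<Sum>i\<in>J. integral (cbox (lo i) (hi i)) (\<lambda>u. \<omega> i (pt (b i) u) * dens (b i) t u)) = 0"
    unfolding sum_distrib_left lint[symmetric]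
    by (rule sum.cong[OF refl]) (rule chart_integral(2)[OF t _ c\<omega> s\<omega>, symmetric])
  then have "(\<Sum>i\<in>J. integral (cbox (lo i) (hi i)) (\<lambda>u. \<omega> i (pt (b i) u) * dens (b i) t u)) = 0"
    using scale_pos[OF IT'[OF t]] by simp
  moreover have "integral (cbox (lo i) (hi i)) (\<lambda>u. \<zeta> i (pt (b i) u) * divergence t (b i) u) =
     - integral (cbox (lo i) (hi i)) (\<lambda>u. \<omega> i (pt (b i) u) * dens (b i) t u)" if "i \<in> J" for i
  proof -
    have "integral (cbox (lo i) (hi i)) (\<lambda>u. pairing t (b i) (\<zeta> i) (pt (b i) u) * dens (b i) t u)
       = integral (cbox (lo i) (hi i)) (\<lambda>u. \<omega> i (pt (b i) u) * dens (b i) t u)"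
      by (rule integral_cong) (simp only: \<omega>b[OF that subsetD[OF box[OF that]]])
    then show ?thesis unfolding integral_by_parts[OF t that] by (rule arg_cong)
  qed
  ultimately show ?thesis by (simp only: sum_negf minus_zero cong: sum.cong)
qed

section \<open>The dissipation rate\<close>

definition rate_density :: "real \<Rightarrow> ('s, 'k) chart \<Rightarrow> real ^ 'k \<Rightarrow> real" where
  "rate_density t c u = (defect t c (chart_at A (x t (pt c u))) (pt c u))\<^sup>2 * dens c t u"

definition rate :: "real \<Rightarrow> real" where
  "rate t = (\<Sum>i\<in>J. integral (cbox (lo i) (hi i)) (\<lambda>u. \<zeta> i (pt (b i) u) * rate_density t (b i) u))"

lemma dens_pos: "t \<in> I \<Longrightarrow> c \<in> S \<Longrightarrow> u \<in> cimg c \<Longrightarrow> dens c t u > 0"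
  using dens_smooth(2)[of c t u] by (simp add: dens_def del: image_iff)

text \<open>Combines two descriptions of one derivative: smoothness in time gives joint continuity,
  and the first variation gives the formula. That the formula holds for all charts \<open>a\<close>
  with the same \<open>d\<close> is used later to compare charts.\<close>

lemma dens_time_derivative:
  assumes "c \<in> S"
  obtains d where "\<And>t u. t \<in> I \<Longrightarrow> u \<in> cimg c \<Longrightarrow> ((\<lambda>s. dens c s u) has_vector_derivative d t u) (at t within I)"
    "continuous_on (I \<times> cimg c) (\<lambda>(t, u). d t u)"
    "\<And>t u a. t \<in> I \<Longrightarrow> u \<in> cimg c \<Longrightarrow> a \<in> charts_at A (x t (pt c u)) \<Longrightarrow>
       d t u = - (defect t c a (pt c u))\<^sup>2 * dens c t u + divergence t c u"
proof -
  obtain d where d: "\<And>t u. t \<in> I \<Longrightarrow> u \<in> cimg c \<Longrightarrow> ((\<lambda>s. dens c s u) has_vector_derivative d t u) (at t within I)"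
    "continuous_on (I \<times> cimg c) (\<lambda>(t, u). d t u)"
    using smooth_on_time_derivative[OF dens_smooth(1)[OF assms] intI] by metis
  have "d t u = - (defect t c a (pt c u))\<^sup>2 * dens c t u + divergence t c u"
    if t: "t \<in> I" and u: "u \<in> cimg c" and a: "a \<in> charts_at A (x t (pt c u))" for t u a
    using vector_derivative_unique_within[OF interval_at_within_nontrivial[OF intI t] d(1)[OF t u]
        density_derivative[OF t assms u a, unfolded has_real_derivative_iff_has_vector_derivative]]
    by (simp add: divergence_def)
  with d show ?thesis using that by blast
qed

text \<open>The chart chosen inside \<open>rate_density\<close> may jump from point to point.
  Continuity follows since the value is the divergence minus the time derivative of the density,
  which are both continuous.\<close>

lemma rate_density_continuous:
  assumes "t \<in> I" "c \<in> S"
  shows "continuous_on (cimg c) (rate_density t c)"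
proof -
  obtain d where d: "continuous_on (I \<times> cimg c) (\<lambda>(t, u). d t u)"
    "\<And>t u a. t \<in> I \<Longrightarrow> u \<in> cimg c \<Longrightarrow> a \<in> charts_at A (x t (pt c u)) \<Longrightarrow>
       d t u = - (defect t c a (pt c u))\<^sup>2 * dens c t u + divergence t c u"
    using dens_time_derivative[OF assms(2)] by metis
  have "continuous_on (cimg c) (\<lambda>u. (\<lambda>(t, u). d t u) (t, u))"
    by (rule continuous_on_compose2[OF d(1)]) (use assms(1) in \<open>auto intro!: continuous_intros\<close>)
  then have "continuous_on (cimg c) (\<lambda>u. divergence t c u - d t u)"
    using divergence_continuous[OF assms] by (intro continuous_on_diff) auto
  then show ?thesis
    by (rule continuous_on_eq) (use d(2)[OF assms(1) _ chart_at_mem[OF atlasA]] in \<open>simp add: rate_density_def\<close>)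
qed

text \<open>Boxes and partition functions are fixed, so each integral can be differentiated under
  the integral sign; the divergence terms then cancel in the sum over the partition.\<close>

lemma mass_derivative:
  assumes t: "t \<in> I"
  shows "(mass has_real_derivative - rate t) (at t within I)"
proof -
  have "((\<lambda>s. integral (cbox (lo i) (hi i)) (\<lambda>u. \<zeta> i (pt (b i) u) * dens (b i) s u)) has_vector_derivative
     integral (cbox (lo i) (hi i)) (\<lambda>u. \<zeta> i (pt (b i) u) * divergence t (b i) u)
     - integral (cbox (lo i) (hi i)) (\<lambda>u. \<zeta> i (pt (b i) u) * rate_density t (b i) u)) (at t within I)" if i: "i \<in> J" for i
  proof -
    let ?B = "cbox (lo i) (hi i)"
    obtain d where d: "\<And>t u. t \<in> I \<Longrightarrow> u \<in> cimg (b i) \<Longrightarrow> ((\<lambda>s. dens (b i) s u) has_vector_derivative d t u) (at t within I)"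
      "continuous_on (I \<times> cimg (b i)) (\<lambda>(t, u). d t u)"
      "\<And>t u a. t \<in> I \<Longrightarrow> u \<in> cimg (b i) \<Longrightarrow> a \<in> charts_at A (x t (pt (b i) u)) \<Longrightarrow>
         d t u = - (defect t (b i) a (pt (b i) u))\<^sup>2 * dens (b i) t u + divergence t (b i) u"
      using dens_time_derivative[OF bS[OF i]] by metis
    have sub: "u \<in> cimg (b i)" if "u \<in> ?B" for u using box[OF i] that by blast
    have cB: "continuous_on ?B h" if "continuous_on (cimg (b i)) h" for h :: "real ^ 'k \<Rightarrow> real"
      by (rule continuous_on_subset[OF that box[OF i]])
    note c\<zeta> = \<zeta>_continuous[OF i bS[OF i]]
    have "((\<lambda>s. integral ?B (\<lambda>u. \<zeta> i (pt (b i) u) * dens (b i) s u)) has_vector_derivative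
       integral ?B (\<lambda>u. \<zeta> i (pt (b i) u) * d t u)) (at t within I)"
    proof (rule leibniz_rule_vector_derivative[OF _ _ _ t])
      fix s u assume s: "s \<in> I" and u: "u \<in> ?B"
      show "((\<lambda>s. \<zeta> i (pt (b i) u) * dens (b i) s u) has_vector_derivative \<zeta> i (pt (b i) u) * d s u) (at s within I)"
        by (rule has_vector_derivative_mult_right[OF d(1)[OF s sub[OF u]]])
    next
      fix s assume s: "s \<in> I"
      show "(\<lambda>u. \<zeta> i (pt (b i) u) * dens (b i) s u) integrable_on ?B"
        by (intro integrable_continuous cB continuous_on_mult c\<zeta> dens_continuous[OF s bS[OF i]])
    next
      have "continuous_on (I \<times> ?B) (\<lambda>(t, u). d t u)"
        by (rule continuous_on_subset[OF d(2)]) (use box[OF i] in blast)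
      moreover have "continuous_on (I \<times> ?B) (\<lambda>w. \<zeta> i (pt (b i) (snd w)))"
        by (rule continuous_on_compose2[OF cB[OF c\<zeta>]]) (auto intro!: continuous_intros)
      ultimately show "continuous_on (I \<times> ?B) (\<lambda>(s, u). \<zeta> i (pt (b i) u) * d s u)"
        unfolding case_prod_unfold by (intro continuous_on_mult)
      show "convex I" using intI(1) by (simp add: is_interval_convex)
    qed
    moreover have "integral ?B (\<lambda>u. \<zeta> i (pt (b i) u) * d t u) =
      integral ?B (\<lambda>u. \<zeta> i (pt (b i) u) * divergence t (b i) u - \<zeta> i (pt (b i) u) * rate_density t (b i) u)"
    proof (rule integral_cong)
      fix u assume "u \<in> ?B"
      from d(3)[OF t sub[OF this] chart_at_mem[OF atlasA]]
      show "\<zeta> i (pt (b i) u) * d t u = \<zeta> i (pt (b i) u) * divergence t (b i) u - \<zeta> i (pt (b i) u) * rate_density t (b i) u"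
        by (simp add: rate_density_def right_diff_distrib[symmetric])
    qed
    moreover have "\<dots> = integral ?B (\<lambda>u. \<zeta> i (pt (b i) u) * divergence t (b i) u)
      - integral ?B (\<lambda>u. \<zeta> i (pt (b i) u) * rate_density t (b i) u)"
      by (intro integral_diff integrable_continuous cB continuous_on_mult c\<zeta>
          divergence_continuous[OF t bS[OF i]] rate_density_continuous[OF t bS[OF i]])
    ultimately show ?thesis by simp
  qed
  then have "(mass has_vector_derivative (\<Sum>i\<in>J. integral (cbox (lo i) (hi i)) (\<lambda>u. \<zeta> i (pt (b i) u) * divergence t (b i) u)
     - integral (cbox (lo i) (hi i)) (\<lambda>u. \<zeta> i (pt (b i) u) * rate_density t (b i) u))) (at t within I)"
    unfolding mass_def[abs_def] by (rule has_vector_derivative_sum)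
  then show ?thesis
    unfolding sum_subtractf divergence_theorem[OF t]
    by (simp add: rate_def has_real_derivative_iff_has_vector_derivative)
qed

text \<open>Each summand integrates a nonnegative continuous function. If the sum is zero, so is
  each integral, and on a box with nonempty interior the integrand itself must vanish.\<close>

lemma rate_nonneg:
  assumes t: "t \<in> I"
  shows "rate t \<ge> 0"
    and "rate t = 0 \<Longrightarrow> i \<in> J \<Longrightarrow> u \<in> cbox (lo i) (hi i) \<Longrightarrow> \<zeta> i (pt (b i) u) * rate_density t (b i) u = 0"
proof -
  let ?r = "\<lambda>i u. \<zeta> i (pt (b i) u) * rate_density t (b i) u"
  have nn: "?r i u \<ge> 0" if "i \<in> J" "u \<in> cbox (lo i) (hi i)" for i u
    using nonneg dens_pos[OF t bS[OF that(1)] subsetD[OF box[OF that(1)] that(2)]]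
    by (simp add: rate_density_def)
  have cont: "continuous_on (cbox (lo i) (hi i)) (?r i)" if "i \<in> J" for i
    by (rule continuous_on_subset[OF _ box[OF that]])
       (intro continuous_on_mult \<zeta>_continuous[OF that bS[OF that]] rate_density_continuous[OF t bS[OF that]])
  have int: "?r i integrable_on cbox (lo i) (hi i)" if "i \<in> J" for i by (rule integrable_continuous[OF cont[OF that]])
  have pos: "integral (cbox (lo i) (hi i)) (?r i) \<ge> 0" if "i \<in> J" for i
    by (rule integral_nonneg[OF int[OF that] nn[OF that]])
  then show "rate t \<ge> 0" unfolding rate_def by (rule sum_nonneg)
  show "?r i u = 0" if "rate t = 0" "i \<in> J" "u \<in> cbox (lo i) (hi i)"
  proof -
    have "integral (cbox (lo i) (hi i)) (?r i) = 0"
      by (rule sum_nonneg_0[where f = "\<lambda>i. integral (cbox (lo i) (hi i)) (?r i)", OF finJ pos])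
         (use that(1,2) in \<open>simp_all add: rate_def\<close>)
    then have "(?r i has_integral 0) (cbox (lo i) (hi i))" using integrable_integral[OF int[OF that(2)]] by simp
    from has_integral_0_cbox_imp_0[OF cont[OF that(2)] _ this box_nonempty[OF that(2)] that(3)]
    show ?thesis using nn[OF that(2)] box_subset_cbox by blast
  qed
qed

text \<open>The velocity of the flow does not refer to a chart of the hypersurface. Both values of
  the mean curvature multiply the same nonzero normal to give it, so they agree.\<close>

lemma defect_change_source:
  assumes t: "t \<in> I" and "c \<in> charts_at S p" "c' \<in> charts_at S p" "a \<in> charts_at A (x t p)"
  shows "defect t c a p = defect t c' a p"
proof -
  have "mean_curvature A c a (gbar t) (x t) (e t) p *\<^sub>R e t p a = mean_curvature A c' a (gbar t) (x t) (e t) p *\<^sub>R e t p a"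
    by (rule vector_derivative_unique_within[OF interval_at_within_nontrivial[OF intI t]
          x_velocity[OF t assms(2,4)] x_velocity[OF t assms(3,4)]])
  moreover have "e t p a \<noteq> 0"
    using e_normal[OF t] assms(2,4) unfolding unit_normal_def by (metis inner_zero_left zero_neq_one)
  ultimately show ?thesis by (simp add: defect_def)
qed

text \<open>The time derivative, the divergence and the positive density do not mention the target
  chart, so the remaining term, the squared defect, cannot depend on it either. The square is all
  that is needed to detect zeros.\<close>

lemma defect_square_change_target:
  assumes t: "t \<in> I" and c: "c \<in> charts_at S p" and a: "a \<in> charts_at A (x t p)" "a' \<in> charts_at A (x t p)"
  shows "(defect t c a p)\<^sup>2 = (defect t c a' p)\<^sup>2"
proof -
  note cS = charts_atD[OF c]
  have u: "snd c p \<in> cimg c" "pt c (snd c p) = p" using cS atlas_chart(5)[OF atlasS] by auto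
  obtain d where d: "\<And>t u a. t \<in> I \<Longrightarrow> u \<in> cimg c \<Longrightarrow> a \<in> charts_at A (x t (pt c u)) \<Longrightarrow>
       d t u = - (defect t c a (pt c u))\<^sup>2 * dens c t u + divergence t c u"
    using dens_time_derivative[OF cS(1)] by metis
  have "(defect t c a p)\<^sup>2 * dens c t (snd c p) = (defect t c a' p)\<^sup>2 * dens c t (snd c p)"
    using d[OF t u(1), of a] d[OF t u(1), of a'] a unfolding u(2) by auto
  then show ?thesis using dens_pos[OF t cS(1) u(1)] by simp
qed

lemma rate_zero_iff:
  assumes t: "t \<in> I"
  shows "rate t = 0 \<longleftrightarrow> (\<forall>p. \<forall>c\<in>charts_at S p. \<forall>a\<in>charts_at A (x t p). defect t c a p = 0)"
proof (intro iffI allI ballI)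
  fix p c a assume r: "rate t = 0" and c: "c \<in> charts_at S p" and a: "a \<in> charts_at A (x t p)"
  obtain i where i: "i \<in> J" "\<zeta> i p \<noteq> 0"
    using partition[of p] by (metis sum.neutral zero_neq_one)
  define u where "u = snd (b i) p"
  note s = supp[OF i]
  have bi: "b i \<in> charts_at S p" by (rule charts_atI[OF bS[OF i(1)] conjunct1[OF s]])
  have u: "u \<in> cbox (lo i) (hi i)" "pt (b i) u = p"
    using s atlas_chart(5)[OF atlasS bS[OF i(1)]] by (simp_all add: u_def)
  have u': "u \<in> cimg (b i)" by (rule subsetD[OF box[OF i(1)] u(1)])
  have "rate_density t (b i) u = 0" using rate_nonneg(2)[OF t r i(1) u(1)] i(2) u(2) by simp
  then have "(defect t (b i) (chart_at A (x t p)) p)\<^sup>2 = 0"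
    unfolding rate_density_def u(2) using dens_pos[OF t bS[OF i(1)] u'] by simp
  then have "defect t (b i) a p = 0"
    using defect_square_change_target[OF t bi a chart_at_mem[OF atlasA]] by simp
  then show "defect t c a p = 0" using defect_change_source[OF t c bi a] by simp
next
  assume z: "\<forall>p. \<forall>c\<in>charts_at S p. \<forall>a\<in>charts_at A (x t p). defect t c a p = 0"
  have "integral (cbox (lo i) (hi i)) (\<lambda>u. \<zeta> i (pt (b i) u) * rate_density t (b i) u) = integral (cbox (lo i) (hi i)) (\<lambda>u. 0)" if i: "i \<in> J" for i
  proof (rule integral_cong)
    fix u assume "u \<in> cbox (lo i) (hi i)"
    then have "u \<in> cimg (b i)" using box[OF i] by blast
    then have "rate_density t (b i) u = 0"
      using z charts_at_pt[OF bS[OF i]] chart_at_mem[OF atlasA] by (simp add: rate_density_def del: image_iff)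
    then show "\<zeta> i (pt (b i) u) * rate_density t (b i) u = 0" by simp
  qed
  then show "rate t = 0" unfolding rate_def by simp
qed

section \<open>Monotonicity and the equality case\<close>

lemma mass_antimono: "antimono_on I mass"
proof (rule monotone_onI)
  fix s t assume st: "s \<in> I" "t \<in> I" "s \<le> t"
  show "mass t \<le> mass s"
  proof (cases "s = t")
    case False
    then have lt: "s < t" using st by simp
    have sub: "{s..t} \<subseteq> I" using intI(1) st by (meson is_interval_1 atLeastAtMost_iff subsetI)
    have "\<exists>r\<in>{s<..<t}. mass t - mass s = (\<lambda>h. - rate r * h) (t - s)"
    proof (rule mvt_simple[OF lt])
      fix r assume "s \<le> r" "r \<le> t"
      then have "r \<in> I" using sub by auto
      from mass_derivative[OF this] show "(mass has_derivative (*) (- rate r)) (at r within {s..t})"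
        unfolding has_field_derivative_def using has_derivative_subset[OF _ sub] by blast
    qed
    then obtain r where r: "r \<in> {s<..<t}" "mass t - mass s = - rate r * (t - s)" by blast
    then have "r \<in> I" using sub by auto
    from rate_nonneg(1)[OF this] lt have "rate r * (t - s) \<ge> 0" by simp
    then show ?thesis using r(2) by simp
  qed simp
qed

lemma mass_constant_iff: "mass constant_on I \<longleftrightarrow> (\<forall>t\<in>I. rate t = 0)"
proof (intro iffI ballI)
  fix t assume "mass constant_on I" and t: "t \<in> I"
  then obtain m where m: "\<And>s. s \<in> I \<Longrightarrow> mass s = m" unfolding constant_on_def by blast
  have "((\<lambda>_. m) has_vector_derivative - rate t) (at t within I)"
    by (rule has_vector_derivative_transform[OF t _ mass_derivative[OF t, unfolded has_real_derivative_iff_has_vector_derivative]])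
       (simp add: m)
  from vector_derivative_unique_within[OF interval_at_within_nontrivial[OF intI t] this has_vector_derivative_const]
  show "rate t = 0" by simp
next
  assume z: "\<forall>t\<in>I. rate t = 0"
  have "\<exists>m. \<forall>t\<in>I. mass t = m"
  proof (rule has_derivative_zero_constant)
    show "convex I" using intI(1) by (simp add: is_interval_convex)
    show "(mass has_derivative (\<lambda>h. 0)) (at t within I)" if "t \<in> I" for t
      using mass_derivative[OF that] z that
      by (simp add: has_real_derivative_iff_has_vector_derivative has_vector_derivative_def)
  qed
  then show "mass constant_on I" unfolding constant_on_def by blast
qed

end

text \<open>With \<open>n = k + 1\<close> the exponent in \<open>Phi\<close> is minus half the
  dimension of the hypersurface, which cancels the power of the scale in
  \<open>weighted_area_eq\<close>.\<close>

lemma Phi_scale: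
  assumes "t \<in> time_domain kind" "n = k + 1" "area t = sqrt (soliton_scale kind t ^ k) * m"
  shows "Phi kind n area t = m"
proof -
  have pos: "z powr (- ((real n - 1) / 2)) * (sqrt (z ^ k) * m) = m" if "z > 0" for z :: real
  proof -
    have "sqrt (z ^ k) = z powr (real k / 2)"
      using that by (simp add: powr_half_sqrt[symmetric] powr_realpow[symmetric] powr_powr)
    then show ?thesis using that assms(2) by (simp add: powr_add[symmetric] mult.assoc[symmetric])
  qed
  show ?thesis using assms pos by (cases kind) auto
qed

theorem theorem2:
  fixes A :: "('m::{t2_space, second_countable_topology}, 'n::finite) chart set"
    and S :: "('s::{t2_space, second_countable_topology}, 'k::finite) chart set"
    and kind :: soliton_kind
    and gbar :: "real \<Rightarrow> ('m, 'n) metric"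
    and wbar fbar :: "real \<Rightarrow> 'm \<Rightarrow> real"
    and I :: "real set"
    and x :: "real \<Rightarrow> 's \<Rightarrow> 'm"
    and e :: "real \<Rightarrow> ('s, 'm, 'n) field_along"
    and dA :: "real \<Rightarrow> 's measure"
    and \<Phi> :: "real \<Rightarrow> real"
  assumes "CARD('n) \<ge> 3" and "CARD('n) = CARD('k) + 1"
    and "manifold A"
    and "manifold S" and "compact (UNIV :: 's set)"
    and "gradient_soliton A kind gbar wbar fbar"
    and "is_interval I" and "interior I \<noteq> {}" and "I \<subseteq> time_domain kind"
    and "mean_curvature_flow S A I gbar x e"
    and "\<And>t. t \<in> I \<Longrightarrow> riemannian_measure S (pullback_metric A (x t) (gbar t)) (dA t)"
    and "\<And>t. \<Phi> t = Phi kind CARD('n) (\<lambda>s. weighted_area (dA s) (fbar s) (x s)) t"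
  shows "antimono_on I \<Phi> \<and>
    (\<Phi> constant_on I \<longleftrightarrow> mean_curvature_solitons S A I gbar fbar x e)"
proof -
  have atlas: "smooth_atlas A" "smooth_atlas S" using assms(3,4) by (auto simp: manifold_def)
  have bar: "\<And>t. t \<in> time_domain kind \<Longrightarrow> riemannian_metric A (gbar t)"
    using assms(6) by (simp add: gradient_soliton_def extended_ricci_flow_def metric_family_def)
  obtain g w f \<psi> where sol: "riemannian_metric A g" "smooth_fun A f" "smooth_family A A (time_domain kind) \<psi>"
    "\<forall>t\<in>time_domain kind. diffeomorphism A (\<psi> t)"
    "\<forall>t\<in>time_domain kind. \<forall>p. \<forall>c\<in>charts_at A (\<psi> t p).
       ((\<lambda>s. snd c (\<psi> s p)) has_vector_derivative
          (1 / soliton_scale kind t) *\<^sub>R gradient g f c (\<psi> t p)) (at t)"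
    "\<forall>t\<in>time_domain kind. \<forall>p.
       (\<forall>c\<in>charts_at A p. gbar t c p = soliton_scale kind t *\<^sub>R pullback_metric A (\<psi> t) g c p) \<and>
       wbar t p = w (\<psi> t p) \<and> fbar t p = f (\<psi> t p)"
    using assms(6) unfolding gradient_soliton_def by blast
  \<comment> \<open>The partition is obtained before the locale is interpreted because it is among
    the locale parameters; the conclusion does not depend on its choice.\<close>
  show ?thesis
  proof (rule C1_partition_of_unity[OF atlas(2) assms(5)])
    fix J :: "'s set" and b lo hi and \<zeta> :: "'s \<Rightarrow> 's \<Rightarrow> real" assume pou:
      "finite J" "\<And>i. i \<in> J \<Longrightarrow> b i \<in> S" "\<And>i. i \<in> J \<Longrightarrow> cbox (lo i) (hi i) \<subseteq> cimg (b i)"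
      "\<And>i p. \<zeta> i p \<ge> 0" "\<And>i p. i \<in> J \<Longrightarrow> \<zeta> i p \<noteq> 0 \<Longrightarrow> p \<in> fst (b i) \<and> snd (b i) p \<in> cbox (lo i) (hi i)"
      "\<And>i c. i \<in> J \<Longrightarrow> c \<in> S \<Longrightarrow> Ck_on 1 (cimg c) (\<lambda>u. \<zeta> i (pt c u))"
      "\<And>p. (\<Sum>i\<in>J. \<zeta> i p) = 1" "\<And>i. i \<in> J \<Longrightarrow> box (lo i) (hi i) \<noteq> {}"
    interpret closed_pulled_back_flow A S "time_domain kind" I "soliton_scale kind" g f \<psi> gbar fbar x e dA J b lo hi \<zeta>
    proof unfold_locales
      show "open (time_domain kind)" by (cases kind) auto
      show "0 < soliton_scale kind t" if "t \<in> time_domain kind" for t using that by (cases kind) auto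
      show "((\<lambda>s. snd c (\<psi> s p)) has_vector_derivative
          (1 / soliton_scale kind t) *\<^sub>R gradient g f c (\<psi> t p)) (at t)"
        if "t \<in> time_domain kind" "c \<in> charts_at A (\<psi> t p)" for t p c
        using sol(5) that by blast
      show "gbar t c p = soliton_scale kind t *\<^sub>R pullback_metric A (\<psi> t) g c p"
        if "t \<in> time_domain kind" "c \<in> charts_at A p" for t p c
        using sol(6) that by blast
      show "fbar t p = f (\<psi> t p)" if "t \<in> time_domain kind" for t p
        using sol(6) that by blast
      show "diffeomorphism A (\<psi> t)" if "t \<in> time_domain kind" for t
        using sol(4) that by blast
    qed (fact atlas assms(2,7-11) bar sol(1-3) pou)+
    have \<Phi>: "\<Phi> t = mass t" if "t \<in> I" for t
      unfolding assms(12) using that assms(9)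
      by (intro Phi_scale[OF _ assms(2) weighted_area_eq]) auto
    have "antimono_on I \<Phi>"
      using mass_antimono \<Phi> by (simp add: monotone_on_def)
    moreover have "\<Phi> constant_on I \<longleftrightarrow> mass constant_on I"
      using \<Phi> by (simp add: constant_on_def)
    moreover have "mass constant_on I \<longleftrightarrow> mean_curvature_solitons S A I gbar fbar x e"
      unfolding mass_constant_iff mean_curvature_solitons_def using rate_zero_iff by (simp add: defect_def)
    ultimately show ?thesis by simp
  qed
qed

end
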